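(* Let $G$ be a finite group, let $\alpha=(D_g,\alpha_g)_{g\in G}$ be a unital partial action of $G$ on a commutative ring $R$, and assume that $R\supseteq R^\alpha$ is an $\alpha$-partial Galois extension. Let $$\Phi_0\colon G\to\mathbf{PicS}_{R^\alpha}(R),\qquad g\mapsto[{}_g(D_{g^{-1}})_I].$$ Then: 1. $\Phi_0$ is a partial representation of $G$ in $\mathbf{PicS}_{R^\alpha}(R)$ with $\Phi_0(g)\Phi_0(g^{-1})=[D_g]$ for all $g\in G$. 2. $\Phi_0(g)[D_h]=[D_{gh}]\Phi_0(g)$ for all $g,h\in G$. In particular, $\Phi_0(g)[D_{g^{-1}}]=\Phi_0(g)=[D_g]\Phi_0(g)$. 3. For any $g\in G$ and $[P]\in X_{g^{-1}}$ there is an $R$-$R$-bimodule isomorphism $P_g\cong{}_g(D_{g^{-1}})_I\otimes_R P\otimes_R{}_{g^{-1}}(D_g)_I$, that is, $[P_g]=\Phi_0(g)[P]\Phi_0(g^{-1})$.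
   Context: A unital partial action $\alpha=(D_g,\alpha_g)_{g\in G}$ of a group $G$ on a commutative ring $R$ consists of ideals $D_g=R1_g$ generated by idempotents $1_g$ (possibly zero) and ring isomorphisms $\alpha_g\colon D_{g^{-1}}\to D_g$ such that $D_1=R$, $\alpha_1=\mathrm{id}_R$, $\alpha_g(D_{g^{-1}}D_h)=D_gD_{gh}$, and $\alpha_g(\alpha_h(t))=\alpha_{gh}(t)$ for all $t\in D_{h^{-1}}D_{(gh)^{-1}}$. $R^\alpha=\{r\in R:\alpha_g(r1_{g^{-1}})=r1_g\ \forall g\in G\}$. The extension $R\supseteq R^\alpha$ is $\alpha$-partial Galois if there are $m\in\mathbb N$ and $x_i,y_i\in R$ ($1\le i\le m$) with $\sum_i x_i\alpha_g(y_i1_{g^{-1}})=\delta_{1,g}$ for all $g\in G$. $\mathbf{PicS}_{R^\alpha}(R)$ is the monoid, under $[P][Q]=[P\otimes_RQ]$, of isomorphism classes of $R$-$R$-bimodules $P$ that are central over $R^\alpha$, finitely generated projective as left $R$-modules, and admit a surjective $R^\alpha$-algebra homomorphism $R^{\mathrm{op}}\to\mathrm{End}_R(P)$ (endomorphisms of the left module). $\mathbf{PicS}(R)=\mathbf{PicS}_R(R)$ is its submonoid of classes of central $R$-$R$-bimodules (modules over $R$ are viewed as central bimodules; in particular $[D_g]$ is the class of $D_g$ with its usual actions). $X_g=[D_g]\mathbf{PicS}(R)=\{[E]\in\mathbf{PicS}(R):E=1_gE\}$. ${}_g(D_{g^{-1}})_I$ is $D_{g^{-1}}$ with the $R$-$R$-bimodule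 structure $r*d=\alpha_{g^{-1}}(r1_g)d$, $d*r=dr$. For $[P]\in X_{g^{-1}}$, $P_g$ is the abelian group $P$ with the central $R$-action $r\bullet x=\alpha_{g^{-1}}(r1_g)x=x\bullet r$. A (unital) partial representation of $G$ in a monoid $S$ is a map $\Phi\colon G\to S$ such that $\Phi(g^{-1})\Phi(g)\Phi(h)=\Phi(g^{-1})\Phi(gh)$, $\Phi(g)\Phi(h)\Phi(h^{-1})=\Phi(gh)\Phi(h^{-1})$ and $\Phi(1_G)=1_S$ for all $g,h\in G$. *)

theory Defs
  imports "HOL-Algebra.Algebra"
begin

section \<open>Bimodules over a commutative ring\<close>

text \<open>The ring fields \<^const>\<open>monoid.mult\<close> and \<^const>\<open>monoid.one\<close> inherited from the library's
  module record carry no meaning; no notion below refers to them for a bimodule.\<close>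

record ('a, 'b) bimod = "('a, 'b) module" +
  rsmult :: "['b, 'a] \<Rightarrow> 'b"  (infixl \<open>\<triangleleft>\<index>\<close> 70)

locale bimodule = module R M for R and M :: "('a, 'b) bimod" (structure) +
  assumes rsmult_closed:
      "\<lbrakk>a \<in> carrier R; x \<in> carrier M\<rbrakk> \<Longrightarrow> x \<triangleleft>\<^bsub>M\<^esub> a \<in> carrier M"
    and rsmult_l_distr:
      "\<lbrakk>a \<in> carrier R; x \<in> carrier M; y \<in> carrier M\<rbrakk> \<Longrightarrow>
        (x \<oplus>\<^bsub>M\<^esub> y) \<triangleleft>\<^bsub>M\<^esub> a = x \<triangleleft>\<^bsub>M\<^esub> a \<oplus>\<^bsub>M\<^esub> y \<triangleleft>\<^bsub>M\<^esub> a"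
    and rsmult_r_distr:
      "\<lbrakk>a \<in> carrier R; b \<in> carrier R; x \<in> carrier M\<rbrakk> \<Longrightarrow>
        x \<triangleleft>\<^bsub>M\<^esub> (a \<oplus>\<^bsub>R\<^esub> b) = x \<triangleleft>\<^bsub>M\<^esub> a \<oplus>\<^bsub>M\<^esub> x \<triangleleft>\<^bsub>M\<^esub> b"
    and rsmult_assoc:
      "\<lbrakk>a \<in> carrier R; b \<in> carrier R; x \<in> carrier M\<rbrakk> \<Longrightarrow>
        x \<triangleleft>\<^bsub>M\<^esub> (a \<otimes>\<^bsub>R\<^esub> b) = (x \<triangleleft>\<^bsub>M\<^esub> a) \<triangleleft>\<^bsub>M\<^esub> b"
    and rsmult_one: "x \<in> carrier M \<Longrightarrow> x \<triangleleft>\<^bsub>M\<^esub> \<one>\<^bsub>R\<^esub> = x"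
    and smult_rsmult:
      "\<lbrakk>a \<in> carrier R; b \<in> carrier R; x \<in> carrier M\<rbrakk> \<Longrightarrow>
        (a \<odot>\<^bsub>M\<^esub> x) \<triangleleft>\<^bsub>M\<^esub> b = a \<odot>\<^bsub>M\<^esub> (x \<triangleleft>\<^bsub>M\<^esub> b)"

definition left_hom ::
    "('a, 'r) ring_scheme \<Rightarrow> ('a, 'b, 'm) module_scheme \<Rightarrow> ('a, 'c, 'n) module_scheme \<Rightarrow> ('b \<Rightarrow> 'c) set"
  where "left_hom R M N = {f \<in> carrier M \<rightarrow> carrier N.
    (\<forall>x \<in> carrier M. \<forall>y \<in> carrier M. f (x \<oplus>\<^bsub>M\<^esub> y) = f x \<oplus>\<^bsub>N\<^esub> f y) \<and>
    (\<forall>a \<in> carrier R. \<forall>x \<in> carrier M. f (a \<odot>\<^bsub>M\<^esub> x) = a \<odot>\<^bsub>N\<^esub> f x)}"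

definition bimod_hom ::
    "('a, 'r) ring_scheme \<Rightarrow> ('a, 'b) bimod \<Rightarrow> ('a, 'c) bimod \<Rightarrow> ('b \<Rightarrow> 'c) set"
  where "bimod_hom R M N = {f \<in> left_hom R M N.
    \<forall>a \<in> carrier R. \<forall>x \<in> carrier M. f (x \<triangleleft>\<^bsub>M\<^esub> a) = f x \<triangleleft>\<^bsub>N\<^esub> a}"

definition bimod_iso ::
    "('a, 'r) ring_scheme \<Rightarrow> ('a, 'b) bimod \<Rightarrow> ('a, 'c) bimod \<Rightarrow> bool"
  where "bimod_iso R M N \<longleftrightarrow> bimodule R M \<and> bimodule R N \<and>
    (\<exists>f \<in> bimod_hom R M N. bij_betw f (carrier M) (carrier N))"


section \<open>Tensor product over the ring\<close>

text \<open>\<open>P \<otimes>\<^sub>R Q\<close> is the free abelian group on \<open>P \<times> Q\<close> modulo the subgroup generated by the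
  usual balancedness relations. The left action comes from \<open>P\<close>, the right action from \<open>Q\<close>; both are
  first defined on formal sums, and then map a coset \<open>C\<close> to the coset that contains the image
  of \<open>C\<close>.\<close>

definition tensor_rels ::
    "('a, 'r) ring_scheme \<Rightarrow> ('a, 'b) bimod \<Rightarrow> ('a, 'c) bimod \<Rightarrow> ('b \<times> 'c \<Rightarrow>\<^sub>0 int) set"
  where "tensor_rels R P Q =
    {frag_of (p \<oplus>\<^bsub>P\<^esub> p', q) - frag_of (p, q) - frag_of (p', q) | p p' q.
       p \<in> carrier P \<and> p' \<in> carrier P \<and> q \<in> carrier Q} \<union>
    {frag_of (p, q \<oplus>\<^bsub>Q\<^esub> q') - frag_of (p, q) - frag_of (p, q') | p q q'.
       p \<in> carrier P \<and> q \<in> carrier Q \<and> q' \<in> carrier Q} \<union>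
    {frag_of (p \<triangleleft>\<^bsub>P\<^esub> a, q) - frag_of (p, a \<odot>\<^bsub>Q\<^esub> q) | p a q.
       p \<in> carrier P \<and> a \<in> carrier R \<and> q \<in> carrier Q}"

definition tensor ::
    "('a, 'r) ring_scheme \<Rightarrow> ('a, 'b) bimod \<Rightarrow> ('a, 'c) bimod \<Rightarrow> ('a, ('b \<times> 'c \<Rightarrow>\<^sub>0 int) set) bimod"
  where "tensor R P Q =
    (let F = free_Abelian_group (carrier P \<times> carrier Q);
         N = generate F (tensor_rels R P Q)
     in \<lparr>carrier = carrier (F Mod N),
         monoid.mult = undefined, monoid.one = undefined,
         ring.zero = \<one>\<^bsub>F Mod N\<^esub>,
         ring.add = (\<lambda>C D. C \<otimes>\<^bsub>F Mod N\<^esub> D),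
         smult = (\<lambda>a C. N <#>\<^bsub>F\<^esub> (frag_extend (\<lambda>(p, q). frag_of (a \<odot>\<^bsub>P\<^esub> p, q)) ` C)),
         rsmult = (\<lambda>C a. N <#>\<^bsub>F\<^esub> (frag_extend (\<lambda>(p, q). frag_of (p, q \<triangleleft>\<^bsub>Q\<^esub> a)) ` C))\<rparr>)"


section \<open>The Picard monoids\<close>

definition free_module :: "('a, 'r) ring_scheme \<Rightarrow> nat \<Rightarrow> ('a, nat \<Rightarrow> 'a) module"
  where "free_module R n =
    \<lparr>carrier = {..<n} \<rightarrow>\<^sub>E carrier R, monoid.mult = undefined, monoid.one = undefined,
     ring.zero = (\<lambda>i \<in> {..<n}. \<zero>\<^bsub>R\<^esub>), ring.add = (\<lambda>u v. \<lambda>i \<in> {..<n}. u i \<oplus>\<^bsub>R\<^esub> v i),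
     smult = (\<lambda>a u. \<lambda>i \<in> {..<n}. a \<otimes>\<^bsub>R\<^esub> u i)\<rparr>"

text \<open>A finitely generated projective module is a direct summand of some \<open>R\<^sup>n\<close>, i.e. there are
  \<open>M \<rightarrow> R\<^sup>n \<rightarrow> M\<close> composing to the identity.\<close>

definition fg_projective :: "('a, 'r) ring_scheme \<Rightarrow> ('a, 'b, 'm) module_scheme \<Rightarrow> bool"
  where "fg_projective R M \<longleftrightarrow> (\<exists>n. \<exists>i \<in> left_hom R M (free_module R n).
    \<exists>s \<in> left_hom R (free_module R n) M. \<forall>x \<in> carrier M. s (i x) = x)"

definition opposite :: "('a, 'r) ring_scheme \<Rightarrow> ('a, 'r) ring_scheme"
  where "opposite R = R\<lparr>monoid.mult := (\<lambda>x y. y \<otimes>\<^bsub>R\<^esub> x)\<rparr>"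

definition left_End ::
    "('a, 'r) ring_scheme \<Rightarrow> ('a, 'b, 'm) module_scheme \<Rightarrow> ('a, 'b \<Rightarrow> 'b) module"
  where "left_End R M =
    \<lparr>carrier = left_hom R M M \<inter> extensional (carrier M),
     monoid.mult = compose (carrier M), monoid.one = (\<lambda>x \<in> carrier M. x),
     ring.zero = (\<lambda>x \<in> carrier M. \<zero>\<^bsub>M\<^esub>), ring.add = (\<lambda>f g. \<lambda>x \<in> carrier M. f x \<oplus>\<^bsub>M\<^esub> g x),
     smult = (\<lambda>a f. \<lambda>x \<in> carrier M. a \<odot>\<^bsub>M\<^esub> f x)\<rparr>"

definition central_over :: "'a set \<Rightarrow> ('a, 'b) bimod \<Rightarrow> bool"
  where "central_over K M \<longleftrightarrow> (\<forall>a \<in> K. \<forall>x \<in> carrier M. a \<odot>\<^bsub>M\<^esub> x = x \<triangleleft>\<^bsub>M\<^esub> a)"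

text \<open>The bimodules whose classes form \<open>PicS\<^sub>K(R)\<close>, where \<open>K\<close> is (the carrier of) a subring
  of \<open>R\<close>. The algebra epimorphism is only required to exist; it need not be the one given by
  right multiplication.\<close>

definition partially_invertible ::
    "('a, 'r) ring_scheme \<Rightarrow> 'a set \<Rightarrow> ('a, 'b) bimod \<Rightarrow> bool"
  where "partially_invertible R K P \<longleftrightarrow>
    bimodule R P \<and> central_over K P \<and> fg_projective R P \<and>
    (\<exists>\<phi> \<in> ring_hom (opposite R) (left_End R P).
       (\<forall>k \<in> K. \<forall>r \<in> carrier R. \<phi> (k \<otimes>\<^bsub>R\<^esub> r) = k \<odot>\<^bsub>left_End R P\<^esub> \<phi> r) \<and>
       \<phi> ` carrier R = carrier (left_End R P))"

text \<open>Isomorphism classes are formed inside the type of bimodules with elements in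
  \<^typ>\<open>nat \<Rightarrow> 'a\<close>, where \<^typ>\<open>'a\<close> is the type of elements of \<open>R\<close>. Every finitely generated
  projective bimodule, over whatever type, has an isomorphic copy there (lemma
  \<open>fg_projective_representative\<close> below), so the class of a partially invertible \<open>P\<close>
  of any type is a nonempty set that determines \<open>P\<close> up to isomorphism.\<close>

type_synonym 'a bimod_cls = "('a, nat \<Rightarrow> 'a) bimod set"

definition bimod_class :: "('a, 'r) ring_scheme \<Rightarrow> ('a, 'b) bimod \<Rightarrow> 'a bimod_cls"
  where "bimod_class R P = {Q. bimod_iso R P Q}"

definition ideal_bimod :: "('a, 'r) ring_scheme \<Rightarrow> 'a set \<Rightarrow> ('a, 'a) bimod"
  where "ideal_bimod R I =
    \<lparr>carrier = I, monoid.mult = undefined, monoid.one = undefined, ring.zero = \<zero>\<^bsub>R\<^esub>, ring.add = (\<oplus>\<^bsub>R\<^esub>),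
     smult = (\<lambda>r d. r \<otimes>\<^bsub>R\<^esub> d), rsmult = (\<lambda>d r. d \<otimes>\<^bsub>R\<^esub> r)\<rparr>"

text \<open>The product of two classes consists of all \<open>W \<cong> P \<otimes>\<^sub>R Q\<close> with \<open>P\<close>, \<open>Q\<close> in the
  respective classes. \<open>PicS(R)\<close> is \<open>PicS R (carrier R)\<close>.\<close>

definition PicS :: "('a, 'r) ring_scheme \<Rightarrow> 'a set \<Rightarrow> 'a bimod_cls monoid"
  where "PicS R K =
    \<lparr>carrier = {bimod_class R P | P :: ('a, nat \<Rightarrow> 'a) bimod. partially_invertible R K P},
     monoid.mult = (\<lambda>C D. \<Union>P \<in> C. \<Union>Q \<in> D. bimod_class R (tensor R P Q)),
     monoid.one = bimod_class R (ideal_bimod R (carrier R))\<rparr>"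

lemma fg_projective_representative:
  fixes R :: "('a, 'r) ring_scheme" and P :: "('a, 'b) bimod"
  assumes P: "bimodule R P" and fg: "fg_projective R P"
  shows "\<exists>Q :: ('a, nat \<Rightarrow> 'a) bimod. Q \<in> bimod_class R P"
proof -
  interpret P: bimodule R P by (rule P)
  obtain n i s where i: "i \<in> left_hom R P (free_module R n)"
    and si: "\<And>x. x \<in> carrier P \<Longrightarrow> s (i x) = x"
    using fg by (auto simp: fg_projective_def)
  define Q :: "('a, nat \<Rightarrow> 'a) bimod" where
    "Q = \<lparr>carrier = i ` carrier P, monoid.mult = undefined, monoid.one = undefined, ring.zero = i \<zero>\<^bsub>P\<^esub>,
          ring.add = (\<lambda>u v. i (s u \<oplus>\<^bsub>P\<^esub> s v)), smult = (\<lambda>a u. i (a \<odot>\<^bsub>P\<^esub> s u)),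
          rsmult = (\<lambda>u a. i (s u \<triangleleft>\<^bsub>P\<^esub> a))\<rparr>"
  have "abelian_group Q"
  proof (rule abelian_groupI)
    fix x assume "x \<in> carrier Q"
    then obtain p where p: "p \<in> carrier P" "x = i p" by (auto simp: Q_def)
    then have "i (\<ominus>\<^bsub>P\<^esub> p) \<oplus>\<^bsub>Q\<^esub> x = \<zero>\<^bsub>Q\<^esub>"
      using P.M.l_neg by (auto simp: Q_def si)
    then show "\<exists>y \<in> carrier Q. y \<oplus>\<^bsub>Q\<^esub> x = \<zero>\<^bsub>Q\<^esub>"
      using p by (auto simp: Q_def)
  qed (auto simp: Q_def si P.M.a_ac)
  then have "module R Q"
    by (intro moduleI P.R.is_cring)
      (auto simp: Q_def si P.smult_l_distr P.smult_r_distr P.smult_assoc1)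
  then have Q: "bimodule R Q"
    by (intro bimodule.intro bimodule_axioms.intro)
      (auto simp: Q_def si P.rsmult_closed P.rsmult_l_distr P.rsmult_r_distr P.rsmult_assoc
        P.rsmult_one P.smult_rsmult)
  have "i \<in> bimod_hom R P Q"
    by (auto simp: bimod_hom_def left_hom_def Q_def si)
  moreover have "bij_betw i (carrier P) (carrier Q)"
    by (auto simp: bij_betw_def Q_def intro: inj_on_inverseI[of _ s] si)
  ultimately show ?thesis
    using P Q by (auto simp: bimod_class_def bimod_iso_def)
qed


section \<open>Unital partial actions\<close>

text \<open>A unital partial action is given by the idempotents \<open>e g = 1\<^sub>g\<close>, which determine the ideals
  \<open>D\<^sub>g = R 1\<^sub>g\<close>, and by the maps \<open>\<alpha> g\<close>. Each \<open>D\<^sub>g\<close> is a ring with identity \<open>e g\<close>.\<close>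

definition D_ideal :: "('a, 'r) ring_scheme \<Rightarrow> ('g \<Rightarrow> 'a) \<Rightarrow> 'g \<Rightarrow> 'a set"
  where "D_ideal R e g = PIdl\<^bsub>R\<^esub> (e g)"

definition D_ring :: "('a, 'r) ring_scheme \<Rightarrow> ('g \<Rightarrow> 'a) \<Rightarrow> 'g \<Rightarrow> ('a, 'r) ring_scheme"
  where "D_ring R e g = R\<lparr>carrier := D_ideal R e g, monoid.one := e g\<rparr>"

locale unital_partial_action = G: group G + R: cring R
  for G :: "('g, 'h) monoid_scheme" and R :: "('a, 'r) ring_scheme" +
  fixes e :: "'g \<Rightarrow> 'a" and \<alpha> :: "'g \<Rightarrow> 'a \<Rightarrow> 'a"
  assumes idem_closed: "g \<in> carrier G \<Longrightarrow> e g \<in> carrier R"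
    and idem: "g \<in> carrier G \<Longrightarrow> e g \<otimes>\<^bsub>R\<^esub> e g = e g"
    and ring_iso: "g \<in> carrier G \<Longrightarrow> \<alpha> g \<in> ring_iso (D_ring R e (inv\<^bsub>G\<^esub> g)) (D_ring R e g)"
    and D_one: "D_ideal R e \<one>\<^bsub>G\<^esub> = carrier R"
    and alpha_one: "r \<in> carrier R \<Longrightarrow> \<alpha> \<one>\<^bsub>G\<^esub> r = r"
    and alpha_image: "\<lbrakk>g \<in> carrier G; h \<in> carrier G\<rbrakk> \<Longrightarrow>
      \<alpha> g ` (D_ideal R e (inv\<^bsub>G\<^esub> g) \<cdot>\<^bsub>R\<^esub> D_ideal R e h) =
        D_ideal R e g \<cdot>\<^bsub>R\<^esub> D_ideal R e (g \<otimes>\<^bsub>G\<^esub> h)"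
    and alpha_comp: "\<lbrakk>g \<in> carrier G; h \<in> carrier G;
      t \<in> D_ideal R e (inv\<^bsub>G\<^esub> h) \<cdot>\<^bsub>R\<^esub> D_ideal R e (inv\<^bsub>G\<^esub> (g \<otimes>\<^bsub>G\<^esub> h))\<rbrakk> \<Longrightarrow>
      \<alpha> g (\<alpha> h t) = \<alpha> (g \<otimes>\<^bsub>G\<^esub> h) t"

definition invariants ::
    "('g, 'h) monoid_scheme \<Rightarrow> ('a, 'r) ring_scheme \<Rightarrow> ('g \<Rightarrow> 'a) \<Rightarrow> ('g \<Rightarrow> 'a \<Rightarrow> 'a) \<Rightarrow> 'a set"
  where "invariants G R e \<alpha> =
    {r \<in> carrier R. \<forall>g \<in> carrier G. \<alpha> g (r \<otimes>\<^bsub>R\<^esub> e (inv\<^bsub>G\<^esub> g)) = r \<otimes>\<^bsub>R\<^esub> e g}"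

definition partial_Galois ::
    "('g, 'h) monoid_scheme \<Rightarrow> ('a, 'r) ring_scheme \<Rightarrow> ('g \<Rightarrow> 'a) \<Rightarrow> ('g \<Rightarrow> 'a \<Rightarrow> 'a) \<Rightarrow> bool"
  where "partial_Galois G R e \<alpha> \<longleftrightarrow>
    (\<exists>(m :: nat) x y. x \<in> {1..m} \<rightarrow> carrier R \<and> y \<in> {1..m} \<rightarrow> carrier R \<and>
      (\<forall>g \<in> carrier G.
        (\<Oplus>\<^bsub>R\<^esub>i \<in> {1..m}. x i \<otimes>\<^bsub>R\<^esub> \<alpha> g (y i \<otimes>\<^bsub>R\<^esub> e (inv\<^bsub>G\<^esub> g))) =
          (if g = \<one>\<^bsub>G\<^esub> then \<one>\<^bsub>R\<^esub> else \<zero>\<^bsub>R\<^esub>)))"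

text \<open>\<open>twisted_bimod G R e \<alpha> g\<close> is \<open>\<^sub>g(D\<^bsub>g\<^sup>-\<^sup>1\<^esub>)\<^sub>I\<close>.\<close>

definition twisted_bimod ::
    "('g, 'h) monoid_scheme \<Rightarrow> ('a, 'r) ring_scheme \<Rightarrow> ('g \<Rightarrow> 'a) \<Rightarrow> ('g \<Rightarrow> 'a \<Rightarrow> 'a) \<Rightarrow> 'g \<Rightarrow> ('a, 'a) bimod"
  where "twisted_bimod G R e \<alpha> g =
    \<lparr>carrier = D_ideal R e (inv\<^bsub>G\<^esub> g), monoid.mult = undefined, monoid.one = undefined,
     ring.zero = \<zero>\<^bsub>R\<^esub>, ring.add = (\<oplus>\<^bsub>R\<^esub>),
     smult = (\<lambda>r d. \<alpha> (inv\<^bsub>G\<^esub> g) (r \<otimes>\<^bsub>R\<^esub> e g) \<otimes>\<^bsub>R\<^esub> d),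
     rsmult = (\<lambda>d r. d \<otimes>\<^bsub>R\<^esub> r)\<rparr>"

text \<open>\<open>conj_bimod G R e \<alpha> P g\<close> is \<open>P\<^sub>g\<close>.\<close>

definition conj_bimod ::
    "('g, 'h) monoid_scheme \<Rightarrow> ('a, 'r) ring_scheme \<Rightarrow> ('g \<Rightarrow> 'a) \<Rightarrow> ('g \<Rightarrow> 'a \<Rightarrow> 'a) \<Rightarrow>
      ('a, 'b) bimod \<Rightarrow> 'g \<Rightarrow> ('a, 'b) bimod"
  where "conj_bimod G R e \<alpha> P g =
    P\<lparr>smult := (\<lambda>r x. \<alpha> (inv\<^bsub>G\<^esub> g) (r \<otimes>\<^bsub>R\<^esub> e g) \<odot>\<^bsub>P\<^esub> x),
      rsmult := (\<lambda>x r. \<alpha> (inv\<^bsub>G\<^esub> g) (r \<otimes>\<^bsub>R\<^esub> e g) \<odot>\<^bsub>P\<^esub> x)\<rparr>"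

definition D_class :: "('a, 'r) ring_scheme \<Rightarrow> ('g \<Rightarrow> 'a) \<Rightarrow> 'g \<Rightarrow> 'a bimod_cls"
  where "D_class R e g = bimod_class R (ideal_bimod R (D_ideal R e g))"

definition X_set :: "('a, 'r) ring_scheme \<Rightarrow> ('g \<Rightarrow> 'a) \<Rightarrow> 'g \<Rightarrow> 'a bimod_cls set"
  where "X_set R e g = D_class R e g <#\<^bsub>PicS R (carrier R)\<^esub> carrier (PicS R (carrier R))"

definition \<Phi>\<^sub>0 ::
    "('g, 'h) monoid_scheme \<Rightarrow> ('a, 'r) ring_scheme \<Rightarrow> ('g \<Rightarrow> 'a) \<Rightarrow> ('g \<Rightarrow> 'a \<Rightarrow> 'a) \<Rightarrow> 'g \<Rightarrow> 'a bimod_cls"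
  where "\<Phi>\<^sub>0 G R e \<alpha> g = bimod_class R (twisted_bimod G R e \<alpha> g)"

locale partial_representation = G: group G + S: monoid S
  for G :: "('g, 'h) monoid_scheme" and S :: "('s, 't) monoid_scheme" +
  fixes \<Phi> :: "'g \<Rightarrow> 's"
  assumes closed: "\<Phi> \<in> carrier G \<rightarrow> carrier S"
    and left: "\<lbrakk>g \<in> carrier G; h \<in> carrier G\<rbrakk> \<Longrightarrow>
      \<Phi> (inv\<^bsub>G\<^esub> g) \<otimes>\<^bsub>S\<^esub> \<Phi> g \<otimes>\<^bsub>S\<^esub> \<Phi> h = \<Phi> (inv\<^bsub>G\<^esub> g) \<otimes>\<^bsub>S\<^esub> \<Phi> (g \<otimes>\<^bsub>G\<^esub> h)"
    and right: "\<lbrakk>g \<in> carrier G; h \<in> carrier G\<rbrakk> \<Longrightarrow>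
      \<Phi> g \<otimes>\<^bsub>S\<^esub> \<Phi> h \<otimes>\<^bsub>S\<^esub> \<Phi> (inv\<^bsub>G\<^esub> h) = \<Phi> (g \<otimes>\<^bsub>G\<^esub> h) \<otimes>\<^bsub>S\<^esub> \<Phi> (inv\<^bsub>G\<^esub> h)"
    and unit: "\<Phi> \<one>\<^bsub>G\<^esub> = \<one>\<^bsub>S\<^esub>"

end

theory Submission
  imports Defs
begin

text \<open>
  Everything takes place in one family of bimodules. An additive and multiplicative map
  \<open>\<theta>\<close> of \<open>R\<close> into itself, with \<open>\<theta>(1)\<close> possibly different from \<open>1\<close>, gives a bimodule \<open>E(\<theta>)\<close>: the ideal
  \<open>R\<theta>(1)\<close>, on which \<open>r\<close> acts from the right by multiplication with \<open>r\<close> and from the left by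
  multiplication with \<open>\<theta>(r)\<close>. The map \<open>d \<otimes> q \<mapsto> dq\<close> identifies \<open>E(\<theta>) \<otimes> Q\<close> with the part of \<open>Q\<close>
  on which \<open>\<theta>(1)\<close> is the identity, with \<open>r\<close> acting from the left as \<open>\<theta>(r)\<close>
  (\<open>pullback_tensor_iso\<close>). In particular \<open>E(\<theta>) \<otimes> E(\<theta>') \<cong> E(\<theta>' \<circ> \<theta>)\<close>.

  Both \<open>D\<^sub>h\<close> and \<open>\<^sub>g(D\<^bsub>g\<^sup>-\<^sup>1\<^esub>)\<^sub>I\<close> belong to this family, for \<open>r \<mapsto> r1\<^sub>h\<close> and for
  \<open>\<theta>\<^sub>g(r) = \<alpha>\<^bsub>g\<^sup>-\<^sup>1\<^esub>(r1\<^sub>g)\<close>. The axioms of a partial action yield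
  \<open>\<theta>\<^sub>h(\<theta>\<^sub>g(r)) = \<theta>\<^bsub>gh\<^esub>(r)1\<^bsub>h\<^sup>-\<^sup>1\<^esub>\<close> (\<open>twist_twist\<close>) and
  \<open>\<theta>\<^sub>g(1\<^sub>h) = 1\<^bsub>g\<^sup>-\<^sup>1\<^esub>1\<^bsub>g\<^sup>-\<^sup>1h\<^esub>\<close> (\<open>twist_unit_elem\<close>), so that composing endomorphisms gives
  \<open>\<Phi>\<^sub>0(g)\<Phi>\<^sub>0(h) = \<Phi>\<^sub>0(gh)[D\<^bsub>h\<^sup>-\<^sup>1\<^esub>]\<close>, \<open>\<Phi>\<^sub>0(g)\<Phi>\<^sub>0(g\<^sup>-\<^sup>1) = [D\<^sub>g]\<close> and
  \<open>\<Phi>\<^sub>0(g)[D\<^sub>h] = [D\<^bsub>gh\<^esub>]\<Phi>\<^sub>0(g)\<close>. The identities of a partial representation follow from these three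
  by calculation in a monoid.

  A bimodule \<open>P\<close> with class in \<open>X\<^bsub>g\<^sup>-\<^sup>1\<^esub>\<close> is central, and \<open>1\<^bsub>g\<^sup>-\<^sup>1\<^esub>\<close> is the identity on it. Tensoring
  with \<open>\<^sub>g(D\<^bsub>g\<^sup>-\<^sup>1\<^esub>)\<^sub>I\<close> on the left therefore only replaces the left action of \<open>r\<close> by that of
  \<open>\<theta>\<^sub>g(r)\<close>, and \<open>w \<otimes> d \<mapsto> \<theta>\<^sub>g(d)w\<close> absorbs the factor on the right, making the right action that of
  \<open>\<theta>\<^sub>g(r)\<close> as well. This is \<open>P\<^sub>g\<close> (\<open>conj_bimod_iso\<close>).

  The other half of the work is to see that \<open>PicS\<close> is a monoid (\<open>monoid_PicS\<close>), and the difficulty is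
  closure. An epimorphism from \<open>R\<^sup>o\<^sup>p\<close> onto \<open>End\<^sub>R(P)\<close> makes that ring commutative; for a finitely
  generated projective \<open>P\<close> this is equivalent to the identity \<open>f(x)y = f(y)x\<close> for all linear forms \<open>f\<close>
  on \<open>P\<close>, which says that \<open>P\<close> has rank at most one everywhere (\<open>partially_invertible_iff\<close>). In this
  form the condition passes to tensor products (\<open>rank_le_one_tensor\<close>), because it also forces
  the right action on \<open>P\<close> to be through scalars acting from the left.
\<close>

section \<open>The tensor product as a bimodule\<close>

definition add_hom :: "('b, 'm) ring_scheme \<Rightarrow> ('c, 'n) ring_scheme \<Rightarrow> ('b \<Rightarrow> 'c) set"
  where "add_hom A M = {f \<in> carrier A \<rightarrow> carrier M.
    \<forall>x \<in> carrier A. \<forall>y \<in> carrier A. f (x \<oplus>\<^bsub>A\<^esub> y) = f x \<oplus>\<^bsub>M\<^esub> f y}"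

definition balanced ::
    "('a, 'r) ring_scheme \<Rightarrow> ('a, 'b) bimod \<Rightarrow> ('a, 'c) bimod \<Rightarrow> ('d, 'm) ring_scheme \<Rightarrow>
      ('b \<Rightarrow> 'c \<Rightarrow> 'd) \<Rightarrow> bool"
  where "balanced R P Q M \<beta> \<longleftrightarrow>
    (\<forall>p \<in> carrier P. \<beta> p \<in> add_hom Q M) \<and>
    (\<forall>q \<in> carrier Q. (\<lambda>p. \<beta> p q) \<in> add_hom P M) \<and>
    (\<forall>p \<in> carrier P. \<forall>a \<in> carrier R. \<forall>q \<in> carrier Q. \<beta> (p \<triangleleft>\<^bsub>P\<^esub> a) q = \<beta> p (a \<odot>\<^bsub>Q\<^esub> q))"

definition pure_tensor ::
    "('a, 'r) ring_scheme \<Rightarrow> ('a, 'b) bimod \<Rightarrow> ('a, 'c) bimod \<Rightarrow> 'b \<Rightarrow> 'c \<Rightarrow> ('b \<times> 'c \<Rightarrow>\<^sub>0 int) set"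
  where "pure_tensor R P Q p q =
    generate (free_Abelian_group (carrier P \<times> carrier Q)) (tensor_rels R P Q)
      #>\<^bsub>free_Abelian_group (carrier P \<times> carrier Q)\<^esub> frag_of (p, q)"

lemma add_homI:
  assumes "\<And>x. x \<in> carrier A \<Longrightarrow> f x \<in> carrier M"
    and "\<And>x y. \<lbrakk>x \<in> carrier A; y \<in> carrier A\<rbrakk> \<Longrightarrow> f (x \<oplus>\<^bsub>A\<^esub> y) = f x \<oplus>\<^bsub>M\<^esub> f y"
  shows "f \<in> add_hom A M"
  using assms by (auto simp: add_hom_def)

lemma add_homD:
  assumes "f \<in> add_hom A M"
  shows "x \<in> carrier A \<Longrightarrow> f x \<in> carrier M"
    and "\<lbrakk>x \<in> carrier A; y \<in> carrier A\<rbrakk> \<Longrightarrow> f (x \<oplus>\<^bsub>A\<^esub> y) = f x \<oplus>\<^bsub>M\<^esub> f y"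
  using assms by (auto simp: add_hom_def)

lemma balancedI:
  assumes "\<And>p q. \<lbrakk>p \<in> carrier P; q \<in> carrier Q\<rbrakk> \<Longrightarrow> \<beta> p q \<in> carrier M"
    and "\<And>p p' q. \<lbrakk>p \<in> carrier P; p' \<in> carrier P; q \<in> carrier Q\<rbrakk> \<Longrightarrow>
      \<beta> (p \<oplus>\<^bsub>P\<^esub> p') q = \<beta> p q \<oplus>\<^bsub>M\<^esub> \<beta> p' q"
    and "\<And>p q q'. \<lbrakk>p \<in> carrier P; q \<in> carrier Q; q' \<in> carrier Q\<rbrakk> \<Longrightarrow>
      \<beta> p (q \<oplus>\<^bsub>Q\<^esub> q') = \<beta> p q \<oplus>\<^bsub>M\<^esub> \<beta> p q'"
    and "\<And>p a q. \<lbrakk>p \<in> carrier P; a \<in> carrier R; q \<in> carrier Q\<rbrakk> \<Longrightarrow>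
      \<beta> (p \<triangleleft>\<^bsub>P\<^esub> a) q = \<beta> p (a \<odot>\<^bsub>Q\<^esub> q)"
  shows "balanced R P Q M \<beta>"
  using assms by (auto simp: balanced_def add_hom_def)

lemma balancedD:
  assumes "balanced R P Q M \<beta>"
  shows "\<lbrakk>p \<in> carrier P; q \<in> carrier Q\<rbrakk> \<Longrightarrow> \<beta> p q \<in> carrier M"
    and "\<lbrakk>p \<in> carrier P; p' \<in> carrier P; q \<in> carrier Q\<rbrakk> \<Longrightarrow> \<beta> (p \<oplus>\<^bsub>P\<^esub> p') q = \<beta> p q \<oplus>\<^bsub>M\<^esub> \<beta> p' q"
    and "\<lbrakk>p \<in> carrier P; q \<in> carrier Q; q' \<in> carrier Q\<rbrakk> \<Longrightarrow> \<beta> p (q \<oplus>\<^bsub>Q\<^esub> q') = \<beta> p q \<oplus>\<^bsub>M\<^esub> \<beta> p q'"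
    and "\<lbrakk>p \<in> carrier P; a \<in> carrier R; q \<in> carrier Q\<rbrakk> \<Longrightarrow> \<beta> (p \<triangleleft>\<^bsub>P\<^esub> a) q = \<beta> p (a \<odot>\<^bsub>Q\<^esub> q)"
  using assms by (auto simp: balanced_def add_hom_def)

locale tensor_pair = P: bimodule R P + Q: bimodule R Q
  for R :: "('a, 'r) ring_scheme" and P :: "('a, 'b) bimod" and Q :: "('a, 'c) bimod"
begin

abbreviation F where "F \<equiv> free_Abelian_group (carrier P \<times> carrier Q)"
abbreviation N where "N \<equiv> generate F (tensor_rels R P Q)"
abbreviation T where "T \<equiv> tensor R P Q"
abbreviation pure (infixl "\<otimes>\<otimes>" 75) where "p \<otimes>\<otimes> q \<equiv> pure_tensor R P Q p q"

lemma tensor_relsI: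
  "\<lbrakk>p \<in> carrier P; p' \<in> carrier P; q \<in> carrier Q\<rbrakk> \<Longrightarrow>
    frag_of (p \<oplus>\<^bsub>P\<^esub> p', q) - frag_of (p, q) - frag_of (p', q) \<in> tensor_rels R P Q"
  "\<lbrakk>p \<in> carrier P; q \<in> carrier Q; q' \<in> carrier Q\<rbrakk> \<Longrightarrow>
    frag_of (p, q \<oplus>\<^bsub>Q\<^esub> q') - frag_of (p, q) - frag_of (p, q') \<in> tensor_rels R P Q"
  "\<lbrakk>p \<in> carrier P; a \<in> carrier R; q \<in> carrier Q\<rbrakk> \<Longrightarrow>
    frag_of (p \<triangleleft>\<^bsub>P\<^esub> a, q) - frag_of (p, a \<odot>\<^bsub>Q\<^esub> q) \<in> tensor_rels R P Q"
  unfolding tensor_rels_def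
    apply (intro UnI1 CollectI exI conjI; (rule refl | assumption))
   apply (rule UnI1, rule UnI2, intro CollectI exI conjI; (rule refl | assumption))
  apply (rule UnI2, intro CollectI exI conjI; (rule refl | assumption))
  done

lemma tensor_relsE:
  assumes "r \<in> tensor_rels R P Q"
  obtains
    (left) p p' q where "p \<in> carrier P" "p' \<in> carrier P" "q \<in> carrier Q"
      "r = frag_of (p \<oplus>\<^bsub>P\<^esub> p', q) - frag_of (p, q) - frag_of (p', q)"
  | (right) p q q' where "p \<in> carrier P" "q \<in> carrier Q" "q' \<in> carrier Q"
      "r = frag_of (p, q \<oplus>\<^bsub>Q\<^esub> q') - frag_of (p, q) - frag_of (p, q')"
  | (middle) p a q where "p \<in> carrier P" "a \<in> carrier R" "q \<in> carrier Q"
      "r = frag_of (p \<triangleleft>\<^bsub>P\<^esub> a, q) - frag_of (p, a \<odot>\<^bsub>Q\<^esub> q)"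
  using assms unfolding tensor_rels_def
  by (elim UnE CollectE exE conjE) (rule that(1) that(2) that(3); assumption)+

lemma diff_closed: "\<lbrakk>c \<in> carrier F; d \<in> carrier F\<rbrakk> \<Longrightarrow> c - d \<in> carrier F"
  using subset_trans[OF keys_diff[of c d]] by auto

lemma frag_of_closed: "\<lbrakk>p \<in> carrier P; q \<in> carrier Q\<rbrakk> \<Longrightarrow> frag_of (p, q) \<in> carrier F"
  by (simp add: keys_frag_of)

lemma tensor_rels_subset: "tensor_rels R P Q \<subseteq> carrier F"
  by (auto elim!: tensor_relsE intro!: diff_closed frag_of_closed P.rsmult_closed
      simp del: carrier_free_Abelian_group_iff)

sublocale Fr: comm_group F
  by (rule abelian_free_Abelian_group)

lemma subgroup_N: "subgroup N F"
  using tensor_rels_subset by (rule Fr.generate_is_subgroup)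

sublocale N: normal N F
  using subgroup_N Fr.normal_iff_subgroup by blast

lemma tensor_simps:
  "carrier T = carrier (F Mod N)"
  "\<zero>\<^bsub>T\<^esub> = \<one>\<^bsub>F Mod N\<^esub>"
  "C \<oplus>\<^bsub>T\<^esub> D = C \<otimes>\<^bsub>F Mod N\<^esub> D"
  by (simp_all add: tensor_def Let_def)

lemma abelian_group_tensor: "abelian_group T"
proof -
  interpret FN: comm_group "F Mod N"
    by (rule Fr.abelian_FactGroup[OF subgroup_N])
  show ?thesis
  proof (rule abelian_groupI)
    fix x assume "x \<in> carrier T"
    then show "\<exists>y\<in>carrier T. y \<oplus>\<^bsub>T\<^esub> x = \<zero>\<^bsub>T\<^esub>"
      unfolding tensor_simps using FN.l_inv FN.inv_closed by blast
  qed (simp_all add: tensor_simps FN.m_ac FN.m_closed FN.one_closed FN.l_one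
      del: mult_FactGroup one_FactGroup)
qed

sublocale T: abelian_group T
  by (rule abelian_group_tensor)

lemma coset_add:
  "\<lbrakk>c \<in> carrier F; d \<in> carrier F\<rbrakk> \<Longrightarrow> (N #>\<^bsub>F\<^esub> c) \<oplus>\<^bsub>T\<^esub> (N #>\<^bsub>F\<^esub> d) = N #>\<^bsub>F\<^esub> (c + d)"
  using N.rcos_sum[of c d] by (simp add: tensor_simps)

lemma coset_closed: "c \<in> carrier F \<Longrightarrow> N #>\<^bsub>F\<^esub> c \<in> carrier T"
  by (auto simp: tensor_simps carrier_FactGroup)

lemma coset_eqI:
  assumes "c \<in> carrier F" "d \<in> carrier F" "c - d \<in> N"
  shows "N #>\<^bsub>F\<^esub> c = N #>\<^bsub>F\<^esub> d"
proof -
  have "c \<in> N #>\<^bsub>F\<^esub> d"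
    using assms(3) by (force simp: r_coset_def)
  then show ?thesis
    using Fr.repr_independence[OF _ assms(2) subgroup_N] by simp
qed

lemma pure_closed: "\<lbrakk>p \<in> carrier P; q \<in> carrier Q\<rbrakk> \<Longrightarrow> p \<otimes>\<otimes> q \<in> carrier T"
  unfolding pure_tensor_def by (intro coset_closed frag_of_closed)

lemma pure_add_left:
  assumes "p \<in> carrier P" "p' \<in> carrier P" "q \<in> carrier Q"
  shows "(p \<oplus>\<^bsub>P\<^esub> p') \<otimes>\<otimes> q = p \<otimes>\<otimes> q \<oplus>\<^bsub>T\<^esub> p' \<otimes>\<otimes> q"
proof -
  have "frag_of (p \<oplus>\<^bsub>P\<^esub> p', q) - frag_of (p, q) - frag_of (p', q) \<in> N"
    using assms by (intro generate.incl tensor_relsI)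
  then have "N #>\<^bsub>F\<^esub> frag_of (p \<oplus>\<^bsub>P\<^esub> p', q) = N #>\<^bsub>F\<^esub> (frag_of (p, q) + frag_of (p', q))"
    using assms Fr.m_closed[OF frag_of_closed frag_of_closed]
    by (intro coset_eqI frag_of_closed) (auto simp: diff_diff_eq)
  then show ?thesis
    using assms by (simp add: pure_tensor_def coset_add frag_of_closed del: carrier_free_Abelian_group_iff)
qed

lemma pure_add_right:
  assumes "p \<in> carrier P" "q \<in> carrier Q" "q' \<in> carrier Q"
  shows "p \<otimes>\<otimes> (q \<oplus>\<^bsub>Q\<^esub> q') = p \<otimes>\<otimes> q \<oplus>\<^bsub>T\<^esub> p \<otimes>\<otimes> q'"
proof -
  have "frag_of (p, q \<oplus>\<^bsub>Q\<^esub> q') - frag_of (p, q) - frag_of (p, q') \<in> N"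
    using assms by (intro generate.incl tensor_relsI)
  then have "N #>\<^bsub>F\<^esub> frag_of (p, q \<oplus>\<^bsub>Q\<^esub> q') = N #>\<^bsub>F\<^esub> (frag_of (p, q) + frag_of (p, q'))"
    using assms Fr.m_closed[OF frag_of_closed frag_of_closed]
    by (intro coset_eqI frag_of_closed) (auto simp: diff_diff_eq)
  then show ?thesis
    using assms by (simp add: pure_tensor_def coset_add frag_of_closed del: carrier_free_Abelian_group_iff)
qed

lemma pure_balanced:
  assumes "p \<in> carrier P" "a \<in> carrier R" "q \<in> carrier Q"
  shows "(p \<triangleleft>\<^bsub>P\<^esub> a) \<otimes>\<otimes> q = p \<otimes>\<otimes> (a \<odot>\<^bsub>Q\<^esub> q)"
proof -
  have "frag_of (p \<triangleleft>\<^bsub>P\<^esub> a, q) - frag_of (p, a \<odot>\<^bsub>Q\<^esub> q) \<in> N"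
    using assms by (intro generate.incl tensor_relsI)
  then show ?thesis
    unfolding pure_tensor_def
    using assms by (intro coset_eqI frag_of_closed P.rsmult_closed Q.smult_closed)
qed

lemma pure_zero_left: "q \<in> carrier Q \<Longrightarrow> \<zero>\<^bsub>P\<^esub> \<otimes>\<otimes> q = \<zero>\<^bsub>T\<^esub>"
  using pure_add_left[of "\<zero>\<^bsub>P\<^esub>" "\<zero>\<^bsub>P\<^esub>" q] pure_closed[of "\<zero>\<^bsub>P\<^esub>" q]
  by (metis P.M.zero_closed P.M.l_zero T.add.r_cancel_one')

lemma pure_minus_left:
  assumes "p \<in> carrier P" "q \<in> carrier Q"
  shows "(\<ominus>\<^bsub>P\<^esub> p) \<otimes>\<otimes> q = \<ominus>\<^bsub>T\<^esub> (p \<otimes>\<otimes> q)"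
  using pure_add_left[of "\<ominus>\<^bsub>P\<^esub> p" p q] assms
  by (intro T.minus_equality[symmetric]) (simp_all add: pure_zero_left pure_closed P.M.l_neg)

text \<open>Minus signs are absorbed into the left factor, so sums of pure tensors exhaust the
  tensor product.\<close>

lemma tensor_induct [consumes 1, case_names pure add]:
  assumes "t \<in> carrier T"
    and pure: "\<And>p q. \<lbrakk>p \<in> carrier P; q \<in> carrier Q\<rbrakk> \<Longrightarrow> \<Phi> (p \<otimes>\<otimes> q)"
    and add: "\<And>u v. \<lbrakk>u \<in> carrier T; v \<in> carrier T; \<Phi> u; \<Phi> v\<rbrakk> \<Longrightarrow> \<Phi> (u \<oplus>\<^bsub>T\<^esub> v)"
  shows "\<Phi> t"
proof -
  obtain c where c: "c \<in> carrier F" "t = N #>\<^bsub>F\<^esub> c"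
    using assms(1) by (auto simp: tensor_simps carrier_FactGroup)
  have "Poly_Mapping.keys c \<subseteq> carrier P \<times> carrier Q"
    using c(1) by simp
  then have "c \<in> carrier F \<and> - c \<in> carrier F \<and> \<Phi> (N #>\<^bsub>F\<^esub> c) \<and> \<Phi> (N #>\<^bsub>F\<^esub> (- c))"
  proof (induction c rule: frag_induction)
    case zero
    have "\<Phi> \<zero>\<^bsub>T\<^esub>"
      using pure[of "\<zero>\<^bsub>P\<^esub>" "\<zero>\<^bsub>Q\<^esub>"] by (simp add: pure_zero_left)
    then show ?case
      using N.rcos_const[OF _ N.one_closed] by (simp add: tensor_simps)
  next
    case (one x)
    obtain p q where x: "x = (p, q)" "p \<in> carrier P" "q \<in> carrier Q"
      using one by auto
    have "(N #>\<^bsub>F\<^esub> - frag_of x) \<oplus>\<^bsub>T\<^esub> (N #>\<^bsub>F\<^esub> frag_of x) = N #>\<^bsub>F\<^esub> 0"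
      using x frag_of_closed[of p q] by (subst coset_add) auto
    also have "\<dots> = \<zero>\<^bsub>T\<^esub>"
      using N.rcos_const[OF _ N.one_closed] by (simp add: tensor_simps)
    finally have "\<ominus>\<^bsub>T\<^esub> (p \<otimes>\<otimes> q) = N #>\<^bsub>F\<^esub> - frag_of x"
      using x frag_of_closed[of p q]
      by (intro T.minus_equality) (auto simp: pure_tensor_def intro!: coset_closed)
    moreover have "\<Phi> (\<ominus>\<^bsub>T\<^esub> (p \<otimes>\<otimes> q))"
      using x pure[of "\<ominus>\<^bsub>P\<^esub> p" q] by (simp add: pure_minus_left)
    ultimately show ?case
      using x pure[of p q] frag_of_closed[of p q] by (simp add: pure_tensor_def)
  next
    case (diff a b)
    have "a - b = a + - b" "- (a - b) = - a + b" by simp_all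
    then show ?case
      using diff add[of "N #>\<^bsub>F\<^esub> a" "N #>\<^bsub>F\<^esub> - b"] add[of "N #>\<^bsub>F\<^esub> - a" "N #>\<^bsub>F\<^esub> b"]
        Fr.m_closed[of a "- b"] Fr.m_closed[of "- a" b]
      by (simp add: coset_add coset_closed del: carrier_free_Abelian_group_iff)
  qed
  then show ?thesis
    using c by simp
qed

lemma frag_image_closed:
  assumes \<phi>: "\<And>x. x \<in> carrier P \<times> carrier Q \<Longrightarrow> \<phi> x \<in> carrier P \<times> carrier Q"
    and d: "d \<in> carrier F"
  shows "frag_extend (\<lambda>x. frag_of (\<phi> x)) d \<in> carrier F"
proof -
  have "Poly_Mapping.keys (frag_extend (\<lambda>x. frag_of (\<phi> x)) d) \<subseteq> \<phi> ` Poly_Mapping.keys d"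
    using keys_frag_extend[of "\<lambda>x. frag_of (\<phi> x)" d] by (auto simp: keys_frag_of)
  also have "\<dots> \<subseteq> carrier P \<times> carrier Q"
    using \<phi> d by (intro image_subsetI) (auto simp del: mem_Times_iff SigmaI)
  finally show ?thesis
    by simp
qed

text \<open>Both actions on the tensor product come from a map of pairs that sends relations to
  relations. Such a map sends the whole subgroup \<open>N\<close> into itself, so the image of a coset, enlarged
  by \<open>N\<close>, is a single coset.\<close>

lemma coset_image:
  assumes \<phi>: "\<And>x. x \<in> carrier P \<times> carrier Q \<Longrightarrow> \<phi> x \<in> carrier P \<times> carrier Q"
    and rels: "frag_extend (\<lambda>x. frag_of (\<phi> x)) ` tensor_rels R P Q \<subseteq> N"
    and c: "c \<in> carrier F"
  shows "N <#>\<^bsub>F\<^esub> (frag_extend (\<lambda>x. frag_of (\<phi> x)) ` (N #>\<^bsub>F\<^esub> c)) =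
    N #>\<^bsub>F\<^esub> frag_extend (\<lambda>x. frag_of (\<phi> x)) c"
proof -
  let ?f = "frag_extend (\<lambda>x. frag_of (\<phi> x))"
  have f_closed: "?f d \<in> carrier F" if "d \<in> carrier F" for d
    using that by (intro frag_image_closed \<phi>)
  have fN: "?f n \<in> N" if "n \<in> N" for n
    using that
  proof induction
    case one
    then show ?case using N.one_closed by simp
  next
    case (incl h)
    then show ?case using rels by auto
  next
    case (inv h)
    then have h: "h \<in> carrier F" and fh: "?f h \<in> N" using tensor_rels_subset rels by blast+
    then have "?f (inv\<^bsub>F\<^esub> h) = inv\<^bsub>F\<^esub> (?f h)"
      using f_closed[OF h] by (simp add: frag_extend_minus)
    then show ?case
      using N.m_inv_closed[OF fh] by (simp only:)
  next
    case (eng h1 h2)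
    then show ?case
      using N.m_closed by (simp add: frag_extend_add)
  qed
  show ?thesis (is "?L = ?R")
  proof
    show "?L \<subseteq> ?R"
    proof
      fix x assume "x \<in> ?L"
      then obtain n n' where "n \<in> N" "n' \<in> N" "x = n + ?f (n' + c)"
        by (auto simp: set_mult_def r_coset_def)
      then have "n + ?f n' \<in> N" "x = (n + ?f n') + ?f c"
        using N.m_closed[of n "?f n'"] fN by (auto simp: frag_extend_add add.assoc)
      then show "x \<in> ?R"
        by (auto simp: r_coset_def)
    qed
    show "?R \<subseteq> ?L"
    proof
      fix x assume "x \<in> ?R"
      then obtain n where "n \<in> N" "x = n + ?f (0 + c)"
        by (auto simp: r_coset_def)
      moreover have "0 + c \<in> N #>\<^bsub>F\<^esub> c"
        using N.one_closed by (auto simp: r_coset_def)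
      ultimately show "x \<in> ?L"
        by (auto simp: set_mult_def)
    qed
  qed
qed

lemma smult_coset:
  assumes a: "a \<in> carrier R" and c: "c \<in> carrier F"
  shows "a \<odot>\<^bsub>T\<^esub> (N #>\<^bsub>F\<^esub> c) = N #>\<^bsub>F\<^esub> frag_extend (\<lambda>x. frag_of (case x of (p, q) \<Rightarrow> (a \<odot>\<^bsub>P\<^esub> p, q))) c"
proof -
  have "frag_extend (\<lambda>x. frag_of (case x of (p, q) \<Rightarrow> (a \<odot>\<^bsub>P\<^esub> p, q))) ` tensor_rels R P Q \<subseteq> tensor_rels R P Q"
    using a
    by (auto elim!: tensor_relsE intro!: tensor_relsI
        simp: frag_extend_diff P.smult_r_distr P.smult_rsmult[symmetric])
  then have "frag_extend (\<lambda>x. frag_of (case x of (p, q) \<Rightarrow> (a \<odot>\<^bsub>P\<^esub> p, q))) ` tensor_rels R P Q \<subseteq> N"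
    using generate.incl[of _ "tensor_rels R P Q" F] by blast
  then show ?thesis
    using coset_image[OF _ _ c, of "\<lambda>(p, q). (a \<odot>\<^bsub>P\<^esub> p, q)"] a
    by (auto simp: tensor_def Let_def case_prod_unfold)
qed

lemma rsmult_coset:
  assumes a: "a \<in> carrier R" and c: "c \<in> carrier F"
  shows "(N #>\<^bsub>F\<^esub> c) \<triangleleft>\<^bsub>T\<^esub> a = N #>\<^bsub>F\<^esub> frag_extend (\<lambda>x. frag_of (case x of (p, q) \<Rightarrow> (p, q \<triangleleft>\<^bsub>Q\<^esub> a))) c"
proof -
  have "frag_extend (\<lambda>x. frag_of (case x of (p, q) \<Rightarrow> (p, q \<triangleleft>\<^bsub>Q\<^esub> a))) ` tensor_rels R P Q \<subseteq> tensor_rels R P Q"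
    using a
    by (auto elim!: tensor_relsE intro!: tensor_relsI
        simp: frag_extend_diff Q.rsmult_closed Q.rsmult_l_distr Q.smult_rsmult)
  then have "frag_extend (\<lambda>x. frag_of (case x of (p, q) \<Rightarrow> (p, q \<triangleleft>\<^bsub>Q\<^esub> a))) ` tensor_rels R P Q \<subseteq> N"
    using generate.incl[of _ "tensor_rels R P Q" F] by blast
  then show ?thesis
    using coset_image[OF _ _ c, of "\<lambda>(p, q). (p, q \<triangleleft>\<^bsub>Q\<^esub> a)"] a
    by (auto simp: tensor_def Let_def case_prod_unfold Q.rsmult_closed)
qed

lemma smult_pure:
  "\<lbrakk>a \<in> carrier R; p \<in> carrier P; q \<in> carrier Q\<rbrakk> \<Longrightarrow> a \<odot>\<^bsub>T\<^esub> (p \<otimes>\<otimes> q) = (a \<odot>\<^bsub>P\<^esub> p) \<otimes>\<otimes> q"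
  unfolding pure_tensor_def by (subst smult_coset) (auto intro: frag_of_closed)

lemma rsmult_pure:
  "\<lbrakk>a \<in> carrier R; p \<in> carrier P; q \<in> carrier Q\<rbrakk> \<Longrightarrow> (p \<otimes>\<otimes> q) \<triangleleft>\<^bsub>T\<^esub> a = p \<otimes>\<otimes> (q \<triangleleft>\<^bsub>Q\<^esub> a)"
  unfolding pure_tensor_def by (subst rsmult_coset) (auto intro: frag_of_closed)

lemma smult_add_hom:
  assumes a: "a \<in> carrier R"
  shows "(\<lambda>t. a \<odot>\<^bsub>T\<^esub> t) \<in> add_hom T T"
proof (rule add_homI)
  let ?f = "frag_extend (\<lambda>x. frag_of (case x of (p, q) \<Rightarrow> (a \<odot>\<^bsub>P\<^esub> p, q)))"
  have f_closed: "?f d \<in> carrier F" if "d \<in> carrier F" for d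
    using that a by (intro frag_image_closed) auto
  fix s t assume "s \<in> carrier T"
  then obtain c where c: "c \<in> carrier F" "s = N #>\<^bsub>F\<^esub> c"
    by (auto simp: tensor_simps carrier_FactGroup)
  then show "a \<odot>\<^bsub>T\<^esub> s \<in> carrier T"
    using smult_coset[OF a c(1)] coset_closed[OF f_closed[OF c(1)]] by simp
  assume "t \<in> carrier T"
  then obtain d where d: "d \<in> carrier F" "t = N #>\<^bsub>F\<^esub> d"
    by (auto simp: tensor_simps carrier_FactGroup)
  have "c + d \<in> carrier F"
    using c d Fr.m_closed[of c d] by simp
  then show "a \<odot>\<^bsub>T\<^esub> (s \<oplus>\<^bsub>T\<^esub> t) = a \<odot>\<^bsub>T\<^esub> s \<oplus>\<^bsub>T\<^esub> a \<odot>\<^bsub>T\<^esub> t"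
    using c d by (simp add: coset_add smult_coset[OF a] f_closed frag_extend_add
        del: carrier_free_Abelian_group_iff)
qed

lemma rsmult_add_hom:
  assumes a: "a \<in> carrier R"
  shows "(\<lambda>t. t \<triangleleft>\<^bsub>T\<^esub> a) \<in> add_hom T T"
proof (rule add_homI)
  let ?f = "frag_extend (\<lambda>x. frag_of (case x of (p, q) \<Rightarrow> (p, q \<triangleleft>\<^bsub>Q\<^esub> a)))"
  have f_closed: "?f d \<in> carrier F" if "d \<in> carrier F" for d
    using that a by (intro frag_image_closed) (auto intro: Q.rsmult_closed)
  fix s t assume "s \<in> carrier T"
  then obtain c where c: "c \<in> carrier F" "s = N #>\<^bsub>F\<^esub> c"
    by (auto simp: tensor_simps carrier_FactGroup)
  then show "s \<triangleleft>\<^bsub>T\<^esub> a \<in> carrier T"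
    using rsmult_coset[OF a c(1)] coset_closed[OF f_closed[OF c(1)]] by simp
  assume "t \<in> carrier T"
  then obtain d where d: "d \<in> carrier F" "t = N #>\<^bsub>F\<^esub> d"
    by (auto simp: tensor_simps carrier_FactGroup)
  have "c + d \<in> carrier F"
    using c d Fr.m_closed[of c d] by simp
  then show "(s \<oplus>\<^bsub>T\<^esub> t) \<triangleleft>\<^bsub>T\<^esub> a = s \<triangleleft>\<^bsub>T\<^esub> a \<oplus>\<^bsub>T\<^esub> t \<triangleleft>\<^bsub>T\<^esub> a"
    using c d by (simp add: coset_add rsmult_coset[OF a] f_closed frag_extend_add
        del: carrier_free_Abelian_group_iff)
qed

lemma bimodule_tensor: "bimodule R T"
proof -
  note sm = add_homD[OF smult_add_hom] and rs = add_homD[OF rsmult_add_hom]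
  note pc = pure_closed smult_pure rsmult_pure P.rsmult_closed Q.rsmult_closed
  have "module R T"
  proof (rule moduleI)
    fix a b x assume ab: "a \<in> carrier R" "b \<in> carrier R" and x: "x \<in> carrier T"
    show "(a \<oplus>\<^bsub>R\<^esub> b) \<odot>\<^bsub>T\<^esub> x = a \<odot>\<^bsub>T\<^esub> x \<oplus>\<^bsub>T\<^esub> b \<odot>\<^bsub>T\<^esub> x"
      using x
      by (induction rule: tensor_induct)
        (auto simp: ab pc P.smult_l_distr pure_add_left sm T.a_ac)
    show "(a \<otimes>\<^bsub>R\<^esub> b) \<odot>\<^bsub>T\<^esub> x = a \<odot>\<^bsub>T\<^esub> (b \<odot>\<^bsub>T\<^esub> x)"
      using x by (induction rule: tensor_induct) (auto simp: ab pc P.smult_assoc1 sm)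
  next
    fix x assume x: "x \<in> carrier T"
    show "\<one>\<^bsub>R\<^esub> \<odot>\<^bsub>T\<^esub> x = x"
      using x by (induction rule: tensor_induct) (auto simp: pc sm)
  qed (auto simp: P.R.is_cring sm T.abelian_group_axioms)
  moreover have "bimodule_axioms R T"
  proof
    fix a b x assume ab: "a \<in> carrier R" "b \<in> carrier R" and x: "x \<in> carrier T"
    show "x \<triangleleft>\<^bsub>T\<^esub> (a \<oplus>\<^bsub>R\<^esub> b) = x \<triangleleft>\<^bsub>T\<^esub> a \<oplus>\<^bsub>T\<^esub> x \<triangleleft>\<^bsub>T\<^esub> b"
      using x
      by (induction rule: tensor_induct)
        (auto simp: ab pc Q.rsmult_r_distr pure_add_right rs T.a_ac)
    show "x \<triangleleft>\<^bsub>T\<^esub> (a \<otimes>\<^bsub>R\<^esub> b) = (x \<triangleleft>\<^bsub>T\<^esub> a) \<triangleleft>\<^bsub>T\<^esub> b"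
      using x by (induction rule: tensor_induct) (auto simp: ab pc Q.rsmult_assoc rs)
    show "(a \<odot>\<^bsub>T\<^esub> x) \<triangleleft>\<^bsub>T\<^esub> b = a \<odot>\<^bsub>T\<^esub> (x \<triangleleft>\<^bsub>T\<^esub> b)"
      using x by (induction rule: tensor_induct) (auto simp: ab pc sm rs)
  next
    fix x assume x: "x \<in> carrier T"
    show "x \<triangleleft>\<^bsub>T\<^esub> \<one>\<^bsub>R\<^esub> = x"
      using x by (induction rule: tensor_induct) (auto simp: pc rs Q.rsmult_one)
  qed (auto simp: rs)
  ultimately show ?thesis
    by (rule bimodule.intro)
qed

text \<open>The universal property. The homomorphism that \<open>\<beta>\<close> induces on the free abelian group kills
  the balancedness relations. The target is any abelian group, because the associativity isomorphism
  is assembled from maps that are linear on one side only.\<close>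

lemma tensor_lift:
  fixes M :: "('d, 'm) ring_scheme"
  assumes M: "abelian_group M" and \<beta>: "balanced R P Q M \<beta>"
  shows "\<exists>f. f \<in> add_hom T M \<and> (\<forall>p \<in> carrier P. \<forall>q \<in> carrier Q. f (p \<otimes>\<otimes> q) = \<beta> p q)"
proof -
  interpret M: abelian_group M by (rule M)
  have "(\<lambda>x. \<beta> (fst x) (snd x)) ` (carrier P \<times> carrier Q) \<subseteq> carrier (add_monoid M)"
    using balancedD(1)[OF \<beta>] by auto
  then obtain h where h: "h \<in> hom F (add_monoid M)"
    and h_frag: "\<And>x. x \<in> carrier P \<times> carrier Q \<Longrightarrow> h (frag_of x) = \<beta> (fst x) (snd x)"
    by (rule comm_group.free_Abelian_group_universal[OF M.a_comm_group]) (rule that, assumption, blast)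
  interpret h: group_hom F "add_monoid M" h
    by (simp add: group_hom_def group_hom_axioms_def h M.add.is_group)
  have h_add: "h (c + d) = h c \<oplus>\<^bsub>M\<^esub> h d" if "c \<in> carrier F" "d \<in> carrier F" for c d
    using h.hom_mult[OF that] by simp
  have h_closed: "h c \<in> carrier M" if "c \<in> carrier F" for c
    using h.hom_closed[OF that] by simp
  have h_diff: "h (c - d) = h c \<oplus>\<^bsub>M\<^esub> (\<ominus>\<^bsub>M\<^esub> h d)" if "c \<in> carrier F" "d \<in> carrier F" for c d
    using h.hom_inv[OF that(2)] that h_add[of c "- d"] by (simp add: a_inv_def)
  have "tensor_rels R P Q \<subseteq> kernel F (add_monoid M) h"
  proof
    fix r assume r: "r \<in> tensor_rels R P Q"
    note s = h_diff frag_of_closed diff_closed h_frag balancedD[OF \<beta>] P.rsmult_closed M.minus_add M.a_ac M.r_neg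
    have cancel: "x \<oplus>\<^bsub>M\<^esub> (y \<oplus>\<^bsub>M\<^esub> (\<ominus>\<^bsub>M\<^esub> x \<oplus>\<^bsub>M\<^esub> \<ominus>\<^bsub>M\<^esub> y)) = \<zero>\<^bsub>M\<^esub>"
      if "x \<in> carrier M" "y \<in> carrier M" for x y
      using that by (subst M.a_lcomm) (simp_all add: M.r_neg2 M.r_neg)
    have "h r = \<zero>\<^bsub>M\<^esub>"
      using r
      by (cases rule: tensor_relsE)
        (simp_all add: s cancel del: carrier_free_Abelian_group_iff)
    then show "r \<in> kernel F (add_monoid M) h"
      using subsetD[OF tensor_rels_subset r]
      by (simp add: kernel_def del: carrier_free_Abelian_group_iff)
  qed
  then have N: "N \<subseteq> kernel F (add_monoid M) h"
    by (rule Fr.generate_subgroup_incl[OF _ h.subgroup_kernel])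
  have "h c = h d" if "c \<in> carrier F" "d \<in> carrier F" "N #>\<^bsub>F\<^esub> c = N #>\<^bsub>F\<^esub> d" for c d
  proof -
    have "c \<in> N #>\<^bsub>F\<^esub> d"
      using Fr.rcos_self[OF that(1) subgroup_N] that(3) by simp
    then obtain n where "n \<in> N" "c = n + d"
      by (auto simp: r_coset_def)
    then show ?thesis
      using N h_add[of n d] that(2) h_closed by (auto simp: kernel_def)
  qed
  then obtain g where g: "g \<in> hom (F Mod N) (add_monoid M)"
      "\<And>c. c \<in> carrier F \<Longrightarrow> g (N #>\<^bsub>F\<^esub> c) = h c"
    using FactGroup_universal[OF h N.normal_axioms] by blast
  show ?thesis
  proof (intro exI conjI ballI)
    show "g \<in> add_hom T M"
      using g(1) by (auto simp: add_hom_def hom_def tensor_simps)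
    show "g (p \<otimes>\<otimes> q) = \<beta> p q" if "p \<in> carrier P" "q \<in> carrier Q" for p q
      using that g(2)[OF frag_of_closed] h_frag[of "(p, q)"] by (simp add: pure_tensor_def)
  qed
qed

end


section \<open>Isomorphisms of bimodules\<close>

lemma bimod_homI:
  assumes "f \<in> add_hom M N"
    and "\<And>a x. \<lbrakk>a \<in> carrier R; x \<in> carrier M\<rbrakk> \<Longrightarrow> f (a \<odot>\<^bsub>M\<^esub> x) = a \<odot>\<^bsub>N\<^esub> f x"
    and "\<And>a x. \<lbrakk>a \<in> carrier R; x \<in> carrier M\<rbrakk> \<Longrightarrow> f (x \<triangleleft>\<^bsub>M\<^esub> a) = f x \<triangleleft>\<^bsub>N\<^esub> a"
  shows "f \<in> bimod_hom R M N"
  using assms by (auto simp: bimod_hom_def left_hom_def add_hom_def)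

lemma bimod_homD:
  assumes "f \<in> bimod_hom R M N"
  shows "x \<in> carrier M \<Longrightarrow> f x \<in> carrier N"
    and "\<lbrakk>x \<in> carrier M; y \<in> carrier M\<rbrakk> \<Longrightarrow> f (x \<oplus>\<^bsub>M\<^esub> y) = f x \<oplus>\<^bsub>N\<^esub> f y"
    and "\<lbrakk>a \<in> carrier R; x \<in> carrier M\<rbrakk> \<Longrightarrow> f (a \<odot>\<^bsub>M\<^esub> x) = a \<odot>\<^bsub>N\<^esub> f x"
    and "\<lbrakk>a \<in> carrier R; x \<in> carrier M\<rbrakk> \<Longrightarrow> f (x \<triangleleft>\<^bsub>M\<^esub> a) = f x \<triangleleft>\<^bsub>N\<^esub> a"
  using assms by (auto simp: bimod_hom_def left_hom_def)

lemma bimod_isoI: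
  assumes "bimodule R M" "bimodule R N" "f \<in> bimod_hom R M N"
    and "\<And>y. y \<in> carrier N \<Longrightarrow> g y \<in> carrier M"
    and "\<And>x. x \<in> carrier M \<Longrightarrow> g (f x) = x"
    and "\<And>y. y \<in> carrier N \<Longrightarrow> f (g y) = y"
  shows "bimod_iso R M N"
proof -
  have "bij_betw f (carrier M) (carrier N)"
    using assms(4-) bimod_homD(1)[OF assms(3)] by (intro bij_betw_byWitness[where f' = g]) auto
  then show ?thesis
    using assms by (auto simp: bimod_iso_def)
qed

definition inverse_homs ::
    "('a, 'r) ring_scheme \<Rightarrow> ('a, 'b) bimod \<Rightarrow> ('a, 'c) bimod \<Rightarrow> ('b \<Rightarrow> 'c) \<Rightarrow> ('c \<Rightarrow> 'b) \<Rightarrow> bool"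
  where "inverse_homs R M N f g \<longleftrightarrow> f \<in> bimod_hom R M N \<and> g \<in> bimod_hom R N M \<and>
    (\<forall>x \<in> carrier M. g (f x) = x) \<and> (\<forall>y \<in> carrier N. f (g y) = y)"

lemma inverse_homsD:
  assumes "inverse_homs R M N f g"
  shows "f \<in> bimod_hom R M N" "g \<in> bimod_hom R N M"
    "x \<in> carrier M \<Longrightarrow> g (f x) = x" "y \<in> carrier N \<Longrightarrow> f (g y) = y"
  using assms by (auto simp: inverse_homs_def)

lemma bimod_isoE:
  assumes "bimod_iso R M N"
  obtains f g where "bimodule R M" "bimodule R N" "inverse_homs R M N f g"
proof -
  obtain f where M: "bimodule R M" and N: "bimodule R N" and f: "f \<in> bimod_hom R M N"
    and bij: "bij_betw f (carrier M) (carrier N)"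
    using assms by (auto simp: bimod_iso_def)
  interpret M: bimodule R M by (rule M)
  interpret N: bimodule R N by (rule N)
  let ?g = "inv_into (carrier M) f"
  note fg = bij_betw_inv_into_right[OF bij] and gf = bij_betw_inv_into_left[OF bij]
  have g: "?g y \<in> carrier M" if "y \<in> carrier N" for y
    using that bij by (metis bij_betw_imp_surj_on inv_into_into)
  have eq: "?g y = x" if "x \<in> carrier M" "f x = y" for x y
    using gf[OF that(1)] that(2) by simp
  have "?g \<in> bimod_hom R N M"
    by (intro bimod_homI add_homI; (rule g | rule eq))
      (simp_all add: g bimod_homD[OF f] fg M.rsmult_closed)
  then show thesis
    using that[OF M N] f fg gf by (auto simp: inverse_homs_def)
qed

lemma bimod_iso_refl: "bimodule R M \<Longrightarrow> bimod_iso R M M"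
  by (rule bimod_isoI[of R M M "\<lambda>x. x" "\<lambda>x. x"]) (auto intro: bimod_homI add_homI)

lemma bimod_iso_sym: "bimod_iso R M N \<Longrightarrow> bimod_iso R N M"
  by (elim bimod_isoE, rule bimod_isoI) (auto dest: inverse_homsD bimod_homD(1))

lemma bimod_iso_trans [trans]:
  assumes "bimod_iso R L M" "bimod_iso R M N"
  shows "bimod_iso R L N"
proof -
  obtain f g where L: "bimodule R L" and f: "inverse_homs R L M f g"
    using assms(1) by (rule bimod_isoE)
  obtain h k where N: "bimodule R N" and h: "inverse_homs R M N h k"
    using assms(2) by (rule bimod_isoE)
  note D = inverse_homsD(3,4)[OF f] inverse_homsD(3,4)[OF h]
    inverse_homsD(1,2)[OF f, THEN bimod_homD(1)] inverse_homsD(1,2)[OF h, THEN bimod_homD(1)]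
    inverse_homsD(1,2)[OF f, THEN bimod_homD(2)] inverse_homsD(1,2)[OF h, THEN bimod_homD(2)]
    inverse_homsD(1,2)[OF f, THEN bimod_homD(3)] inverse_homsD(1,2)[OF h, THEN bimod_homD(3)]
    inverse_homsD(1,2)[OF f, THEN bimod_homD(4)] inverse_homsD(1,2)[OF h, THEN bimod_homD(4)]
  show ?thesis
    by (rule bimod_isoI[OF L N, of "\<lambda>x. h (f x)" "\<lambda>y. g (k y)"])
      (auto intro!: bimod_homI add_homI simp: D)
qed

text \<open>Two records whose operations differ only off the carrier describe the same bimodule. The
  second one inherits the bimodule laws from the first.\<close>

lemma bimod_iso_if_actions_agree:
  assumes M: "bimodule R M" and "carrier N = carrier M" "\<zero>\<^bsub>N\<^esub> = \<zero>\<^bsub>M\<^esub>"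
    and "\<And>x y. \<lbrakk>x \<in> carrier M; y \<in> carrier M\<rbrakk> \<Longrightarrow> x \<oplus>\<^bsub>N\<^esub> y = x \<oplus>\<^bsub>M\<^esub> y"
    and "\<And>a x. \<lbrakk>a \<in> carrier R; x \<in> carrier M\<rbrakk> \<Longrightarrow> a \<odot>\<^bsub>N\<^esub> x = a \<odot>\<^bsub>M\<^esub> x"
    and "\<And>a x. \<lbrakk>a \<in> carrier R; x \<in> carrier M\<rbrakk> \<Longrightarrow> x \<triangleleft>\<^bsub>N\<^esub> a = x \<triangleleft>\<^bsub>M\<^esub> a"
  shows "bimod_iso R M N"
proof -
  interpret M: bimodule R M by (rule M)
  have "abelian_group N"
  proof (rule abelian_groupI)
    fix x assume "x \<in> carrier N"
    then show "\<exists>y \<in> carrier N. y \<oplus>\<^bsub>N\<^esub> x = \<zero>\<^bsub>N\<^esub>"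
      using assms(2-4) M.M.l_neg[of x] M.M.a_inv_closed[of x] by metis
  qed (auto simp: assms M.M.a_ac)
  then have "module R N"
    by (intro moduleI M.R.is_cring)
      (auto simp: assms M.smult_l_distr M.smult_r_distr M.smult_assoc1)
  then have "bimodule R N"
    by (intro bimodule.intro bimodule_axioms.intro)
      (auto simp: assms M.rsmult_closed M.rsmult_l_distr M.rsmult_r_distr M.rsmult_assoc
        M.rsmult_one M.smult_rsmult)
  then show ?thesis
    using M by (intro bimod_isoI[where f = "\<lambda>x. x" and g = "\<lambda>x. x"])
      (auto simp: assms intro!: bimod_homI add_homI)
qed

context tensor_pair
begin

text \<open>An inverse \<open>g\<close> of the map induced by \<open>\<beta>\<close> has to be tested on values of \<open>\<beta>\<close> only: pure tensors
  span the tensor product, and each element of \<open>M\<close> is required to be a single value of \<open>\<beta>\<close>.\<close>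

lemma tensor_isoI:
  assumes M: "bimodule R M" and \<beta>: "balanced R P Q M \<beta>"
    and left: "\<And>a p q. \<lbrakk>a \<in> carrier R; p \<in> carrier P; q \<in> carrier Q\<rbrakk> \<Longrightarrow>
      \<beta> (a \<odot>\<^bsub>P\<^esub> p) q = a \<odot>\<^bsub>M\<^esub> \<beta> p q"
    and right: "\<And>a p q. \<lbrakk>a \<in> carrier R; p \<in> carrier P; q \<in> carrier Q\<rbrakk> \<Longrightarrow>
      \<beta> p (q \<triangleleft>\<^bsub>Q\<^esub> a) = \<beta> p q \<triangleleft>\<^bsub>M\<^esub> a"
    and g: "g \<in> add_hom M T"
    and g\<beta>: "\<And>p q. \<lbrakk>p \<in> carrier P; q \<in> carrier Q\<rbrakk> \<Longrightarrow> g (\<beta> p q) = p \<otimes>\<otimes> q"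
    and surj: "\<And>m. m \<in> carrier M \<Longrightarrow> \<exists>p \<in> carrier P. \<exists>q \<in> carrier Q. m = \<beta> p q"
  shows "bimod_iso R T M"
proof -
  interpret M: bimodule R M by (rule M)
  interpret T': bimodule R T by (rule bimodule_tensor)
  obtain f where f: "f \<in> add_hom T M"
    and f_pure: "\<And>p q. \<lbrakk>p \<in> carrier P; q \<in> carrier Q\<rbrakk> \<Longrightarrow> f (p \<otimes>\<otimes> q) = \<beta> p q"
    using tensor_lift[OF M.abelian_group_axioms \<beta>] by auto
  note fD = add_homD[OF f] and gD = add_homD[OF g]
  have "f \<in> bimod_hom R T M"
  proof (rule bimod_homI[OF f])
    fix a t assume a: "a \<in> carrier R" and t: "t \<in> carrier T"
    from t show "f (a \<odot>\<^bsub>T\<^esub> t) = a \<odot>\<^bsub>M\<^esub> f t"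
      by (induction rule: tensor_induct)
        (simp_all add: a smult_pure f_pure left T'.smult_r_distr M.smult_r_distr fD)
    from t show "f (t \<triangleleft>\<^bsub>T\<^esub> a) = f t \<triangleleft>\<^bsub>M\<^esub> a"
      by (induction rule: tensor_induct)
        (simp_all add: a rsmult_pure f_pure right T'.rsmult_l_distr M.rsmult_l_distr fD
          Q.rsmult_closed T'.rsmult_closed)
  qed
  moreover have "g (f t) = t" if "t \<in> carrier T" for t
    using that by (induction rule: tensor_induct) (simp_all add: f_pure g\<beta> fD gD)
  moreover have "f (g m) = m" if "m \<in> carrier M" for m
    using surj[OF that] by (auto simp: f_pure g\<beta>)
  ultimately show ?thesis
    using gD(1) by (intro bimod_isoI[OF bimodule_tensor M, of f g])
qed

end

lemma tensor_cong:
  assumes "bimod_iso R P P'" "bimod_iso R Q Q'"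
  shows "bimod_iso R (tensor R P Q) (tensor R P' Q')"
proof -
  obtain f f' where P: "bimodule R P" "bimodule R P'" and f: "inverse_homs R P P' f f'"
    using assms(1) by (rule bimod_isoE)
  obtain g g' where Q: "bimodule R Q" "bimodule R Q'" and g: "inverse_homs R Q Q' g g'"
    using assms(2) by (rule bimod_isoE)
  interpret S: tensor_pair R P Q using P Q by (simp add: tensor_pair_def)
  interpret T: tensor_pair R P' Q' using P Q by (simp add: tensor_pair_def)
  interpret ST: bimodule R "tensor R P Q" by (rule S.bimodule_tensor)
  interpret TT: bimodule R "tensor R P' Q'" by (rule T.bimodule_tensor)
  note D = bimod_homD[OF inverse_homsD(1)[OF f]] bimod_homD[OF inverse_homsD(2)[OF f]]
    bimod_homD[OF inverse_homsD(1)[OF g]] bimod_homD[OF inverse_homsD(2)[OF g]]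
    inverse_homsD(3,4)[OF f] inverse_homsD(3,4)[OF g]
  have "balanced R P Q (tensor R P' Q') (\<lambda>p q. pure_tensor R P' Q' (f p) (g q))"
    by (rule balancedI) (simp_all add: D T.pure_closed T.pure_add_left T.pure_add_right T.pure_balanced)
  from S.tensor_lift[OF T.abelian_group_tensor this]
  obtain h where h: "h \<in> add_hom (tensor R P Q) (tensor R P' Q')"
    "\<And>p q. \<lbrakk>p \<in> carrier P; q \<in> carrier Q\<rbrakk> \<Longrightarrow>
      h (pure_tensor R P Q p q) = pure_tensor R P' Q' (f p) (g q)"
    by blast
  have "balanced R P' Q' (tensor R P Q) (\<lambda>p q. pure_tensor R P Q (f' p) (g' q))"
    by (rule balancedI) (simp_all add: D S.pure_closed S.pure_add_left S.pure_add_right S.pure_balanced)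
  from T.tensor_lift[OF S.abelian_group_tensor this]
  obtain k where k: "k \<in> add_hom (tensor R P' Q') (tensor R P Q)"
    "\<And>p q. \<lbrakk>p \<in> carrier P'; q \<in> carrier Q'\<rbrakk> \<Longrightarrow>
      k (pure_tensor R P' Q' p q) = pure_tensor R P Q (f' p) (g' q)"
    by blast
  note hD = add_homD[OF h(1)] and kD = add_homD[OF k(1)]
  have "h \<in> bimod_hom R (tensor R P Q) (tensor R P' Q')"
  proof (rule bimod_homI[OF h(1)])
    fix a t assume a: "a \<in> carrier R" and t: "t \<in> carrier (tensor R P Q)"
    from t show "h (a \<odot>\<^bsub>tensor R P Q\<^esub> t) = a \<odot>\<^bsub>tensor R P' Q'\<^esub> h t"
      by (induction rule: S.tensor_induct)
        (simp_all add: a S.smult_pure T.smult_pure D h(2) hD ST.smult_r_distr TT.smult_r_distr)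
    from t show "h (t \<triangleleft>\<^bsub>tensor R P Q\<^esub> a) = h t \<triangleleft>\<^bsub>tensor R P' Q'\<^esub> a"
      by (induction rule: S.tensor_induct)
        (simp_all add: a S.rsmult_pure T.rsmult_pure D h(2) hD ST.rsmult_l_distr TT.rsmult_l_distr
          S.Q.rsmult_closed ST.rsmult_closed)
  qed
  moreover have "k (h t) = t" if "t \<in> carrier (tensor R P Q)" for t
    using that by (induction rule: S.tensor_induct) (simp_all add: h(2) k(2) hD kD D)
  moreover have "h (k t) = t" if "t \<in> carrier (tensor R P' Q')" for t
    using that by (induction rule: T.tensor_induct) (simp_all add: h(2) k(2) hD kD D)
  ultimately show ?thesis
    using kD(1) by (intro bimod_isoI[OF S.bimodule_tensor T.bimodule_tensor])
qed

text \<open>For a fixed \<open>w\<close> the assignment \<open>p \<otimes> q \<mapsto> p \<otimes> (q \<otimes> w)\<close> defines an additive map, and these maps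
  depend on \<open>w\<close> in a balanced way; this gives a map out of \<open>(P \<otimes> Q) \<otimes> W\<close>. Fixing \<open>p\<close> instead gives the
  map in the other direction, and the two are inverse to each other on threefold pure tensors.\<close>

lemma tensor_assoc:
  assumes P: "bimodule R P" and Q: "bimodule R Q" and W: "bimodule R W"
  shows "bimod_iso R (tensor R (tensor R P Q) W) (tensor R P (tensor R Q W))"
proof -
  interpret PQ: tensor_pair R P Q using P Q by (simp add: tensor_pair_def)
  interpret QW: tensor_pair R Q W using Q W by (simp add: tensor_pair_def)
  let ?S = "tensor R P Q" and ?T = "tensor R Q W"
  let ?A = "tensor R ?S W" and ?B = "tensor R P ?T"
  interpret A: tensor_pair R ?S W using PQ.bimodule_tensor W by (simp add: tensor_pair_def)
  interpret B: tensor_pair R P ?T using QW.bimodule_tensor P by (simp add: tensor_pair_def)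
  interpret A': bimodule R ?A by (rule A.bimodule_tensor)
  interpret B': bimodule R ?B by (rule B.bimodule_tensor)
  let ?a = "\<lambda>p q w. pure_tensor R ?S W (pure_tensor R P Q p q) w"
  let ?b = "\<lambda>p q w. pure_tensor R P ?T p (pure_tensor R Q W q w)"

  have A_induct: "\<Phi> u" if u: "u \<in> carrier ?A"
    and pure: "\<And>p q w. \<lbrakk>p \<in> carrier P; q \<in> carrier Q; w \<in> carrier W\<rbrakk> \<Longrightarrow> \<Phi> (?a p q w)"
    and add: "\<And>u v. \<lbrakk>u \<in> carrier ?A; v \<in> carrier ?A; \<Phi> u; \<Phi> v\<rbrakk> \<Longrightarrow> \<Phi> (u \<oplus>\<^bsub>?A\<^esub> v)" for \<Phi> u
    using u
  proof (induction rule: A.tensor_induct)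
    case (pure s w)
    from \<open>s \<in> carrier ?S\<close> show ?case
    proof (induction rule: PQ.tensor_induct)
      case (add s s')
      then show ?case
        using that(3) \<open>w \<in> carrier W\<close> by (simp add: A.pure_add_left A.pure_closed)
    qed (simp add: that(2) \<open>w \<in> carrier W\<close>)
  qed (rule add)
  have B_induct: "\<Phi> u" if u: "u \<in> carrier ?B"
    and pure: "\<And>p q w. \<lbrakk>p \<in> carrier P; q \<in> carrier Q; w \<in> carrier W\<rbrakk> \<Longrightarrow> \<Phi> (?b p q w)"
    and add: "\<And>u v. \<lbrakk>u \<in> carrier ?B; v \<in> carrier ?B; \<Phi> u; \<Phi> v\<rbrakk> \<Longrightarrow> \<Phi> (u \<oplus>\<^bsub>?B\<^esub> v)" for \<Phi> u
    using u
  proof (induction rule: B.tensor_induct)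
    case (pure p s)
    from \<open>s \<in> carrier ?T\<close> show ?case
    proof (induction rule: QW.tensor_induct)
      case (add s s')
      then show ?case
        using that(3) \<open>p \<in> carrier P\<close> by (simp add: B.pure_add_right B.pure_closed)
    qed (simp add: that(2) \<open>p \<in> carrier P\<close>)
  qed (rule add)

  note pc = PQ.pure_closed QW.pure_closed A.pure_closed B.pure_closed
    PQ.P.rsmult_closed PQ.Q.rsmult_closed QW.Q.rsmult_closed A.P.rsmult_closed B.Q.rsmult_closed
    A'.rsmult_closed B'.rsmult_closed
  note pl = PQ.pure_add_left QW.pure_add_left A.pure_add_left B.pure_add_left
    PQ.pure_add_right QW.pure_add_right A.pure_add_right B.pure_add_right
  note sp = PQ.smult_pure QW.smult_pure A.smult_pure B.smult_pure
    PQ.rsmult_pure QW.rsmult_pure A.rsmult_pure B.rsmult_pure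
    A.P.smult_r_distr B.Q.smult_r_distr A'.smult_r_distr B'.smult_r_distr
    A.P.rsmult_l_distr B.Q.rsmult_l_distr A'.rsmult_l_distr B'.rsmult_l_distr

  have "\<exists>f. f \<in> add_hom ?S ?B \<and>
      (\<forall>p \<in> carrier P. \<forall>q \<in> carrier Q. f (pure_tensor R P Q p q) = ?b p q w)" if w: "w \<in> carrier W" for w
  proof -
    have "balanced R P Q ?B (\<lambda>p q. ?b p q w)"
      by (rule balancedI) (simp_all add: w pc pl B.pure_balanced QW.smult_pure)
    then show ?thesis
      by (rule PQ.tensor_lift[OF B.abelian_group_tensor])
  qed
  then obtain f where f: "\<And>w. w \<in> carrier W \<Longrightarrow> f w \<in> add_hom ?S ?B"
    and f_pure: "\<And>p q w. \<lbrakk>p \<in> carrier P; q \<in> carrier Q; w \<in> carrier W\<rbrakk> \<Longrightarrow>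
      f w (pure_tensor R P Q p q) = ?b p q w"
    by metis
  note fD = add_homD[OF f]
  have "balanced R ?S W ?B (\<lambda>s w. f w s)"
  proof (rule balancedI)
    fix s w w' assume s: "s \<in> carrier ?S" and w: "w \<in> carrier W" "w' \<in> carrier W"
    from s show "f (w \<oplus>\<^bsub>W\<^esub> w') s = f w s \<oplus>\<^bsub>?B\<^esub> f w' s"
      by (induction rule: PQ.tensor_induct)
        (simp_all add: w f_pure pc pl fD B.T.a_ac)
  next
    fix s a w assume s: "s \<in> carrier ?S" and a: "a \<in> carrier R" and w: "w \<in> carrier W"
    from s show "f w (s \<triangleleft>\<^bsub>?S\<^esub> a) = f (a \<odot>\<^bsub>W\<^esub> w) s"
      by (induction rule: PQ.tensor_induct)
        (simp_all add: a w f_pure pc sp fD QW.pure_balanced)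
  qed (simp_all add: fD)
  from A.tensor_lift[OF B.abelian_group_tensor this]
  obtain F where F: "F \<in> add_hom ?A ?B"
    and F_pure: "\<And>s w. \<lbrakk>s \<in> carrier ?S; w \<in> carrier W\<rbrakk> \<Longrightarrow> F (pure_tensor R ?S W s w) = f w s"
    by blast
  have F_pure3: "F (?a p q w) = ?b p q w"
    if "p \<in> carrier P" "q \<in> carrier Q" "w \<in> carrier W" for p q w
    using that by (simp add: F_pure f_pure pc)

  have "\<exists>g. g \<in> add_hom ?T ?A \<and>
      (\<forall>q \<in> carrier Q. \<forall>w \<in> carrier W. g (pure_tensor R Q W q w) = ?a p q w)" if p: "p \<in> carrier P" for p
  proof -
    have "balanced R Q W ?A (\<lambda>q w. ?a p q w)"
      by (rule balancedI) (simp_all add: p pc pl PQ.rsmult_pure[symmetric] A.pure_balanced)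
    then show ?thesis
      by (rule QW.tensor_lift[OF A.abelian_group_tensor])
  qed
  then obtain g where g: "\<And>p. p \<in> carrier P \<Longrightarrow> g p \<in> add_hom ?T ?A"
    and g_pure: "\<And>p q w. \<lbrakk>p \<in> carrier P; q \<in> carrier Q; w \<in> carrier W\<rbrakk> \<Longrightarrow>
      g p (pure_tensor R Q W q w) = ?a p q w"
    by metis
  note gD = add_homD[OF g]
  have "balanced R P ?T ?A g"
  proof (rule balancedI)
    fix p p' s assume s: "s \<in> carrier ?T" and p: "p \<in> carrier P" "p' \<in> carrier P"
    from s show "g (p \<oplus>\<^bsub>P\<^esub> p') s = g p s \<oplus>\<^bsub>?A\<^esub> g p' s"
      by (induction rule: QW.tensor_induct)
        (simp_all add: p g_pure pc pl gD A.T.a_ac)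
  next
    fix s a p assume s: "s \<in> carrier ?T" and a: "a \<in> carrier R" and p: "p \<in> carrier P"
    from s show "g (p \<triangleleft>\<^bsub>P\<^esub> a) s = g p (a \<odot>\<^bsub>?T\<^esub> s)"
      by (induction rule: QW.tensor_induct)
        (simp_all add: a p g_pure pc sp gD PQ.pure_balanced)
  qed (simp_all add: gD)
  from B.tensor_lift[OF A.abelian_group_tensor this]
  obtain H where H: "H \<in> add_hom ?B ?A"
    and H_pure: "\<And>p s. \<lbrakk>p \<in> carrier P; s \<in> carrier ?T\<rbrakk> \<Longrightarrow> H (pure_tensor R P ?T p s) = g p s"
    by blast
  have H_pure3: "H (?b p q w) = ?a p q w"
    if "p \<in> carrier P" "q \<in> carrier Q" "w \<in> carrier W" for p q w
    using that by (simp add: H_pure g_pure pc)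

  note FD = add_homD[OF F] and HD = add_homD[OF H]
  have "F \<in> bimod_hom R ?A ?B"
  proof (rule bimod_homI[OF F])
    fix a u assume a: "a \<in> carrier R" and u: "u \<in> carrier ?A"
    from u show "F (a \<odot>\<^bsub>?A\<^esub> u) = a \<odot>\<^bsub>?B\<^esub> F u"
      by (rule A_induct) (simp_all add: a sp pc F_pure3 FD)
    from u show "F (u \<triangleleft>\<^bsub>?A\<^esub> a) = F u \<triangleleft>\<^bsub>?B\<^esub> a"
      by (rule A_induct) (simp_all add: a sp pc F_pure3 FD)
  qed
  moreover have "H (F u) = u" if "u \<in> carrier ?A" for u
    using that by (rule A_induct) (simp_all add: F_pure3 H_pure3 FD HD)
  moreover have "F (H u) = u" if "u \<in> carrier ?B" for u
    using that by (rule B_induct) (simp_all add: F_pure3 H_pure3 FD HD)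
  ultimately show ?thesis
    using HD(1) by (intro bimod_isoI[OF A.bimodule_tensor B.bimodule_tensor])
qed


section \<open>Projective modules of rank at most one\<close>

definition linear_form ::
    "('a, 'r) ring_scheme \<Rightarrow> ('a, 'b, 'm) module_scheme \<Rightarrow> ('b \<Rightarrow> 'a) \<Rightarrow> bool"
  where "linear_form R M f \<longleftrightarrow> f \<in> add_hom M R \<and>
    (\<forall>a \<in> carrier R. \<forall>x \<in> carrier M. f (a \<odot>\<^bsub>M\<^esub> x) = a \<otimes>\<^bsub>R\<^esub> f x)"

definition dual_basis ::
    "('a, 'r) ring_scheme \<Rightarrow> ('a, 'b, 'm) module_scheme \<Rightarrow> 'i set \<Rightarrow> ('i \<Rightarrow> 'b \<Rightarrow> 'a) \<Rightarrow> ('i \<Rightarrow> 'b) \<Rightarrow> bool"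
  where "dual_basis R M I f x \<longleftrightarrow> finite I \<and> (\<forall>i \<in> I. linear_form R M (f i)) \<and> x \<in> I \<rightarrow> carrier M \<and>
    (\<forall>m \<in> carrier M. (\<Oplus>\<^bsub>M\<^esub>i \<in> I. f i m \<odot>\<^bsub>M\<^esub> x i) = m)"

text \<open>If \<open>M\<close> is the image of an idempotent matrix, then this identity is the vanishing of all
  \<open>2 \<times> 2\<close> minors of that matrix, that is, all localizations of \<open>M\<close> have rank at most one.\<close>

definition rank_le_one :: "('a, 'r) ring_scheme \<Rightarrow> ('a, 'b, 'm) module_scheme \<Rightarrow> bool"
  where "rank_le_one R M \<longleftrightarrow> (\<forall>f. linear_form R M f \<longrightarrow>
    (\<forall>x \<in> carrier M. \<forall>y \<in> carrier M. f x \<odot>\<^bsub>M\<^esub> y = f y \<odot>\<^bsub>M\<^esub> x))"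

lemma linear_formI:
  assumes "\<And>x. x \<in> carrier M \<Longrightarrow> f x \<in> carrier R"
    and "\<And>x y. \<lbrakk>x \<in> carrier M; y \<in> carrier M\<rbrakk> \<Longrightarrow> f (x \<oplus>\<^bsub>M\<^esub> y) = f x \<oplus>\<^bsub>R\<^esub> f y"
    and "\<And>a x. \<lbrakk>a \<in> carrier R; x \<in> carrier M\<rbrakk> \<Longrightarrow> f (a \<odot>\<^bsub>M\<^esub> x) = a \<otimes>\<^bsub>R\<^esub> f x"
  shows "linear_form R M f"
  using assms by (simp add: linear_form_def add_hom_def)

lemma linear_formD:
  assumes "linear_form R M f"
  shows "x \<in> carrier M \<Longrightarrow> f x \<in> carrier R"
    and "\<lbrakk>x \<in> carrier M; y \<in> carrier M\<rbrakk> \<Longrightarrow> f (x \<oplus>\<^bsub>M\<^esub> y) = f x \<oplus>\<^bsub>R\<^esub> f y"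
    and "\<lbrakk>a \<in> carrier R; x \<in> carrier M\<rbrakk> \<Longrightarrow> f (a \<odot>\<^bsub>M\<^esub> x) = a \<otimes>\<^bsub>R\<^esub> f x"
  using assms by (auto simp: linear_form_def add_hom_def)

lemma dual_basisD:
  assumes "dual_basis R M I f x"
  shows "finite I" "\<And>i. i \<in> I \<Longrightarrow> linear_form R M (f i)" "\<And>i. i \<in> I \<Longrightarrow> x i \<in> carrier M"
    "\<And>m. m \<in> carrier M \<Longrightarrow> (\<Oplus>\<^bsub>M\<^esub>i \<in> I. f i m \<odot>\<^bsub>M\<^esub> x i) = m"
  using assms by (auto simp: dual_basis_def)

lemma left_homD:
  assumes "h \<in> left_hom R M N"
  shows "x \<in> carrier M \<Longrightarrow> h x \<in> carrier N"
    and "\<lbrakk>x \<in> carrier M; y \<in> carrier M\<rbrakk> \<Longrightarrow> h (x \<oplus>\<^bsub>M\<^esub> y) = h x \<oplus>\<^bsub>N\<^esub> h y"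
    and "\<lbrakk>a \<in> carrier R; x \<in> carrier M\<rbrakk> \<Longrightarrow> h (a \<odot>\<^bsub>M\<^esub> x) = a \<odot>\<^bsub>N\<^esub> h x"
  using assms by (auto simp: left_hom_def)

lemma add_hom_zero:
  assumes "abelian_group A" "abelian_group B" "h \<in> add_hom A B"
  shows "h \<zero>\<^bsub>A\<^esub> = \<zero>\<^bsub>B\<^esub>"
proof -
  interpret A: abelian_group A by fact
  interpret B: abelian_group B by fact
  have "h \<zero>\<^bsub>A\<^esub> \<oplus>\<^bsub>B\<^esub> h \<zero>\<^bsub>A\<^esub> = h \<zero>\<^bsub>A\<^esub>"
    using add_homD(2)[OF assms(3), of "\<zero>\<^bsub>A\<^esub>" "\<zero>\<^bsub>A\<^esub>"] by simp
  then show ?thesis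
    using add_homD(1)[OF assms(3) A.zero_closed] by (metis B.add.r_cancel_one)
qed

lemma add_hom_finsum:
  assumes "abelian_group A" "abelian_group B" "h \<in> add_hom A B"
    and "finite I" "x \<in> I \<rightarrow> carrier A"
  shows "h (\<Oplus>\<^bsub>A\<^esub>i \<in> I. x i) = (\<Oplus>\<^bsub>B\<^esub>i \<in> I. h (x i))"
proof -
  interpret A: abelian_group A by fact
  interpret B: abelian_group B by fact
  show ?thesis
    using assms(4,5)
  proof (induction I)
    case empty
    then show ?case by (simp add: add_hom_zero[OF assms(1-3)])
  next
    case (insert i I)
    then show ?case
      using add_homD[OF assms(3)] by (auto simp: A.finsum_insert B.finsum_insert Pi_def)
  qed
qed

lemma (in abelian_monoid) finsum_Times:
  assumes "finite I" "finite J" "\<And>i j. \<lbrakk>i \<in> I; j \<in> J\<rbrakk> \<Longrightarrow> f i j \<in> carrier G"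
  shows "(\<Oplus>\<^bsub>G\<^esub>p \<in> I \<times> J. f (fst p) (snd p)) = (\<Oplus>\<^bsub>G\<^esub>i \<in> I. \<Oplus>\<^bsub>G\<^esub>j \<in> J. f i j)"
  using assms(1,3)
proof (induction I)
  case (insert i I)
  have "(\<Oplus>\<^bsub>G\<^esub>p \<in> Pair i ` J. f (fst p) (snd p)) = (\<Oplus>\<^bsub>G\<^esub>j \<in> J. f i j)"
    using insert.prems by (subst finsum_reindex) (auto simp: inj_on_def)
  moreover have "insert i I \<times> J = Pair i ` J \<union> I \<times> J"
    by auto
  moreover have "(\<Oplus>\<^bsub>G\<^esub>p \<in> Pair i ` J \<union> I \<times> J. f (fst p) (snd p)) =
      (\<Oplus>\<^bsub>G\<^esub>p \<in> Pair i ` J. f (fst p) (snd p)) \<oplus>\<^bsub>G\<^esub> (\<Oplus>\<^bsub>G\<^esub>p \<in> I \<times> J. f (fst p) (snd p))"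
    using insert assms(2) by (intro finsum_Un_disjoint) auto
  ultimately show ?case
    using insert by (simp add: finsum_insert finsum_closed Pi_def)
qed simp

lemma fg_projectiveI:
  fixes M :: "('a, 'b, 'm) module_scheme"
  assumes "module R M" and db: "dual_basis R M I f x"
  shows "fg_projective R M"
proof -
  interpret module R M by fact
  note dbD = dual_basisD[OF db]
  obtain k where k: "bij_betw k {..<card I} I"
    using dbD(1) by (metis atLeast0LessThan ex_bij_betw_nat_finite)
  then have kI: "k j \<in> I" if "j < card I" for j
    using that by (auto simp: bij_betw_def)
  define emb where "emb m = (\<lambda>j \<in> {..<card I}. f (k j) m)" for m
  define proj where "proj u = (\<Oplus>\<^bsub>M\<^esub>j \<in> {..<card I}. u j \<odot>\<^bsub>M\<^esub> x (k j))" for u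
  have "emb \<in> left_hom R M (free_module R (card I))"
    using linear_formD[OF dbD(2)[OF kI]]
    by (auto simp: left_hom_def free_module_def emb_def PiE_def intro!: restrict_ext)
  moreover have "proj \<in> left_hom R (free_module R (card I)) M"
  proof -
    have xk: "x (k j) \<in> carrier M" if "j < card I" for j
      using dbD(3)[OF kI[OF that]] .
    have uc: "u j \<in> carrier R" if "u \<in> {..<card I} \<rightarrow>\<^sub>E carrier R" "j < card I" for u j
      using that by auto
    show ?thesis
      unfolding left_hom_def free_module_def mem_Collect_eq partial_object.simps ring.simps module.simps
    proof (intro conjI ballI Pi_I)
      fix u assume u: "u \<in> {..<card I} \<rightarrow>\<^sub>E carrier R"
      show "proj u \<in> carrier M"
        unfolding proj_def using uc[OF u] xk by (intro M.finsum_closed) auto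
      show "proj (\<lambda>j \<in> {..<card I}. a \<otimes>\<^bsub>R\<^esub> u j) = a \<odot>\<^bsub>M\<^esub> proj u" if a: "a \<in> carrier R" for a
      proof -
        have "proj (\<lambda>j \<in> {..<card I}. a \<otimes>\<^bsub>R\<^esub> u j) =
            (\<Oplus>\<^bsub>M\<^esub>j \<in> {..<card I}. a \<odot>\<^bsub>M\<^esub> (u j \<odot>\<^bsub>M\<^esub> x (k j)))"
          unfolding proj_def using a uc[OF u] xk by (intro M.finsum_cong') (auto simp: smult_assoc1)
        then show ?thesis
          unfolding proj_def using a uc[OF u] xk by (subst finsum_smult_ldistr) auto
      qed
      fix v assume v: "v \<in> {..<card I} \<rightarrow>\<^sub>E carrier R"
      have "proj (\<lambda>j \<in> {..<card I}. u j \<oplus>\<^bsub>R\<^esub> v j) =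
          (\<Oplus>\<^bsub>M\<^esub>j \<in> {..<card I}. u j \<odot>\<^bsub>M\<^esub> x (k j) \<oplus>\<^bsub>M\<^esub> v j \<odot>\<^bsub>M\<^esub> x (k j))"
        unfolding proj_def using uc[OF u] uc[OF v] xk
        by (intro M.finsum_cong') (auto simp: smult_l_distr)
      then show "proj (\<lambda>j \<in> {..<card I}. u j \<oplus>\<^bsub>R\<^esub> v j) = proj u \<oplus>\<^bsub>M\<^esub> proj v"
        unfolding proj_def using uc[OF u] uc[OF v] xk by (subst (asm) M.finsum_addf) auto
    qed
  qed
  moreover have "proj (emb m) = m" if "m \<in> carrier M" for m
  proof -
    have "proj (emb m) = (\<Oplus>\<^bsub>M\<^esub>j \<in> {..<card I}. f (k j) m \<odot>\<^bsub>M\<^esub> x (k j))"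
      unfolding proj_def emb_def
      using dbD(3)[OF kI] linear_formD(1)[OF dbD(2)[OF kI] that]
      by (intro M.finsum_cong') auto
    also have "\<dots> = (\<Oplus>\<^bsub>M\<^esub>i \<in> k ` {..<card I}. f i m \<odot>\<^bsub>M\<^esub> x i)"
      using k dbD(3) linear_formD(1)[OF dbD(2) that]
      by (intro M.finsum_reindex[symmetric]) (auto simp: bij_betw_def)
    also have "\<dots> = m"
      using dbD(4)[OF that] k by (simp add: bij_betw_def)
    finally show ?thesis .
  qed
  ultimately show ?thesis
    unfolding fg_projective_def by blast
qed

lemma fg_projectiveE:
  fixes M :: "('a, 'b, 'm) module_scheme"
  assumes "module R M" and "fg_projective R M"
  obtains n :: nat and f x where "dual_basis R M {..<n} f x"
proof -
  interpret module R M by fact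
  obtain n i s where i: "i \<in> left_hom R M (free_module R n)"
    and s: "s \<in> left_hom R (free_module R n) M"
    and si: "\<And>m. m \<in> carrier M \<Longrightarrow> s (i m) = m"
    using assms(2) by (auto simp: fg_projective_def)
  note iD = left_homD[OF i] and sD = left_homD[OF s]
  define unit_vec where "unit_vec j = (\<lambda>k \<in> {..<n}. if k = j then \<one>\<^bsub>R\<^esub> else \<zero>\<^bsub>R\<^esub>)" for j
  \<comment> \<open>Cutting a vector off after its first \<open>k\<close> coordinates makes the expansion of \<open>s u\<close>
    along unit vectors accessible to induction on \<open>k\<close>.\<close>
  define trunc where "trunc u k = (\<lambda>j \<in> {..<n}. if j < k then u j else \<zero>\<^bsub>R\<^esub>)" for u :: "nat \<Rightarrow> 'a" and k
  have [simp]: "unit_vec j \<in> carrier (free_module R n)" for j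
    by (auto simp: unit_vec_def free_module_def)
  have s_trunc: "s (trunc u k) = (\<Oplus>\<^bsub>M\<^esub>j \<in> {..<k}. u j \<odot>\<^bsub>M\<^esub> s (unit_vec j))"
    if u: "u \<in> carrier (free_module R n)" and "k \<le> n" for u k
    using that(2)
  proof (induction k)
    case 0
    have "trunc u 0 = \<zero>\<^bsub>R\<^esub> \<odot>\<^bsub>free_module R n\<^esub> unit_vec 0"
      by (auto simp: trunc_def unit_vec_def free_module_def intro!: restrict_ext)
    then show ?case
      using sD(1)[of "unit_vec 0"] by (simp add: sD(3))
  next
    case (Suc k)
    have uk: "u j \<in> carrier R" if "j < n" for j
      using u that by (auto simp: free_module_def)
    have "trunc u (Suc k) = trunc u k \<oplus>\<^bsub>free_module R n\<^esub> u k \<odot>\<^bsub>free_module R n\<^esub> unit_vec k"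
      using uk Suc.prems
      by (auto simp: trunc_def unit_vec_def free_module_def less_Suc_eq intro!: restrict_ext)
    moreover have "trunc u k \<in> carrier (free_module R n)"
      using uk by (auto simp: trunc_def free_module_def)
    moreover have "u k \<odot>\<^bsub>free_module R n\<^esub> unit_vec k \<in> carrier (free_module R n)"
      using uk Suc.prems by (auto simp: unit_vec_def free_module_def)
    ultimately have "s (trunc u (Suc k)) = s (trunc u k) \<oplus>\<^bsub>M\<^esub> u k \<odot>\<^bsub>M\<^esub> s (unit_vec k)"
      using uk Suc.prems by (simp add: sD(2,3))
    also have "\<dots> = (\<Oplus>\<^bsub>M\<^esub>j \<in> insert k {..<k}. u j \<odot>\<^bsub>M\<^esub> s (unit_vec j))"
      using Suc uk sD(1) by (subst M.finsum_insert) (auto simp: M.a_comm M.finsum_closed Pi_def)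
    finally show ?case
      by (simp add: lessThan_Suc)
  qed
  have "dual_basis R M {..<n} (\<lambda>j m. i m j) (\<lambda>j. s (unit_vec j))"
    unfolding dual_basis_def
  proof (intro conjI ballI)
    fix j assume "j \<in> {..<n}"
    then show "linear_form R M (\<lambda>m. i m j)"
      using iD by (intro linear_formI) (auto simp: free_module_def)
  next
    fix m assume m: "m \<in> carrier M"
    then have "trunc (i m) n = i m"
      using iD(1)[OF m] by (auto simp: trunc_def free_module_def PiE_def extensional_def)
    then show "(\<Oplus>\<^bsub>M\<^esub>j \<in> {..<n}. i m j \<odot>\<^bsub>M\<^esub> s (unit_vec j)) = m"
      using s_trunc[OF iD(1)[OF m], of n] si[OF m] by simp
  qed (auto simp: sD(1))
  then show thesis
    by (rule that)
qed

text \<open>Write \<open>J\<^sub>i\<close> for the ideal \<open>f\<^sub>i(M)\<close>. The \<open>J\<^sub>i\<close> together generate an ideal \<open>J\<close> with \<open>JM = M\<close>, so a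
  nonzero \<open>c\<close> cannot be killed by the square of every \<open>J\<^sub>i\<close>. The induction is on a set \<open>S\<close> of indices
  such that \<open>J\<^sub>i\<close> itself kills \<open>c\<close> for all \<open>i\<close> outside \<open>S\<close>. For \<open>k\<close> in \<open>S\<close>, each multiple \<open>f\<^sub>k(z)c\<close>
  satisfies the hypotheses with \<open>S - {k}\<close>, hence vanishes; this means that \<open>c\<close> satisfies them
  with \<open>S - {k}\<close> too.\<close>

lemma (in module) square_annihilated_eq_zero:
  assumes db: "dual_basis R M I f x" and c: "c \<in> carrier M"
    and "\<And>i z z'. \<lbrakk>i \<in> I; z \<in> carrier M; z' \<in> carrier M\<rbrakk> \<Longrightarrow>
      f i z' \<odot>\<^bsub>M\<^esub> (f i z \<odot>\<^bsub>M\<^esub> c) = \<zero>\<^bsub>M\<^esub>"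
  shows "c = \<zero>\<^bsub>M\<^esub>"
proof -
  note dbD = dual_basisD[OF db]
  have "c = \<zero>\<^bsub>M\<^esub>" if "finite S" "c \<in> carrier M"
    and "\<And>i z z'. \<lbrakk>i \<in> I; z \<in> carrier M; z' \<in> carrier M\<rbrakk> \<Longrightarrow>
      f i z' \<odot>\<^bsub>M\<^esub> (f i z \<odot>\<^bsub>M\<^esub> c) = \<zero>\<^bsub>M\<^esub>"
    and "\<And>i z. \<lbrakk>i \<in> I - S; z \<in> carrier M\<rbrakk> \<Longrightarrow> f i z \<odot>\<^bsub>M\<^esub> c = \<zero>\<^bsub>M\<^esub>" for S c
    using that
  proof (induction S arbitrary: c)
    case empty
    have form0: "f i \<zero>\<^bsub>M\<^esub> = \<zero>" if "i \<in> I" for i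
      using linear_formD(3)[OF dbD(2)[OF that], of \<zero> "\<zero>\<^bsub>M\<^esub>"] linear_formD(1)[OF dbD(2)[OF that], of "\<zero>\<^bsub>M\<^esub>"]
      by simp
    \<comment> \<open>Expand \<open>x\<^sub>i\<close> in the dual basis: \<open>f\<^sub>i(c)f\<^sub>j(x\<^sub>i) = f\<^sub>i(f\<^sub>j(x\<^sub>i)c)\<close>, where \<open>J\<^sub>j\<close> kills \<open>c\<close>.\<close>
    have "f i c \<odot>\<^bsub>M\<^esub> x i = \<zero>\<^bsub>M\<^esub>" if i: "i \<in> I" for i
    proof -
      have term0: "f i c \<odot>\<^bsub>M\<^esub> (f j (x i) \<odot>\<^bsub>M\<^esub> x j) = \<zero>\<^bsub>M\<^esub>" if j: "j \<in> I" for j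
      proof -
        have xi: "x i \<in> carrier M" "x j \<in> carrier M"
          using dbD(3) i j by auto
        note r = linear_formD(1)[OF dbD(2)[OF i] empty.prems(1)] linear_formD(1)[OF dbD(2)[OF j] xi(1)]
        have "f i c \<otimes> f j (x i) = f i (f j (x i) \<odot>\<^bsub>M\<^esub> c)"
          using linear_formD(3)[OF dbD(2)[OF i] r(2) empty.prems(1)] r by (simp add: R.m_comm)
        also have "\<dots> = \<zero>"
          using empty.prems(3)[of j "x i"] j xi form0[OF i] by simp
        finally show ?thesis
          using r xi by (simp add: smult_assoc1[symmetric])
      qed
      have xi: "x i \<in> carrier M"
        using dbD(3) i by auto
      have "f i c \<odot>\<^bsub>M\<^esub> x i = f i c \<odot>\<^bsub>M\<^esub> (\<Oplus>\<^bsub>M\<^esub>j \<in> I. f j (x i) \<odot>\<^bsub>M\<^esub> x j)"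
        using dbD(4)[OF xi] by simp
      also have "\<dots> = (\<Oplus>\<^bsub>M\<^esub>j \<in> I. f i c \<odot>\<^bsub>M\<^esub> (f j (x i) \<odot>\<^bsub>M\<^esub> x j))"
        using dbD(3) linear_formD(1)[OF dbD(2) xi] linear_formD(1)[OF dbD(2)[OF i] empty.prems(1)]
        by (intro finsum_smult_ldistr dbD(1)) auto
      also have "\<dots> = (\<Oplus>\<^bsub>M\<^esub>j \<in> I. \<zero>\<^bsub>M\<^esub>)"
        using term0 by (intro M.finsum_cong') auto
      finally show ?thesis
        by simp
    qed
    then have "(\<Oplus>\<^bsub>M\<^esub>i \<in> I. f i c \<odot>\<^bsub>M\<^esub> x i) = (\<Oplus>\<^bsub>M\<^esub>i \<in> I. \<zero>\<^bsub>M\<^esub>)"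
      by (intro M.finsum_cong') auto
    then show ?case
      using dbD(4)[OF empty.prems(1)] by simp
  next
    case (insert k S)
    have "f k z \<odot>\<^bsub>M\<^esub> c = \<zero>\<^bsub>M\<^esub>" if k: "k \<in> I" and z: "z \<in> carrier M" for z
    proof (rule insert.IH)
      have fk: "f k z \<in> carrier R"
        using linear_formD(1)[OF dbD(2)[OF k] z] .
      show "f k z \<odot>\<^bsub>M\<^esub> c \<in> carrier M"
        using fk insert.prems(1) by simp
      have swap: "f i y \<odot>\<^bsub>M\<^esub> (f k z \<odot>\<^bsub>M\<^esub> d) = f k z \<odot>\<^bsub>M\<^esub> (f i y \<odot>\<^bsub>M\<^esub> d)"
        if "i \<in> I" "y \<in> carrier M" "d \<in> carrier M" for i y d
        using fk linear_formD(1)[OF dbD(2)[OF that(1)] that(2)] that(3)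
        by (simp add: smult_assoc1[symmetric] R.m_comm)
      fix i y y' assume i: "i \<in> I" and y: "y \<in> carrier M" "y' \<in> carrier M"
      show "f i y' \<odot>\<^bsub>M\<^esub> (f i y \<odot>\<^bsub>M\<^esub> (f k z \<odot>\<^bsub>M\<^esub> c)) = \<zero>\<^bsub>M\<^esub>"
        using insert.prems(1) insert.prems(2)[OF i y] fk i y linear_formD(1)[OF dbD(2)[OF i] y(1)]
        by (simp add: swap)
    next
      have fk: "f k z \<in> carrier R"
        using linear_formD(1)[OF dbD(2)[OF k] z] .
      fix i y assume i: "i \<in> I - S" and y: "y \<in> carrier M"
      show "f i y \<odot>\<^bsub>M\<^esub> (f k z \<odot>\<^bsub>M\<^esub> c) = \<zero>\<^bsub>M\<^esub>"
      proof (cases "i = k")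
        case True
        then show ?thesis
          using insert.prems(2)[OF k z y] by simp
      next
        case False
        then have "f i y \<odot>\<^bsub>M\<^esub> c = \<zero>\<^bsub>M\<^esub>"
          using insert.prems(3)[of i y] i y by simp
        then show ?thesis
          using fk i y insert.prems(1) linear_formD(1)[OF dbD(2) y, of i]
          by (metis DiffD1 R.m_comm smult_assoc1 smult_r_null)
      qed
    qed
    then have "f i z \<odot>\<^bsub>M\<^esub> c = \<zero>\<^bsub>M\<^esub>" if "i \<in> I - S" "z \<in> carrier M" for i z
      using insert.prems(3)[of i z] that by (cases "i = k") auto
    then show ?case
      using insert.IH[OF insert.prems(1,2)] by simp
  qed
  from this[of I] show ?thesis
    using assms dbD(1) by simp
qed

text \<open>The second hypothesis says that the endomorphisms \<open>z \<mapsto> g(z)w\<close> and \<open>z \<mapsto> h(z)y\<close> commute. After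
  applying a third form \<open>k\<close> it makes the products \<open>g(z)h(w)k(y)\<close> invariant under cyclic permutations
  of the arguments. If two of the three forms coincide, invariance under all permutations follows.
  Consequently \<open>c = h(w)y - h(y)w\<close> is killed by every product \<open>f\<^sub>i(z')f\<^sub>i(z)\<close>, and the preceding lemma
  applies.\<close>

lemma (in module) rank_le_one_if_commutative:
  assumes db: "dual_basis R M I f x"
    and comm: "\<And>g h w y z. \<lbrakk>linear_form R M g; linear_form R M h;
        w \<in> carrier M; y \<in> carrier M; z \<in> carrier M\<rbrakk> \<Longrightarrow>
      (g z \<otimes> h w) \<odot>\<^bsub>M\<^esub> y = (h z \<otimes> g y) \<odot>\<^bsub>M\<^esub> w"
  shows "rank_le_one R M"
  unfolding rank_le_one_def
proof (intro allI impI ballI)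
  note dbD = dual_basisD[OF db]
  fix h w y assume h: "linear_form R M h" and w: "w \<in> carrier M" and y: "y \<in> carrier M"
  note hc = linear_formD(1)[OF h]
  let ?c = "h w \<odot>\<^bsub>M\<^esub> y \<ominus>\<^bsub>M\<^esub> h y \<odot>\<^bsub>M\<^esub> w"
  have "f i z' \<odot>\<^bsub>M\<^esub> (f i z \<odot>\<^bsub>M\<^esub> ?c) = \<zero>\<^bsub>M\<^esub>"
    if i: "i \<in> I" and z: "z \<in> carrier M" "z' \<in> carrier M" for i z z'
  proof -
    let ?k = "f i"
    have k: "linear_form R M ?k" using dbD(2)[OF i] .
    note kc = linear_formD(1)[OF k]
    have "?k z \<odot>\<^bsub>M\<^esub> ?c = (?k z \<otimes> h w) \<odot>\<^bsub>M\<^esub> y \<ominus>\<^bsub>M\<^esub> (?k z \<otimes> h y) \<odot>\<^bsub>M\<^esub> w"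
      using hc kc w y z by (simp add: M.minus_eq smult_r_distr smult_r_minus smult_assoc1)
    also have "\<dots> = (h z \<otimes> ?k y) \<odot>\<^bsub>M\<^esub> w \<ominus>\<^bsub>M\<^esub> (?k z \<otimes> h y) \<odot>\<^bsub>M\<^esub> w"
      using comm[OF k h w y z(1)] by simp
    finally have "?k z' \<odot>\<^bsub>M\<^esub> (?k z \<odot>\<^bsub>M\<^esub> ?c) =
        (?k z' \<otimes> (h z \<otimes> ?k y)) \<odot>\<^bsub>M\<^esub> w \<ominus>\<^bsub>M\<^esub> (?k z' \<otimes> (?k z \<otimes> h y)) \<odot>\<^bsub>M\<^esub> w"
      using hc kc w y z by (simp add: M.minus_eq smult_r_distr smult_r_minus smult_assoc1)
    moreover have "?k z' \<otimes> (h z \<otimes> ?k y) = ?k z' \<otimes> (?k z \<otimes> h y)"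
    proof -
      have "?k ((?k z' \<otimes> h z) \<odot>\<^bsub>M\<^esub> y) = ?k ((h z' \<otimes> ?k y) \<odot>\<^bsub>M\<^esub> z)"
        using comm[OF k h z(1) y z(2)] by simp
      moreover have "?k ((?k z' \<otimes> h y) \<odot>\<^bsub>M\<^esub> z) = ?k ((h z' \<otimes> ?k z) \<odot>\<^bsub>M\<^esub> y)"
        using comm[OF k h y z] by simp
      ultimately show ?thesis
        using hc kc w y z by (simp add: linear_formD(3)[OF k] R.m_ac)
    qed
    ultimately show ?thesis
      using hc kc w y z by (simp add: M.minus_eq M.r_neg)
  qed
  then have "?c = \<zero>\<^bsub>M\<^esub>"
    using square_annihilated_eq_zero[OF db, of ?c] hc w y by simp
  then show "h w \<odot>\<^bsub>M\<^esub> y = h y \<odot>\<^bsub>M\<^esub> w"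
    using hc[OF w] hc[OF y] w y
    by (metis M.minus_eq M.a_assoc M.a_inv_closed M.l_neg M.l_zero M.r_zero smult_closed)
qed

text \<open>The scalar is the trace \<open>\<Sum>\<^sub>i f\<^sub>i(h(x\<^sub>i))\<close>, since \<open>h(m) = \<Sum>\<^sub>i f\<^sub>i(m)h(x\<^sub>i) = \<Sum>\<^sub>i f\<^sub>i(h(x\<^sub>i))m\<close>.\<close>

lemma (in module) left_hom_eq_smult:
  assumes db: "dual_basis R M I f x" and rk: "rank_le_one R M" and h: "h \<in> left_hom R M M"
  obtains t where "t \<in> carrier R" "\<And>m. m \<in> carrier M \<Longrightarrow> h m = t \<odot>\<^bsub>M\<^esub> m"
proof -
  note dbD = dual_basisD[OF db] and hD = left_homD[OF h]
  have hM: "h \<in> add_hom M M"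
    using hD by (intro add_homI)
  let ?t = "\<Oplus>i \<in> I. f i (h (x i))"
  have tc: "(\<lambda>i. f i (h (x i))) \<in> I \<rightarrow> carrier R"
    using dbD hD linear_formD(1) by fastforce
  have "h m = ?t \<odot>\<^bsub>M\<^esub> m" if m: "m \<in> carrier M" for m
  proof -
    have fc: "\<And>i. i \<in> I \<Longrightarrow> f i m \<in> carrier R"
      using linear_formD(1)[OF dbD(2) m] .
    have "h m = h (\<Oplus>\<^bsub>M\<^esub>i \<in> I. f i m \<odot>\<^bsub>M\<^esub> x i)"
      using dbD(4)[OF m] by simp
    also have "\<dots> = (\<Oplus>\<^bsub>M\<^esub>i \<in> I. h (f i m \<odot>\<^bsub>M\<^esub> x i))"
      using dbD fc by (intro add_hom_finsum[OF M.abelian_group_axioms M.abelian_group_axioms hM]) auto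
    also have "\<dots> = (\<Oplus>\<^bsub>M\<^esub>i \<in> I. f i (h (x i)) \<odot>\<^bsub>M\<^esub> m)"
      using dbD fc hD m rk tc by (intro M.finsum_cong') (auto simp: rank_le_one_def)
    also have "\<dots> = ?t \<odot>\<^bsub>M\<^esub> m"
      using m tc smult_l_distr
      by (intro add_hom_finsum[OF R.abelian_group_axioms M.abelian_group_axioms _ dbD(1), symmetric] add_homI)
        auto
    finally show ?thesis .
  qed
  moreover have "?t \<in> carrier R"
    using tc by simp
  ultimately show thesis
    using that by blast
qed

text \<open>An epimorphism from \<open>R\<^sup>o\<^sup>p\<close> enters only through the commutativity of its image, whatever the
  epimorphism is. Conversely, in rank at most one every endomorphism is a scalar, so left
  multiplication is an epimorphism.\<close>

lemma partially_invertible_iff: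
  fixes R :: "('a, 'r) ring_scheme" and P :: "('a, 'b) bimod"
  assumes K: "K \<subseteq> carrier R"
  shows "partially_invertible R K P \<longleftrightarrow>
    bimodule R P \<and> central_over K P \<and> fg_projective R P \<and> rank_le_one R P"
proof (cases "bimodule R P \<and> central_over K P \<and> fg_projective R P")
  case True
  then interpret bimodule R P by simp
  obtain n :: nat and f x where db: "dual_basis R P {..<n} f x"
    using fg_projectiveE[OF module_axioms] True by blast
  have "rank_le_one R P"
    if \<phi>: "\<phi> \<in> ring_hom (opposite R) (left_End R P)"
      and surj: "\<phi> ` carrier R = carrier (left_End R P)" for \<phi>
  proof (rule rank_le_one_if_commutative[OF db])
    fix g h w y z
    assume g: "linear_form R P g" and h: "linear_form R P h"
      and w: "w \<in> carrier P" and y: "y \<in> carrier P" and z: "z \<in> carrier P"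
    let ?E = "\<lambda>g y. \<lambda>z \<in> carrier P. g z \<odot>\<^bsub>P\<^esub> y"
    have E: "?E g y \<in> carrier (left_End R P)" if "linear_form R P g" "y \<in> carrier P" for g y
      using linear_formD[OF that(1)] that(2)
      by (auto simp: left_End_def left_hom_def smult_l_distr smult_assoc1)
    have "?E h y \<in> \<phi> ` carrier R" "?E g w \<in> \<phi> ` carrier R"
      using E[OF h y] E[OF g w] by (simp_all only: surj)
    then obtain r s where rs: "r \<in> carrier R" "s \<in> carrier R" "\<phi> r = ?E h y" "\<phi> s = ?E g w"
      by (elim imageE) (rule that, assumption+, (erule sym)+)
    have "\<phi> (s \<otimes>\<^bsub>R\<^esub> r) = compose (carrier P) (\<phi> r) (\<phi> s)"
      "\<phi> (r \<otimes>\<^bsub>R\<^esub> s) = compose (carrier P) (\<phi> s) (\<phi> r)"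
      using ring_hom_mult[OF \<phi>, of r s] ring_hom_mult[OF \<phi>, of s r] rs(1,2)
      by (auto simp: opposite_def left_End_def)
    then have "compose (carrier P) (?E h y) (?E g w) z = compose (carrier P) (?E g w) (?E h y) z"
      using rs R.m_comm by simp
    then show "(g z \<otimes>\<^bsub>R\<^esub> h w) \<odot>\<^bsub>P\<^esub> y = (h z \<otimes>\<^bsub>R\<^esub> g y) \<odot>\<^bsub>P\<^esub> w"
      using w y z linear_formD(1,3)[OF g] linear_formD(1,3)[OF h] by (simp add: compose_def)
  qed
  moreover have "\<exists>\<phi> \<in> ring_hom (opposite R) (left_End R P).
      (\<forall>k \<in> K. \<forall>r \<in> carrier R. \<phi> (k \<otimes>\<^bsub>R\<^esub> r) = k \<odot>\<^bsub>left_End R P\<^esub> \<phi> r) \<and>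
      \<phi> ` carrier R = carrier (left_End R P)" if rk: "rank_le_one R P"
  proof (intro bexI conjI ballI)
    let ?\<phi> = "\<lambda>r. \<lambda>z \<in> carrier P. r \<odot>\<^bsub>P\<^esub> z"
    have \<phi>_closed: "?\<phi> r \<in> carrier (left_End R P)" if "r \<in> carrier R" for r
      using that by (auto simp: left_End_def left_hom_def smult_r_distr smult_assoc1[symmetric] R.m_comm)
    then show "?\<phi> \<in> ring_hom (opposite R) (left_End R P)"
      by (intro ring_hom_memI)
        (auto simp: opposite_def left_End_def compose_def smult_assoc1[symmetric] R.m_comm smult_l_distr
          intro!: restrict_ext)
    show "?\<phi> (k \<otimes>\<^bsub>R\<^esub> r) = k \<odot>\<^bsub>left_End R P\<^esub> ?\<phi> r" if "k \<in> K" "r \<in> carrier R" for k r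
      using that K by (auto simp: left_End_def smult_assoc1 intro!: restrict_ext)
    show "?\<phi> ` carrier R = carrier (left_End R P)"
    proof
      show "carrier (left_End R P) \<subseteq> ?\<phi> ` carrier R"
      proof
        fix h assume "h \<in> carrier (left_End R P)"
        then have h: "h \<in> left_hom R P P" "h \<in> extensional (carrier P)"
          by (auto simp: left_End_def)
        obtain t where "t \<in> carrier R" "\<And>m. m \<in> carrier P \<Longrightarrow> h m = t \<odot>\<^bsub>P\<^esub> m"
          using left_hom_eq_smult[OF db rk h(1)] by blast
        then show "h \<in> ?\<phi> ` carrier R"
          using h(2) by (intro image_eqI[of _ _ t]) (auto simp: extensional_def)
      qed
    qed (use \<phi>_closed in blast)
  qed
  ultimately show ?thesis
    using True by (auto simp: partially_invertible_def)
qed (auto simp: partially_invertible_def)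


section \<open>Restriction of scalars along a non-unital endomorphism\<close>

definition nonunital_endo :: "('a, 'r) ring_scheme \<Rightarrow> ('a \<Rightarrow> 'a) \<Rightarrow> bool"
  where "nonunital_endo R \<theta> \<longleftrightarrow> \<theta> \<in> add_hom R R \<and>
    (\<forall>r \<in> carrier R. \<forall>s \<in> carrier R. \<theta> (r \<otimes>\<^bsub>R\<^esub> s) = \<theta> r \<otimes>\<^bsub>R\<^esub> \<theta> s)"

text \<open>Through \<open>\<theta>\<close>, the unit of \<open>R\<close> acts as \<open>\<theta>(1)\<close>. The carrier is cut down to the elements fixed by
  \<open>\<theta>(1)\<close>, so that the new left action is unital.\<close>

definition pullback_bimod ::
    "('a, 'r) ring_scheme \<Rightarrow> ('a \<Rightarrow> 'a) \<Rightarrow> ('a, 'b) bimod \<Rightarrow> ('a, 'b) bimod"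
  where "pullback_bimod R \<theta> Q = Q\<lparr>carrier := {q \<in> carrier Q. \<theta> \<one>\<^bsub>R\<^esub> \<odot>\<^bsub>Q\<^esub> q = q},
    smult := (\<lambda>r q. \<theta> r \<odot>\<^bsub>Q\<^esub> q)\<rparr>"

abbreviation regular_bimod :: "('a, 'r) ring_scheme \<Rightarrow> ('a, 'a) bimod"
  where "regular_bimod R \<equiv> ideal_bimod R (carrier R)"

text \<open>This is \<open>E(\<theta>)\<close>, the ideal \<open>R\<theta>(1)\<close> with left action through \<open>\<theta>\<close>.\<close>

abbreviation endo_bimod :: "('a, 'r) ring_scheme \<Rightarrow> ('a \<Rightarrow> 'a) \<Rightarrow> ('a, 'a) bimod"
  where "endo_bimod R \<theta> \<equiv> pullback_bimod R \<theta> (regular_bimod R)"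

lemma pullback_bimod_simps:
  "carrier (pullback_bimod R \<theta> Q) = {q \<in> carrier Q. \<theta> \<one>\<^bsub>R\<^esub> \<odot>\<^bsub>Q\<^esub> q = q}"
  "\<zero>\<^bsub>pullback_bimod R \<theta> Q\<^esub> = \<zero>\<^bsub>Q\<^esub>"
  "x \<oplus>\<^bsub>pullback_bimod R \<theta> Q\<^esub> y = x \<oplus>\<^bsub>Q\<^esub> y"
  "r \<odot>\<^bsub>pullback_bimod R \<theta> Q\<^esub> x = \<theta> r \<odot>\<^bsub>Q\<^esub> x"
  "x \<triangleleft>\<^bsub>pullback_bimod R \<theta> Q\<^esub> r = x \<triangleleft>\<^bsub>Q\<^esub> r"
  by (simp_all add: pullback_bimod_def)

lemma ideal_bimod_simps:
  "carrier (ideal_bimod R I) = I"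
  "\<zero>\<^bsub>ideal_bimod R I\<^esub> = \<zero>\<^bsub>R\<^esub>"
  "x \<oplus>\<^bsub>ideal_bimod R I\<^esub> y = x \<oplus>\<^bsub>R\<^esub> y"
  "r \<odot>\<^bsub>ideal_bimod R I\<^esub> d = r \<otimes>\<^bsub>R\<^esub> d"
  "d \<triangleleft>\<^bsub>ideal_bimod R I\<^esub> r = d \<otimes>\<^bsub>R\<^esub> r"
  by (simp_all add: ideal_bimod_def)

lemma endo_bimod_simps:
  "carrier (endo_bimod R \<theta>) = {d \<in> carrier R. \<theta> \<one>\<^bsub>R\<^esub> \<otimes>\<^bsub>R\<^esub> d = d}"
  "\<zero>\<^bsub>endo_bimod R \<theta>\<^esub> = \<zero>\<^bsub>R\<^esub>"
  "x \<oplus>\<^bsub>endo_bimod R \<theta>\<^esub> y = x \<oplus>\<^bsub>R\<^esub> y"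
  "r \<odot>\<^bsub>endo_bimod R \<theta>\<^esub> d = \<theta> r \<otimes>\<^bsub>R\<^esub> d"
  "d \<triangleleft>\<^bsub>endo_bimod R \<theta>\<^esub> r = d \<otimes>\<^bsub>R\<^esub> r"
  by (simp_all add: pullback_bimod_simps ideal_bimod_simps)

lemma nonunital_endoD:
  assumes "nonunital_endo R \<theta>"
  shows "r \<in> carrier R \<Longrightarrow> \<theta> r \<in> carrier R"
    and "\<lbrakk>r \<in> carrier R; s \<in> carrier R\<rbrakk> \<Longrightarrow> \<theta> (r \<oplus>\<^bsub>R\<^esub> s) = \<theta> r \<oplus>\<^bsub>R\<^esub> \<theta> s"
    and "\<lbrakk>r \<in> carrier R; s \<in> carrier R\<rbrakk> \<Longrightarrow> \<theta> (r \<otimes>\<^bsub>R\<^esub> s) = \<theta> r \<otimes>\<^bsub>R\<^esub> \<theta> s"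
  using assms by (auto simp: nonunital_endo_def add_hom_def)

lemma (in cring) nonunital_endo_one:
  "\<lbrakk>nonunital_endo R \<theta>; r \<in> carrier R\<rbrakk> \<Longrightarrow> \<theta> \<one> \<otimes> \<theta> r = \<theta> r"
  using nonunital_endoD(3)[of R \<theta> \<one> r] by simp

lemma (in cring) bimodule_regular: "bimodule R (regular_bimod R)"
proof (intro bimodule.intro bimodule_axioms.intro moduleI is_cring)
  show "abelian_group (regular_bimod R)"
  proof (rule abelian_groupI)
    fix x assume "x \<in> carrier (regular_bimod R)"
    then show "\<exists>y \<in> carrier (regular_bimod R). y \<oplus>\<^bsub>regular_bimod R\<^esub> x = \<zero>\<^bsub>regular_bimod R\<^esub>"
      using l_neg[of x] a_inv_closed[of x] by (auto simp: ideal_bimod_def)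
  qed (auto simp: ideal_bimod_def a_ac)
qed (auto simp: ideal_bimod_def l_distr r_distr m_assoc)

lemma (in bimodule) bimodule_pullback:
  assumes \<theta>: "nonunital_endo R \<theta>"
  shows "bimodule R (pullback_bimod R \<theta> M)"
proof -
  note D = nonunital_endoD[OF \<theta>]
  have eq: "\<theta> \<one>\<^bsub>R\<^esub> \<odot> (\<theta> a \<odot> x) = \<theta> a \<odot> x" if "a \<in> carrier R" "x \<in> carrier M" for a x
    using that D R.nonunital_endo_one[OF \<theta>] by (simp add: smult_assoc1[symmetric])
  have eq': "\<theta> \<one>\<^bsub>R\<^esub> \<odot> (x \<triangleleft> a) = x \<triangleleft> a"
    if "a \<in> carrier R" "x \<in> carrier M" "\<theta> \<one>\<^bsub>R\<^esub> \<odot> x = x" for a x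
    using that D by (simp add: smult_rsmult[symmetric])
  show ?thesis
  proof (intro bimodule.intro bimodule_axioms.intro moduleI R.is_cring)
    show "abelian_group (pullback_bimod R \<theta> M)"
    proof (rule abelian_groupI)
      fix x assume "x \<in> carrier (pullback_bimod R \<theta> M)"
      then show "\<exists>y \<in> carrier (pullback_bimod R \<theta> M). y \<oplus>\<^bsub>pullback_bimod R \<theta> M\<^esub> x = \<zero>\<^bsub>pullback_bimod R \<theta> M\<^esub>"
        using M.l_neg[of x] D by (intro bexI[of _ "\<ominus> x"]) (auto simp: pullback_bimod_simps smult_r_minus)
    qed (use D in \<open>auto simp: pullback_bimod_simps smult_r_distr M.a_ac\<close>)
  qed (auto simp: pullback_bimod_simps D eq eq' smult_l_distr smult_r_distr smult_assoc1
      rsmult_closed rsmult_l_distr rsmult_r_distr rsmult_assoc rsmult_one smult_rsmult)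
qed

text \<open>The isomorphism is \<open>d \<otimes> q \<mapsto> dq\<close> with inverse \<open>q \<mapsto> \<theta>(1) \<otimes> q\<close>: moving \<open>d\<close> across the tensor sign
  gives \<open>\<theta>(1) \<otimes> dq = \<theta>(1)d \<otimes> q = d \<otimes> q\<close>.\<close>

lemma pullback_tensor_iso:
  fixes R :: "('a, 'r) ring_scheme" and Q :: "('a, 'b) bimod"
  assumes Q: "bimodule R Q" and \<theta>: "nonunital_endo R \<theta>"
  shows "bimod_iso R (tensor R (endo_bimod R \<theta>) Q) (pullback_bimod R \<theta> Q)"
proof -
  interpret Q: bimodule R Q by (rule Q)
  let ?E = "endo_bimod R \<theta>"
  interpret reg: bimodule R "regular_bimod R" by (rule Q.R.bimodule_regular)
  interpret E: tensor_pair R ?E Q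
    using reg.bimodule_pullback[OF \<theta>] Q by (simp add: tensor_pair_def)
  note D = nonunital_endoD[OF \<theta>]
  have one: "\<theta> \<one>\<^bsub>R\<^esub> \<in> carrier ?E"
    using D Q.R.nonunital_endo_one[OF \<theta>] by (simp add: pullback_bimod_simps ideal_bimod_def)
  show ?thesis
  proof (rule E.tensor_isoI[OF Q.bimodule_pullback[OF \<theta>]])
    show "balanced R ?E Q (pullback_bimod R \<theta> Q) (\<lambda>d q. d \<odot>\<^bsub>Q\<^esub> q)"
      using D by (intro balancedI)
        (auto simp: pullback_bimod_simps ideal_bimod_def Q.smult_l_distr Q.smult_r_distr
          Q.smult_assoc1 simp flip: Q.smult_assoc1[of "\<theta> \<one>\<^bsub>R\<^esub>"])
    show "(\<lambda>q. pure_tensor R ?E Q (\<theta> \<one>\<^bsub>R\<^esub>) q) \<in> add_hom (pullback_bimod R \<theta> Q) (tensor R ?E Q)"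
      using one by (intro add_homI) (auto simp: pullback_bimod_simps E.pure_closed E.pure_add_right)
    fix d q assume d: "d \<in> carrier ?E" and q: "q \<in> carrier Q"
    then have dR: "d \<in> carrier R" "\<theta> \<one>\<^bsub>R\<^esub> \<triangleleft>\<^bsub>?E\<^esub> d = d"
      by (auto simp: pullback_bimod_simps ideal_bimod_def)
    then show "pure_tensor R ?E Q (\<theta> \<one>\<^bsub>R\<^esub>) (d \<odot>\<^bsub>Q\<^esub> q) = pure_tensor R ?E Q d q"
      using E.pure_balanced[OF one dR(1) q] by simp
  next
    fix q assume "q \<in> carrier (pullback_bimod R \<theta> Q)"
    then show "\<exists>d \<in> carrier ?E. \<exists>q' \<in> carrier Q. q = d \<odot>\<^bsub>Q\<^esub> q'"
      using one by (intro bexI[of _ "\<theta> \<one>\<^bsub>R\<^esub>"] bexI[of _ q]) (auto simp: pullback_bimod_simps)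
  qed (use D in \<open>auto simp: pullback_bimod_simps ideal_bimod_def Q.smult_assoc1 Q.smult_rsmult\<close>)
qed

lemma (in bimodule) pullback_pullback_iso:
  assumes \<theta>: "nonunital_endo R \<theta>" and \<theta>': "nonunital_endo R \<theta>'"
    and \<eta>: "\<And>r. r \<in> carrier R \<Longrightarrow> \<eta> r = \<theta>' (\<theta> r)"
  shows "bimod_iso R (pullback_bimod R \<theta> (pullback_bimod R \<theta>' M)) (pullback_bimod R \<eta> M)"
proof (rule bimod_iso_if_actions_agree)
  interpret P: bimodule R "pullback_bimod R \<theta>' M"
    by (rule bimodule_pullback[OF \<theta>'])
  show "bimodule R (pullback_bimod R \<theta> (pullback_bimod R \<theta>' M))"
    by (rule P.bimodule_pullback[OF \<theta>])
  have "\<theta>' \<one>\<^bsub>R\<^esub> \<odot> x = x" if "x \<in> carrier M" "\<theta>' (\<theta> \<one>\<^bsub>R\<^esub>) \<odot> x = x" for x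
  proof -
    have "\<theta>' \<one>\<^bsub>R\<^esub> \<odot> x = (\<theta>' \<one>\<^bsub>R\<^esub> \<otimes>\<^bsub>R\<^esub> \<theta>' (\<theta> \<one>\<^bsub>R\<^esub>)) \<odot> x"
      using that nonunital_endoD(1)[OF \<theta>] nonunital_endoD(1)[OF \<theta>'] by (simp add: smult_assoc1)
    then show ?thesis
      using that R.nonunital_endo_one[OF \<theta>'] nonunital_endoD(1)[OF \<theta>] by simp
  qed
  then show "carrier (pullback_bimod R \<eta> M) = carrier (pullback_bimod R \<theta> (pullback_bimod R \<theta>' M))"
    by (auto simp: pullback_bimod_simps \<eta>)
qed (auto simp: pullback_bimod_simps \<eta>)

text \<open>The regular bimodule is \<open>E(id)\<close>.\<close>

lemma (in cring) left_unit_iso: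
  assumes "bimodule R P"
  shows "bimod_iso R (tensor R (regular_bimod R) P) P"
proof -
  interpret P: bimodule R P by fact
  have id: "nonunital_endo R (\<lambda>r. r)"
    by (auto simp: nonunital_endo_def add_hom_def)
  have triv: "bimod_iso R Q (pullback_bimod R (\<lambda>r. r) Q)" if "bimodule R Q" for Q :: "('a, 'z) bimod"
  proof -
    interpret Q: bimodule R Q by fact
    show ?thesis
      by (intro bimod_iso_if_actions_agree that) (auto simp: pullback_bimod_simps)
  qed
  have triv': "bimod_iso R (regular_bimod R) (endo_bimod R (\<lambda>r. r))"
    by (intro bimod_iso_if_actions_agree bimodule_regular) (auto simp: pullback_bimod_simps ideal_bimod_def)
  have "bimod_iso R (tensor R (regular_bimod R) P)
      (tensor R (endo_bimod R (\<lambda>r. r)) P)"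
    by (intro tensor_cong triv' bimod_iso_refl assms)
  also have "bimod_iso R \<dots> (pullback_bimod R (\<lambda>r. r) P)"
    by (rule pullback_tensor_iso[OF assms id])
  also have "bimod_iso R \<dots> P"
    by (rule bimod_iso_sym[OF triv[OF assms]])
  finally show ?thesis .
qed

lemma (in cring) right_unit_iso:
  assumes "bimodule R P"
  shows "bimod_iso R (tensor R P (regular_bimod R)) P"
proof -
  interpret T: tensor_pair R P "regular_bimod R"
    using assms bimodule_regular by (simp add: tensor_pair_def)
  have one: "\<one> \<in> carrier (regular_bimod R)"
    by (simp add: ideal_bimod_def)
  show ?thesis
  proof (rule T.tensor_isoI[OF assms])
    show "balanced R P (regular_bimod R) P (\<lambda>p r. p \<triangleleft>\<^bsub>P\<^esub> r)"
      by (intro balancedI) (auto simp: ideal_bimod_def T.P.rsmult_closed T.P.rsmult_l_distr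
          T.P.rsmult_r_distr T.P.rsmult_assoc)
    show "(\<lambda>p. pure_tensor R P (regular_bimod R) p \<one>) \<in> add_hom P (tensor R P (regular_bimod R))"
      using one by (intro add_homI) (auto simp: T.pure_closed T.pure_add_left)
    fix p r assume "p \<in> carrier P" "r \<in> carrier (regular_bimod R)"
    then show "pure_tensor R P (regular_bimod R) (p \<triangleleft>\<^bsub>P\<^esub> r) \<one> = pure_tensor R P (regular_bimod R) p r"
      using T.pure_balanced[of p r \<one>] one by (simp add: ideal_bimod_def)
  next
    fix p assume "p \<in> carrier P"
    then show "\<exists>q \<in> carrier P. \<exists>r \<in> carrier (regular_bimod R). p = q \<triangleleft>\<^bsub>P\<^esub> r"
      using one T.P.rsmult_one by metis
  qed (auto simp: ideal_bimod_def T.P.smult_rsmult T.P.rsmult_assoc)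
qed

section \<open>The monoid laws for \<open>PicS\<close>\<close>

context tensor_pair
begin

text \<open>In \<open>p \<otimes> q = \<Sum>\<^sub>j p \<otimes> g\<^sub>j(q)y\<^sub>j\<close> the coefficient \<open>g\<^sub>j(q)\<close> moves across the tensor sign and acts on \<open>p\<close>
  from the right. The coordinates of \<open>p \<otimes> q\<close> with respect to the \<open>x\<^sub>i \<otimes> y\<^sub>j\<close> are therefore
  \<open>f\<^sub>i(p g\<^sub>j(q))\<close>.\<close>

lemma fg_projective_tensor:
  assumes "fg_projective R P" "fg_projective R Q"
  shows "fg_projective R T"
proof -
  interpret T': bimodule R T by (rule bimodule_tensor)
  obtain m :: nat and f x where dbP: "dual_basis R P {..<m} f x"
    using fg_projectiveE[OF P.module_axioms assms(1)] by blast
  obtain n :: nat and g y where dbQ: "dual_basis R Q {..<n} g y"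
    using fg_projectiveE[OF Q.module_axioms assms(2)] by blast
  note PD = dual_basisD[OF dbP] and QD = dual_basisD[OF dbQ]
  note fD = linear_formD[OF PD(2)] and gD = linear_formD[OF QD(2)]
  have "\<exists>F. F \<in> add_hom T R \<and>
      (\<forall>p \<in> carrier P. \<forall>q \<in> carrier Q. F (p \<otimes>\<otimes> q) = f i (p \<triangleleft>\<^bsub>P\<^esub> g j q))"
    if "i < m" "j < n" for i j
  proof -
    have "balanced R P Q R (\<lambda>p q. f i (p \<triangleleft>\<^bsub>P\<^esub> g j q))"
      using that by (intro balancedI)
        (simp_all add: fD gD P.rsmult_closed P.rsmult_l_distr P.rsmult_r_distr P.rsmult_assoc)
    then show ?thesis
      by (rule tensor_lift[OF P.R.abelian_group_axioms])
  qed
  then obtain F where F: "\<And>i j. \<lbrakk>i < m; j < n\<rbrakk> \<Longrightarrow> F i j \<in> add_hom T R"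
    and F_pure: "\<And>i j p q. \<lbrakk>i < m; j < n; p \<in> carrier P; q \<in> carrier Q\<rbrakk> \<Longrightarrow>
      F i j (p \<otimes>\<otimes> q) = f i (p \<triangleleft>\<^bsub>P\<^esub> g j q)"
    by metis
  note FD = add_homD[OF F]
  have F_form: "linear_form R T (F i j)" if ij: "i < m" "j < n" for i j
  proof (rule linear_formI)
    fix a t assume a: "a \<in> carrier R" and t: "t \<in> carrier T"
    from t show "F i j (a \<odot>\<^bsub>T\<^esub> t) = a \<otimes>\<^bsub>R\<^esub> F i j t"
      by (induction rule: tensor_induct)
        (simp_all add: a ij FD smult_pure F_pure P.smult_rsmult gD fD P.rsmult_closed
          T'.smult_r_distr P.R.r_distr)
  qed (use ij in \<open>simp_all add: FD\<close>)
  let ?S = "\<lambda>t. \<Oplus>\<^bsub>T\<^esub>j \<in> {..<n}. \<Oplus>\<^bsub>T\<^esub>i \<in> {..<m}. F i j t \<odot>\<^bsub>T\<^esub> (x i \<otimes>\<otimes> y j)"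
  have z: "x i \<otimes>\<otimes> y j \<in> carrier T" if "i < m" "j < n" for i j
    using that PD(3) QD(3) by (intro pure_closed) auto
  have S: "?S t = t" if "t \<in> carrier T" for t
    using that
  proof (induction rule: tensor_induct)
    case (pure p q)
    have inner: "(p \<triangleleft>\<^bsub>P\<^esub> g j q) \<otimes>\<otimes> y j = (\<Oplus>\<^bsub>T\<^esub>i \<in> {..<m}. F i j (p \<otimes>\<otimes> q) \<odot>\<^bsub>T\<^esub> (x i \<otimes>\<otimes> y j))"
      if j: "j < n" for j
    proof -
      have yj: "y j \<in> carrier Q"
        using QD(3) j by auto
      have pg: "p \<triangleleft>\<^bsub>P\<^esub> g j q \<in> carrier P"
        using pure j by (simp add: P.rsmult_closed gD)
      have "(p \<triangleleft>\<^bsub>P\<^esub> g j q) \<otimes>\<otimes> y j = (\<Oplus>\<^bsub>P\<^esub>i \<in> {..<m}. f i (p \<triangleleft>\<^bsub>P\<^esub> g j q) \<odot>\<^bsub>P\<^esub> x i) \<otimes>\<otimes> y j"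
        using PD(4)[OF pg] by simp
      also have "\<dots> = (\<Oplus>\<^bsub>T\<^esub>i \<in> {..<m}. (f i (p \<triangleleft>\<^bsub>P\<^esub> g j q) \<odot>\<^bsub>P\<^esub> x i) \<otimes>\<otimes> y j)"
        using yj pg PD(3) fD(1)
        by (intro add_hom_finsum[OF P.M.abelian_group_axioms T.abelian_group_axioms] add_homI)
          (auto simp: pure_closed pure_add_left)
      also have "\<dots> = (\<Oplus>\<^bsub>T\<^esub>i \<in> {..<m}. F i j (p \<otimes>\<otimes> q) \<odot>\<^bsub>T\<^esub> (x i \<otimes>\<otimes> y j))"
        using yj pg PD(3) fD(1) j pure
        by (intro T.finsum_cong') (auto simp: pure_closed F_pure smult_pure)
      finally show ?thesis .
    qed
    have "p \<otimes>\<otimes> q = p \<otimes>\<otimes> (\<Oplus>\<^bsub>Q\<^esub>j \<in> {..<n}. g j q \<odot>\<^bsub>Q\<^esub> y j)"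
      using QD(4) pure by simp
    also have "\<dots> = (\<Oplus>\<^bsub>T\<^esub>j \<in> {..<n}. p \<otimes>\<otimes> (g j q \<odot>\<^bsub>Q\<^esub> y j))"
      using pure QD(3) gD(1)
      by (intro add_hom_finsum[OF Q.M.abelian_group_axioms T.abelian_group_axioms] add_homI)
        (auto simp: pure_closed pure_add_right)
    also have "\<dots> = ?S (p \<otimes>\<otimes> q)"
    proof (rule T.finsum_cong'[OF refl])
      show "(\<lambda>j. \<Oplus>\<^bsub>T\<^esub>i \<in> {..<m}. F i j (p \<otimes>\<otimes> q) \<odot>\<^bsub>T\<^esub> (x i \<otimes>\<otimes> y j)) \<in> {..<n} \<rightarrow> carrier T"
        using pure z by (auto intro!: T.finsum_closed simp: FD pure_closed)
      fix j assume j: "j \<in> {..<n}"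
      have "p \<otimes>\<otimes> (g j q \<odot>\<^bsub>Q\<^esub> y j) = (p \<triangleleft>\<^bsub>P\<^esub> g j q) \<otimes>\<otimes> y j"
        using pure j QD(3) gD(1) by (intro pure_balanced[symmetric]) auto
      then show "p \<otimes>\<otimes> (g j q \<odot>\<^bsub>Q\<^esub> y j) = (\<Oplus>\<^bsub>T\<^esub>i \<in> {..<m}. F i j (p \<otimes>\<otimes> q) \<odot>\<^bsub>T\<^esub> (x i \<otimes>\<otimes> y j))"
        using inner[of j] j by simp
    qed
    finally show ?case ..
  next
    case (add u v)
    have "?S (u \<oplus>\<^bsub>T\<^esub> v) = (\<Oplus>\<^bsub>T\<^esub>j \<in> {..<n}. (\<Oplus>\<^bsub>T\<^esub>i \<in> {..<m}. F i j u \<odot>\<^bsub>T\<^esub> (x i \<otimes>\<otimes> y j)) \<oplus>\<^bsub>T\<^esub>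
        (\<Oplus>\<^bsub>T\<^esub>i \<in> {..<m}. F i j v \<odot>\<^bsub>T\<^esub> (x i \<otimes>\<otimes> y j)))"
    proof (rule T.finsum_cong'[OF refl])
      fix j assume j: "j \<in> {..<n}"
      have "(\<Oplus>\<^bsub>T\<^esub>i \<in> {..<m}. F i j (u \<oplus>\<^bsub>T\<^esub> v) \<odot>\<^bsub>T\<^esub> (x i \<otimes>\<otimes> y j)) =
          (\<Oplus>\<^bsub>T\<^esub>i \<in> {..<m}. F i j u \<odot>\<^bsub>T\<^esub> (x i \<otimes>\<otimes> y j) \<oplus>\<^bsub>T\<^esub> F i j v \<odot>\<^bsub>T\<^esub> (x i \<otimes>\<otimes> y j))"
        using j add(1,2) z by (intro T.finsum_cong') (auto simp: FD T'.smult_l_distr)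
      also have "\<dots> = (\<Oplus>\<^bsub>T\<^esub>i \<in> {..<m}. F i j u \<odot>\<^bsub>T\<^esub> (x i \<otimes>\<otimes> y j)) \<oplus>\<^bsub>T\<^esub>
          (\<Oplus>\<^bsub>T\<^esub>i \<in> {..<m}. F i j v \<odot>\<^bsub>T\<^esub> (x i \<otimes>\<otimes> y j))"
        using j add(1,2) z by (intro T.finsum_addf) (auto simp: FD)
      finally show "(\<Oplus>\<^bsub>T\<^esub>i \<in> {..<m}. F i j (u \<oplus>\<^bsub>T\<^esub> v) \<odot>\<^bsub>T\<^esub> (x i \<otimes>\<otimes> y j)) = \<dots>" .
    qed (use add(1,2) z in \<open>auto intro!: T.finsum_closed T.a_closed simp: FD\<close>)
    also have "\<dots> = ?S u \<oplus>\<^bsub>T\<^esub> ?S v"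
      using add(1,2) z by (intro T.finsum_addf) (auto intro!: T.finsum_closed simp: FD)
    finally show ?case
      using add(3,4) by simp
  qed
  have "dual_basis R T ({..<n} \<times> {..<m}) (\<lambda>ji. F (snd ji) (fst ji)) (\<lambda>ji. x (snd ji) \<otimes>\<otimes> y (fst ji))"
    unfolding dual_basis_def
  proof (intro conjI ballI)
    fix t assume t: "t \<in> carrier T"
    show "(\<Oplus>\<^bsub>T\<^esub>ji \<in> {..<n} \<times> {..<m}. F (snd ji) (fst ji) t \<odot>\<^bsub>T\<^esub> (x (snd ji) \<otimes>\<otimes> y (fst ji))) = t"
      using T.finsum_Times[of "{..<n}" "{..<m}" "\<lambda>j i. F i j t \<odot>\<^bsub>T\<^esub> (x i \<otimes>\<otimes> y j)"] t z S[OF t]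
      by (simp add: FD)
  qed (auto simp: F_form z)
  then show ?thesis
    by (rule fg_projectiveI[OF T'.module_axioms])
qed

text \<open>It suffices to exchange the two left and the two right factors in \<open>F(p \<otimes> q)(p' \<otimes> q')\<close>. For the
  left ones, \<open>p \<mapsto> F(p \<otimes> q)\<close> is a linear form on \<open>P\<close>. For the right ones, the expansion of \<open>q'\<close> in a
  dual basis has coefficients \<open>g\<^sub>j(q')\<close>. On the other side of the tensor sign each acts on \<open>P\<close> as some
  scalar \<open>t\<close> from the left, \<open>P\<close> having rank at most one; \<open>t\<close> can be pulled into \<open>F\<close> and turned back
  into \<open>g\<^sub>j(q')\<close>, which now multiplies \<open>q\<close>. There \<open>g\<^sub>j(q')q = g\<^sub>j(q)q'\<close> makes the exchange.\<close>

lemma rank_le_one_tensor: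
  assumes "fg_projective R P" "fg_projective R Q"
    and rkP: "rank_le_one R P" and rkQ: "rank_le_one R Q"
  shows "rank_le_one R T"
  unfolding rank_le_one_def
proof (intro allI impI ballI)
  interpret T': bimodule R T by (rule bimodule_tensor)
  obtain m :: nat and f x where dbP: "dual_basis R P {..<m} f x"
    using fg_projectiveE[OF P.module_axioms assms(1)] by blast
  obtain n :: nat and g y where dbQ: "dual_basis R Q {..<n} g y"
    using fg_projectiveE[OF Q.module_axioms assms(2)] by blast
  note QD = dual_basisD[OF dbQ]
  note gD = linear_formD[OF QD(2)]
  have right_mult: "\<exists>t \<in> carrier R. \<forall>p \<in> carrier P. p \<triangleleft>\<^bsub>P\<^esub> a = t \<odot>\<^bsub>P\<^esub> p" if a: "a \<in> carrier R" for a
  proof -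
    have "(\<lambda>p. p \<triangleleft>\<^bsub>P\<^esub> a) \<in> left_hom R P P"
      using a by (auto simp: left_hom_def P.rsmult_closed P.rsmult_l_distr P.smult_rsmult)
    then show ?thesis
      using P.left_hom_eq_smult[OF dbP rkP] by metis
  qed
  fix F assume F: "linear_form R T F"
  note FD = linear_formD[OF F]
  have swap_left: "F (p \<otimes>\<otimes> q) \<odot>\<^bsub>T\<^esub> (p' \<otimes>\<otimes> q') = F (p' \<otimes>\<otimes> q) \<odot>\<^bsub>T\<^esub> (p \<otimes>\<otimes> q')"
    if "p \<in> carrier P" "p' \<in> carrier P" "q \<in> carrier Q" "q' \<in> carrier Q" for p p' q q'
  proof -
    have "linear_form R P (\<lambda>p. F (p \<otimes>\<otimes> q))"
      using that by (intro linear_formI)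
        (simp_all add: FD pure_closed pure_add_left smult_pure[symmetric])
    then have "F (p \<otimes>\<otimes> q) \<odot>\<^bsub>P\<^esub> p' = F (p' \<otimes>\<otimes> q) \<odot>\<^bsub>P\<^esub> p"
      using rkP that unfolding rank_le_one_def by blast
    then show ?thesis
      using that by (simp add: smult_pure FD pure_closed)
  qed
  have expand: "F (p' \<otimes>\<otimes> q) \<odot>\<^bsub>T\<^esub> (p \<otimes>\<otimes> q') =
      (\<Oplus>\<^bsub>T\<^esub>j \<in> {..<n}. F (p' \<otimes>\<otimes> (g j q' \<odot>\<^bsub>Q\<^esub> q)) \<odot>\<^bsub>T\<^esub> (p \<otimes>\<otimes> y j))"
    if p: "p \<in> carrier P" "p' \<in> carrier P" and q: "q \<in> carrier Q" "q' \<in> carrier Q" for p p' q q'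
  proof -
    have Fc: "F (p' \<otimes>\<otimes> q) \<in> carrier R"
      using p q by (simp add: FD pure_closed)
    have "F (p' \<otimes>\<otimes> q) \<odot>\<^bsub>T\<^esub> (p \<otimes>\<otimes> q') =
        F (p' \<otimes>\<otimes> q) \<odot>\<^bsub>T\<^esub> (p \<otimes>\<otimes> (\<Oplus>\<^bsub>Q\<^esub>j \<in> {..<n}. g j q' \<odot>\<^bsub>Q\<^esub> y j))"
      using QD(4) q by simp
    also have "\<dots> = (\<Oplus>\<^bsub>T\<^esub>j \<in> {..<n}. F (p' \<otimes>\<otimes> q) \<odot>\<^bsub>T\<^esub> (p \<otimes>\<otimes> (g j q' \<odot>\<^bsub>Q\<^esub> y j)))"
      using Fc p q QD(3) gD(1)
      by (intro add_hom_finsum[OF Q.M.abelian_group_axioms T.abelian_group_axioms] add_homI)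
        (auto simp: pure_closed pure_add_right T'.smult_r_distr)
    also have "\<dots> = (\<Oplus>\<^bsub>T\<^esub>j \<in> {..<n}. F (p' \<otimes>\<otimes> (g j q' \<odot>\<^bsub>Q\<^esub> q)) \<odot>\<^bsub>T\<^esub> (p \<otimes>\<otimes> y j))"
    proof (rule T.finsum_cong'[OF refl])
      show "(\<lambda>j. F (p' \<otimes>\<otimes> (g j q' \<odot>\<^bsub>Q\<^esub> q)) \<odot>\<^bsub>T\<^esub> (p \<otimes>\<otimes> y j)) \<in> {..<n} \<rightarrow> carrier T"
        using p q QD(3) by (auto simp: FD pure_closed gD)
      fix j assume j: "j \<in> {..<n}"
      then have gj: "g j q' \<in> carrier R" and yj: "y j \<in> carrier Q"
        using gD(1) q QD(3) by auto
      obtain t where t: "t \<in> carrier R" "\<And>p. p \<in> carrier P \<Longrightarrow> p \<triangleleft>\<^bsub>P\<^esub> g j q' = t \<odot>\<^bsub>P\<^esub> p"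
        using right_mult[OF gj] by blast
      have "p \<otimes>\<otimes> (g j q' \<odot>\<^bsub>Q\<^esub> y j) = t \<odot>\<^bsub>T\<^esub> (p \<otimes>\<otimes> y j)"
        using p yj gj t by (simp add: pure_balanced[symmetric] smult_pure)
      moreover have "p' \<otimes>\<otimes> (g j q' \<odot>\<^bsub>Q\<^esub> q) = t \<odot>\<^bsub>T\<^esub> (p' \<otimes>\<otimes> q)"
        using p q gj t by (simp add: pure_balanced[symmetric] smult_pure)
      ultimately show "F (p' \<otimes>\<otimes> q) \<odot>\<^bsub>T\<^esub> (p \<otimes>\<otimes> (g j q' \<odot>\<^bsub>Q\<^esub> y j)) =
          F (p' \<otimes>\<otimes> (g j q' \<odot>\<^bsub>Q\<^esub> q)) \<odot>\<^bsub>T\<^esub> (p \<otimes>\<otimes> y j)"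
        using p q t Fc yj
        by (simp add: FD pure_closed T'.smult_assoc1[symmetric] P.R.m_comm)
    qed
    finally show ?thesis .
  qed
  have swap_right: "F (p' \<otimes>\<otimes> q) \<odot>\<^bsub>T\<^esub> (p \<otimes>\<otimes> q') = F (p' \<otimes>\<otimes> q') \<odot>\<^bsub>T\<^esub> (p \<otimes>\<otimes> q)"
    if p: "p \<in> carrier P" "p' \<in> carrier P" and q: "q \<in> carrier Q" "q' \<in> carrier Q" for p p' q q'
  proof -
    have "g j q' \<odot>\<^bsub>Q\<^esub> q = g j q \<odot>\<^bsub>Q\<^esub> q'" if "j < n" for j
      using rkQ QD(2)[of j] q that unfolding rank_le_one_def by blast
    then have "(\<Oplus>\<^bsub>T\<^esub>j \<in> {..<n}. F (p' \<otimes>\<otimes> (g j q' \<odot>\<^bsub>Q\<^esub> q)) \<odot>\<^bsub>T\<^esub> (p \<otimes>\<otimes> y j)) =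
        (\<Oplus>\<^bsub>T\<^esub>j \<in> {..<n}. F (p' \<otimes>\<otimes> (g j q \<odot>\<^bsub>Q\<^esub> q')) \<odot>\<^bsub>T\<^esub> (p \<otimes>\<otimes> y j))"
      using p q QD(3) by (intro T.finsum_cong') (auto simp: FD pure_closed gD)
    then show ?thesis
      using expand p q by simp
  qed
  fix u v assume u: "u \<in> carrier T" and v: "v \<in> carrier T"
  from u show "F u \<odot>\<^bsub>T\<^esub> v = F v \<odot>\<^bsub>T\<^esub> u"
  proof (induction rule: tensor_induct)
    case (pure p q)
    from v show ?case
    proof (induction rule: tensor_induct)
      case (pure p' q')
      then show ?case
        using \<open>p \<in> carrier P\<close> \<open>q \<in> carrier Q\<close> swap_left swap_right by simp
    next
      case (add v v')
      then show ?case
        using \<open>p \<in> carrier P\<close> \<open>q \<in> carrier Q\<close>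
        by (simp add: FD pure_closed T'.smult_r_distr T'.smult_l_distr)
    qed
  next
    case (add u u')
    then show ?case
      using v by (simp add: FD T'.smult_r_distr T'.smult_l_distr)
  qed
qed

lemma central_over_tensor:
  assumes K: "K \<subseteq> carrier R" and "central_over K P" "central_over K Q"
  shows "central_over K T"
  unfolding central_over_def
proof (intro ballI)
  interpret T': bimodule R T by (rule bimodule_tensor)
  fix a t assume "a \<in> K" and t: "t \<in> carrier T"
  then have a: "a \<in> carrier R" "\<And>p. p \<in> carrier P \<Longrightarrow> a \<odot>\<^bsub>P\<^esub> p = p \<triangleleft>\<^bsub>P\<^esub> a"
      "\<And>q. q \<in> carrier Q \<Longrightarrow> a \<odot>\<^bsub>Q\<^esub> q = q \<triangleleft>\<^bsub>Q\<^esub> a"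
    using assms by (auto simp: central_over_def)
  from t show "a \<odot>\<^bsub>T\<^esub> t = t \<triangleleft>\<^bsub>T\<^esub> a"
  proof (induction rule: tensor_induct)
    case (pure p q)
    then show ?case
      using pure_balanced[of p a q] by (simp add: a smult_pure rsmult_pure)
  qed (simp add: a(1) T'.smult_r_distr T'.rsmult_l_distr)
qed

lemma partially_invertible_tensor:
  assumes "K \<subseteq> carrier R" "partially_invertible R K P" "partially_invertible R K Q"
  shows "partially_invertible R K T"
  using assms bimodule_tensor central_over_tensor fg_projective_tensor rank_le_one_tensor
  by (simp add: partially_invertible_iff)

end

lemma fg_projective_iso:
  assumes "bimod_iso R P P'" "fg_projective R P"
  shows "fg_projective R P'"
proof -
  obtain f g where f: "inverse_homs R P P' f g"
    using assms(1) by (rule bimod_isoE)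
  note D = bimod_homD[OF inverse_homsD(1)[OF f]] bimod_homD[OF inverse_homsD(2)[OF f]]
    inverse_homsD(4)[OF f]
  obtain n i s where i: "i \<in> left_hom R P (free_module R n)"
    and s: "s \<in> left_hom R (free_module R n) P"
    and si: "\<And>x. x \<in> carrier P \<Longrightarrow> s (i x) = x"
    using assms(2) by (auto simp: fg_projective_def)
  have "(\<lambda>x. i (g x)) \<in> left_hom R P' (free_module R n)" "(\<lambda>u. f (s u)) \<in> left_hom R (free_module R n) P'"
    using left_homD[OF i] left_homD[OF s] D by (auto simp: left_hom_def)
  moreover have "f (s (i (g x))) = x" if "x \<in> carrier P'" for x
    using si D that by simp
  ultimately show ?thesis
    unfolding fg_projective_def by (intro exI bexI ballI)
qed

lemma rank_le_one_iso:
  assumes "bimod_iso R P P'" "rank_le_one R P"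
  shows "rank_le_one R P'"
  unfolding rank_le_one_def
proof (intro allI impI ballI)
  obtain f g where f: "inverse_homs R P P' f g"
    using assms(1) by (rule bimod_isoE)
  note D = bimod_homD[OF inverse_homsD(1)[OF f]] bimod_homD[OF inverse_homsD(2)[OF f]]
    inverse_homsD(4)[OF f]
  fix F x y assume F: "linear_form R P' F" and xy: "x \<in> carrier P'" "y \<in> carrier P'"
  have "linear_form R P (\<lambda>x. F (f x))"
    using linear_formD[OF F] D by (intro linear_formI) auto
  then have "F (f (g x)) \<odot>\<^bsub>P\<^esub> g y = F (f (g y)) \<odot>\<^bsub>P\<^esub> g x"
    using assms(2) xy D(5) unfolding rank_le_one_def by blast
  then have "f (F (f (g x)) \<odot>\<^bsub>P\<^esub> g y) = f (F (f (g y)) \<odot>\<^bsub>P\<^esub> g x)"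
    by simp
  then show "F x \<odot>\<^bsub>P'\<^esub> y = F y \<odot>\<^bsub>P'\<^esub> x"
    using xy linear_formD[OF F] by (simp add: D)
qed

lemma central_over_iso:
  assumes "bimod_iso R P P'" "central_over K P" "K \<subseteq> carrier R"
  shows "central_over K P'"
  unfolding central_over_def
proof (intro ballI)
  obtain f g where f: "inverse_homs R P P' f g"
    using assms(1) by (rule bimod_isoE)
  note D = bimod_homD[OF inverse_homsD(1)[OF f]] bimod_homD[OF inverse_homsD(2)[OF f]]
    inverse_homsD(4)[OF f]
  fix a x assume a: "a \<in> K" and x: "x \<in> carrier P'"
  have "f (a \<odot>\<^bsub>P\<^esub> g x) = f (g x \<triangleleft>\<^bsub>P\<^esub> a)"
    using assms(2) a x D(5) by (simp add: central_over_def)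
  then show "a \<odot>\<^bsub>P'\<^esub> x = x \<triangleleft>\<^bsub>P'\<^esub> a"
    using a x assms(3) by (simp add: D subset_iff)
qed

lemma partially_invertible_iso:
  assumes "K \<subseteq> carrier R" "bimod_iso R P P'" "partially_invertible R K P"
  shows "partially_invertible R K P'"
proof -
  have "bimodule R P'"
    using assms(2) by (simp add: bimod_iso_def)
  then show ?thesis
    using assms fg_projective_iso rank_le_one_iso central_over_iso
    by (metis partially_invertible_iff)
qed

lemma bimod_class_eqI: "bimod_iso R P P' \<Longrightarrow> bimod_class R P = bimod_class R P'"
  unfolding bimod_class_def by (auto intro: bimod_iso_trans dest: bimod_iso_sym)

text \<open>Without projectivity both classes could be empty.\<close>

lemma bimod_iso_if_class_eq:
  assumes "bimodule R P" "fg_projective R P" "bimod_class R P = bimod_class R P'"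
  shows "bimod_iso R P P'"
proof -
  obtain Q where "Q \<in> bimod_class R P" "Q \<in> bimod_class R P'"
    using fg_projective_representative[OF assms(1,2)] assms(3) by blast
  then show ?thesis
    by (auto simp: bimod_class_def intro: bimod_iso_trans dest: bimod_iso_sym)
qed

lemma bimod_class_mult:
  assumes "bimodule R P" "fg_projective R P" "bimodule R Q" "fg_projective R Q"
  shows "bimod_class R P \<otimes>\<^bsub>PicS R K\<^esub> bimod_class R Q = bimod_class R (tensor R P Q)"
proof -
  have "bimod_class R (tensor R P' Q') = bimod_class R (tensor R P Q)"
    if "P' \<in> bimod_class R P" "Q' \<in> bimod_class R Q" for P' Q' :: "('a, nat \<Rightarrow> 'a) bimod"
    using that by (intro bimod_class_eqI[symmetric] tensor_cong) (simp_all add: bimod_class_def)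
  then show ?thesis
    using fg_projective_representative[OF assms(1,2)] fg_projective_representative[OF assms(3,4)]
    by (auto simp: PicS_def)
qed

lemma bimod_class_in_PicS:
  assumes "K \<subseteq> carrier R" "partially_invertible R K P"
  shows "bimod_class R P \<in> carrier (PicS R K)"
proof -
  obtain Q :: "('a, nat \<Rightarrow> 'a) bimod" where Q: "bimod_iso R P Q"
    using fg_projective_representative[of R P] assms(2)
    by (auto simp: partially_invertible_def bimod_class_def)
  then show ?thesis
    using partially_invertible_iso[OF assms(1) Q assms(2)] bimod_class_eqI[OF Q]
    by (auto simp: PicS_def)
qed

lemma PicS_carrierE:
  assumes "C \<in> carrier (PicS R K)"
  obtains P :: "('a, nat \<Rightarrow> 'a) bimod"
  where "C = bimod_class R P" "partially_invertible R K P" "bimodule R P" "fg_projective R P"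
  using assms by (auto simp: PicS_def partially_invertible_def)

lemma (in cring) partially_invertible_regular:
  assumes "K \<subseteq> carrier R"
  shows "partially_invertible R K (regular_bimod R)"
  unfolding partially_invertible_iff[OF assms]
proof (intro conjI bimodule_regular)
  interpret reg: bimodule R "regular_bimod R" by (rule bimodule_regular)
  have "dual_basis R (regular_bimod R) {()} (\<lambda>_ r. r) (\<lambda>_. \<one>)"
    unfolding dual_basis_def
  proof (intro conjI ballI)
    fix r assume r: "r \<in> carrier (regular_bimod R)"
    then have "r \<odot>\<^bsub>regular_bimod R\<^esub> \<one> = r"
      by (simp add: ideal_bimod_def)
    then show "(\<Oplus>\<^bsub>regular_bimod R\<^esub>i \<in> {()}. r \<odot>\<^bsub>regular_bimod R\<^esub> \<one>) = r"
      using reg.M.finsum_insert[of "{}" "()" "\<lambda>_. r"] r by simp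
  qed (auto simp: linear_form_def add_hom_def ideal_bimod_def)
  then show "fg_projective R (regular_bimod R)"
    by (rule fg_projectiveI[OF reg.module_axioms])
  have "F x \<otimes> y = F y \<otimes> x"
    if F: "linear_form R (regular_bimod R) F" and "x \<in> carrier R" "y \<in> carrier R" for F x y
  proof -
    have "F x = x \<otimes> F \<one>" "F y = y \<otimes> F \<one>" "F \<one> \<in> carrier R"
      using linear_formD(3)[OF F, of x \<one>] linear_formD(3)[OF F, of y \<one>] linear_formD(1)[OF F] that
      by (simp_all add: ideal_bimod_def)
    then show ?thesis
      using that by (simp add: m_ac)
  qed
  then show "rank_le_one R (regular_bimod R)"
    by (auto simp: rank_le_one_def ideal_bimod_def)
  show "central_over K (regular_bimod R)"
    using assms by (auto simp: central_over_def ideal_bimod_def m_comm)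
qed

lemma (in cring) monoid_PicS:
  assumes K: "K \<subseteq> carrier R"
  shows "monoid (PicS R K)"
proof (rule monoidI)
  have one: "\<one>\<^bsub>PicS R K\<^esub> = bimod_class R (regular_bimod R)"
    by (simp add: PicS_def)
  have reg: "bimodule R (regular_bimod R)" "fg_projective R (regular_bimod R)"
    using partially_invertible_regular[OF K] by (auto simp: partially_invertible_def)
  show "\<one>\<^bsub>PicS R K\<^esub> \<in> carrier (PicS R K)"
    unfolding one by (rule bimod_class_in_PicS[OF K partially_invertible_regular[OF K]])
  fix C assume "C \<in> carrier (PicS R K)"
  then obtain P :: "('a, nat \<Rightarrow> 'a) bimod"
    where P: "C = bimod_class R P" "partially_invertible R K P" "bimodule R P" "fg_projective R P"
    by (rule PicS_carrierE)
  show "\<one>\<^bsub>PicS R K\<^esub> \<otimes>\<^bsub>PicS R K\<^esub> C = C"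
    unfolding one P(1) bimod_class_mult[OF reg P(3,4)] by (rule bimod_class_eqI[OF left_unit_iso[OF P(3)]])
  show "C \<otimes>\<^bsub>PicS R K\<^esub> \<one>\<^bsub>PicS R K\<^esub> = C"
    unfolding one P(1) bimod_class_mult[OF P(3,4) reg] by (rule bimod_class_eqI[OF right_unit_iso[OF P(3)]])
  fix D assume "D \<in> carrier (PicS R K)"
  then obtain Q :: "('a, nat \<Rightarrow> 'a) bimod"
    where Q: "D = bimod_class R Q" "partially_invertible R K Q" "bimodule R Q" "fg_projective R Q"
    by (rule PicS_carrierE)
  interpret PQ: tensor_pair R P Q
    using P Q by (simp add: tensor_pair_def)
  show "C \<otimes>\<^bsub>PicS R K\<^esub> D \<in> carrier (PicS R K)"
    unfolding P(1) Q(1) bimod_class_mult[OF P(3,4) Q(3,4)]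
    by (rule bimod_class_in_PicS[OF K PQ.partially_invertible_tensor[OF K P(2) Q(2)]])
  fix E assume "E \<in> carrier (PicS R K)"
  then obtain W :: "('a, nat \<Rightarrow> 'a) bimod"
    where W: "E = bimod_class R W" "partially_invertible R K W" "bimodule R W" "fg_projective R W"
    by (rule PicS_carrierE)
  interpret QW: tensor_pair R Q W
    using Q W by (simp add: tensor_pair_def)
  show "C \<otimes>\<^bsub>PicS R K\<^esub> D \<otimes>\<^bsub>PicS R K\<^esub> E = C \<otimes>\<^bsub>PicS R K\<^esub> (D \<otimes>\<^bsub>PicS R K\<^esub> E)"
    unfolding P(1) Q(1) W(1) bimod_class_mult[OF P(3,4) Q(3,4)] bimod_class_mult[OF Q(3,4) W(3,4)]
      bimod_class_mult[OF PQ.bimodule_tensor PQ.fg_projective_tensor[OF P(4) Q(4)] W(3,4)]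
      bimod_class_mult[OF P(3,4) QW.bimodule_tensor QW.fg_projective_tensor[OF Q(4) W(4)]]
    by (rule bimod_class_eqI[OF tensor_assoc[OF P(3) Q(3) W(3)]])
qed


lemma (in cring) bimodule_endo: "nonunital_endo R \<theta> \<Longrightarrow> bimodule R (endo_bimod R \<theta>)"
  using bimodule.bimodule_pullback[OF bimodule_regular] .

section \<open>Classes of the bimodules of endomorphisms\<close>

lemma (in cring) endo_bimod_class_eqI:
  assumes "nonunital_endo R \<theta>" and "\<And>r. r \<in> carrier R \<Longrightarrow> \<eta> r = \<theta> r"
  shows "bimod_class R (endo_bimod R \<theta>) = bimod_class R (endo_bimod R \<eta>)"
  using assms by (intro bimod_class_eqI bimod_iso_if_actions_agree bimodule_endo)
    (auto simp: endo_bimod_simps)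

lemma (in cring) endo_bimod_class_mult:
  assumes \<theta>: "nonunital_endo R \<theta>" and \<theta>': "nonunital_endo R \<theta>'"
    and "fg_projective R (endo_bimod R \<theta>)" "fg_projective R (endo_bimod R \<theta>')"
    and "\<And>r. r \<in> carrier R \<Longrightarrow> \<eta> r = \<theta>' (\<theta> r)"
  shows "bimod_class R (endo_bimod R \<theta>) \<otimes>\<^bsub>PicS R K\<^esub> bimod_class R (endo_bimod R \<theta>') =
    bimod_class R (endo_bimod R \<eta>)"
proof -
  interpret reg: bimodule R "regular_bimod R"
    by (rule bimodule_regular)
  have "bimod_iso R (tensor R (endo_bimod R \<theta>) (endo_bimod R \<theta>'))
      (pullback_bimod R \<theta> (endo_bimod R \<theta>'))"
    by (rule pullback_tensor_iso[OF bimodule_endo[OF \<theta>'] \<theta>])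
  also have "bimod_iso R \<dots> (endo_bimod R \<eta>)"
    by (rule reg.pullback_pullback_iso[OF \<theta> \<theta>' assms(5)])
  finally show ?thesis
    unfolding bimod_class_mult[OF bimodule_endo[OF \<theta>] assms(3) bimodule_endo[OF \<theta>'] assms(4)]
    by (rule bimod_class_eqI)
qed

text \<open>The form \<open>\<psi>\<close> undoes the twist \<open>\<theta>\<close>: it embeds \<open>E(\<theta>)\<close> into \<open>R\<close> as a left module. Together with the
  single generator \<open>\<theta>(1)\<close> it is a dual basis, because \<open>\<theta>(\<psi>(d))\<theta>(1) = d\<close>.\<close>

lemma (in cring) partially_invertible_endo:
  assumes K: "K \<subseteq> carrier R" and \<theta>: "nonunital_endo R \<theta>"
    and \<psi>: "linear_form R (endo_bimod R \<theta>) \<psi>"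
    and \<theta>\<psi>: "\<And>d. d \<in> carrier (endo_bimod R \<theta>) \<Longrightarrow> \<theta> (\<psi> d) = d"
    and central: "\<And>k. k \<in> K \<Longrightarrow> \<theta> k = k \<otimes> \<theta> \<one>"
  shows "partially_invertible R K (endo_bimod R \<theta>)"
  unfolding partially_invertible_iff[OF K]
proof (intro conjI)
  let ?E = "endo_bimod R \<theta>"
  interpret E: bimodule R ?E by (rule bimodule_endo[OF \<theta>])
  show "bimodule R ?E" by (rule bimodule_endo[OF \<theta>])
  note \<theta>D = nonunital_endoD[OF \<theta>] and \<psi>D = linear_formD[OF \<psi>]
  have one: "\<theta> \<one> \<in> carrier ?E"
    using \<theta>D nonunital_endo_one[OF \<theta>] by (simp add: endo_bimod_simps)
  have expand: "\<psi> d \<odot>\<^bsub>?E\<^esub> \<theta> \<one> = d" if "d \<in> carrier ?E" for d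
    using that \<theta>\<psi>[OF that] \<theta>D(1)[OF one_closed] by (simp add: endo_bimod_simps m_comm[of d])
  have "dual_basis R ?E {()} (\<lambda>_. \<psi>) (\<lambda>_. \<theta> \<one>)"
    unfolding dual_basis_def
  proof (intro conjI ballI)
    fix d assume d: "d \<in> carrier ?E"
    then show "(\<Oplus>\<^bsub>?E\<^esub>i \<in> {()}. \<psi> d \<odot>\<^bsub>?E\<^esub> \<theta> \<one>) = d"
      using E.M.finsum_insert[of "{}" "()" "\<lambda>_. d"] by (simp add: expand)
  qed (use \<psi> one in auto)
  then show "fg_projective R ?E"
    by (rule fg_projectiveI[OF E.module_axioms])
  have "\<theta> (F x) \<otimes> y = \<theta> (F y) \<otimes> x"
    if F: "linear_form R ?E F" and xy: "x \<in> carrier ?E" "y \<in> carrier ?E" for F x y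
  proof -
    have \<theta>F: "\<theta> (F d) = d \<otimes> \<theta> (F (\<theta> \<one>))" if "d \<in> carrier ?E" for d
      using linear_formD(3)[OF F \<psi>D(1)[OF that] one] linear_formD(1)[OF F one] \<psi>D(1)[OF that] \<theta>\<psi>[OF that]
      by (simp add: expand[OF that] \<theta>D)
    have "\<theta> (F (\<theta> \<one>)) \<in> carrier R" "x \<in> carrier R" "y \<in> carrier R"
      using linear_formD(1)[OF F one] \<theta>D xy by (auto simp: endo_bimod_simps)
    then show ?thesis
      using \<theta>F xy by (simp add: m_ac)
  qed
  then show "rank_le_one R ?E"
    by (auto simp: rank_le_one_def endo_bimod_simps)
  show "central_over K ?E"
    unfolding central_over_def
  proof (intro ballI)
    fix k d assume k: "k \<in> K" and d: "d \<in> carrier ?E"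
    then have "k \<otimes> d = d \<otimes> k"
      using K by (intro m_comm) (auto simp: endo_bimod_simps)
    then show "k \<odot>\<^bsub>?E\<^esub> d = d \<triangleleft>\<^bsub>?E\<^esub> k"
      using K k d \<theta>D(1)[OF one_closed] by (auto simp: endo_bimod_simps central m_assoc)
  qed
qed

section \<open>The endomorphisms of a unital partial action\<close>

context unital_partial_action
begin

text \<open>This is \<open>\<theta>\<^sub>g\<close>, through which \<open>R\<close> acts on \<open>\<^sub>g(D\<^bsub>g\<^sup>-\<^sup>1\<^esub>)\<^sub>I\<close> from the left.\<close>

definition twist :: "'g \<Rightarrow> 'a \<Rightarrow> 'a"
  where "twist g r = \<alpha> (inv\<^bsub>G\<^esub> g) (r \<otimes>\<^bsub>R\<^esub> e g)"

lemma D_ideal_iff: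
  assumes g: "g \<in> carrier G"
  shows "d \<in> D_ideal R e g \<longleftrightarrow> d \<in> carrier R \<and> d \<otimes>\<^bsub>R\<^esub> e g = d"
  using idem_closed[OF g] idem[OF g]
  by (auto simp: D_ideal_def cgenideal_def R.m_assoc intro: exI[of _ d])

lemma D_prod_iff:
  assumes g: "g \<in> carrier G" and h: "h \<in> carrier G"
  shows "t \<in> D_ideal R e g \<cdot>\<^bsub>R\<^esub> D_ideal R e h \<longleftrightarrow> t \<in> carrier R \<and> t \<otimes>\<^bsub>R\<^esub> e g = t \<and> t \<otimes>\<^bsub>R\<^esub> e h = t"
proof
  have ideals: "ideal (D_ideal R e g) R" "ideal (D_ideal R e h) R"
    using g h by (simp_all add: D_ideal_def R.cgenideal_ideal idem_closed)
  show "t \<in> carrier R \<and> t \<otimes>\<^bsub>R\<^esub> e g = t \<and> t \<otimes>\<^bsub>R\<^esub> e h = t"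
    if "t \<in> D_ideal R e g \<cdot>\<^bsub>R\<^esub> D_ideal R e h"
    using subsetD[OF R.ideal_prod_inter[OF ideals] that] g h by (simp add: D_ideal_iff)
  assume t: "t \<in> carrier R \<and> t \<otimes>\<^bsub>R\<^esub> e g = t \<and> t \<otimes>\<^bsub>R\<^esub> e h = t"
  then have "t \<otimes>\<^bsub>R\<^esub> e h \<in> D_ideal R e g \<cdot>\<^bsub>R\<^esub> D_ideal R e h"
    using g h idem idem_closed by (intro ideal_prod.prod) (auto simp: D_ideal_iff)
  then show "t \<in> D_ideal R e g \<cdot>\<^bsub>R\<^esub> D_ideal R e h"
    using t by simp
qed

lemma e_one: "e \<one>\<^bsub>G\<^esub> = \<one>\<^bsub>R\<^esub>"
proof -
  have "\<one>\<^bsub>R\<^esub> \<in> D_ideal R e \<one>\<^bsub>G\<^esub>"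
    by (simp add: D_one)
  then show ?thesis
    using idem_closed[of "\<one>\<^bsub>G\<^esub>"] by (simp add: D_ideal_iff)
qed

lemma alpha_hom:
  assumes g: "g \<in> carrier G"
  shows "d \<in> D_ideal R e (inv\<^bsub>G\<^esub> g) \<Longrightarrow> \<alpha> g d \<in> D_ideal R e g"
    and "\<lbrakk>c \<in> D_ideal R e (inv\<^bsub>G\<^esub> g); d \<in> D_ideal R e (inv\<^bsub>G\<^esub> g)\<rbrakk> \<Longrightarrow>
      \<alpha> g (c \<oplus>\<^bsub>R\<^esub> d) = \<alpha> g c \<oplus>\<^bsub>R\<^esub> \<alpha> g d"
    and "\<lbrakk>c \<in> D_ideal R e (inv\<^bsub>G\<^esub> g); d \<in> D_ideal R e (inv\<^bsub>G\<^esub> g)\<rbrakk> \<Longrightarrow>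
      \<alpha> g (c \<otimes>\<^bsub>R\<^esub> d) = \<alpha> g c \<otimes>\<^bsub>R\<^esub> \<alpha> g d"
    and "\<alpha> g (e (inv\<^bsub>G\<^esub> g)) = e g"
proof -
  have hom: "\<alpha> g \<in> ring_hom (D_ring R e (inv\<^bsub>G\<^esub> g)) (D_ring R e g)"
    using ring_iso[OF g] by (simp add: ring_iso_def)
  show "d \<in> D_ideal R e (inv\<^bsub>G\<^esub> g) \<Longrightarrow> \<alpha> g d \<in> D_ideal R e g"
    using ring_hom_closed[OF hom, of d] by (simp add: D_ring_def)
  show "\<lbrakk>c \<in> D_ideal R e (inv\<^bsub>G\<^esub> g); d \<in> D_ideal R e (inv\<^bsub>G\<^esub> g)\<rbrakk> \<Longrightarrow>
      \<alpha> g (c \<oplus>\<^bsub>R\<^esub> d) = \<alpha> g c \<oplus>\<^bsub>R\<^esub> \<alpha> g d"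
    using ring_hom_add[OF hom, of c d] by (simp add: D_ring_def)
  show "\<lbrakk>c \<in> D_ideal R e (inv\<^bsub>G\<^esub> g); d \<in> D_ideal R e (inv\<^bsub>G\<^esub> g)\<rbrakk> \<Longrightarrow>
      \<alpha> g (c \<otimes>\<^bsub>R\<^esub> d) = \<alpha> g c \<otimes>\<^bsub>R\<^esub> \<alpha> g d"
    using ring_hom_mult[OF hom, of c d] by (simp add: D_ring_def)
  show "\<alpha> g (e (inv\<^bsub>G\<^esub> g)) = e g"
    using ring_hom_one[OF hom] by (simp add: D_ring_def)
qed

text \<open>Both sides are the identity element of the ring \<open>D\<^sub>gD\<^bsub>gh\<^esub>\<close>, which is the image of
  \<open>D\<^bsub>g\<^sup>-\<^sup>1\<^esub>D\<^sub>h\<close> under \<open>\<alpha>\<^sub>g\<close>.\<close>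

lemma alpha_unit:
  assumes g: "g \<in> carrier G" and h: "h \<in> carrier G"
  shows "\<alpha> g (e (inv\<^bsub>G\<^esub> g) \<otimes>\<^bsub>R\<^esub> e h) = e g \<otimes>\<^bsub>R\<^esub> e (g \<otimes>\<^bsub>G\<^esub> h)"
proof -
  let ?u = "e (inv\<^bsub>G\<^esub> g) \<otimes>\<^bsub>R\<^esub> e h" and ?v = "e g \<otimes>\<^bsub>R\<^esub> e (g \<otimes>\<^bsub>G\<^esub> h)"
  have ec: "e (inv\<^bsub>G\<^esub> g) \<in> carrier R" "e h \<in> carrier R" "e g \<in> carrier R" "e (g \<otimes>\<^bsub>G\<^esub> h) \<in> carrier R"
    using g h by (simp_all add: idem_closed)
  have ab: "(a \<otimes>\<^bsub>R\<^esub> b) \<otimes>\<^bsub>R\<^esub> a = a \<otimes>\<^bsub>R\<^esub> b \<and> (a \<otimes>\<^bsub>R\<^esub> b) \<otimes>\<^bsub>R\<^esub> b = a \<otimes>\<^bsub>R\<^esub> b"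
    if "a \<in> carrier R" "b \<in> carrier R" "a \<otimes>\<^bsub>R\<^esub> a = a" "b \<otimes>\<^bsub>R\<^esub> b = b" for a b
    using that by (metis R.m_assoc R.m_comm)
  have u: "?u \<in> D_ideal R e (inv\<^bsub>G\<^esub> g) \<cdot>\<^bsub>R\<^esub> D_ideal R e h"
    using g h ec ab[of "e (inv\<^bsub>G\<^esub> g)" "e h"] by (simp add: D_prod_iff idem)
  have "\<alpha> g ?u \<in> D_ideal R e g \<cdot>\<^bsub>R\<^esub> D_ideal R e (g \<otimes>\<^bsub>G\<^esub> h)"
    using u alpha_image[OF g h] by blast
  then have \<alpha>u: "\<alpha> g ?u \<in> carrier R" "\<alpha> g ?u \<otimes>\<^bsub>R\<^esub> ?v = \<alpha> g ?u"
    using g h ec by (simp_all add: D_prod_iff R.m_assoc[symmetric])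
  have "?v \<in> D_ideal R e g \<cdot>\<^bsub>R\<^esub> D_ideal R e (g \<otimes>\<^bsub>G\<^esub> h)"
    using g h ec ab[of "e g" "e (g \<otimes>\<^bsub>G\<^esub> h)"] by (simp add: D_prod_iff idem)
  then obtain t where t: "t \<in> D_ideal R e (inv\<^bsub>G\<^esub> g) \<cdot>\<^bsub>R\<^esub> D_ideal R e h" "?v = \<alpha> g t"
    using alpha_image[OF g h] by blast
  then have tu: "t \<in> carrier R" "t \<otimes>\<^bsub>R\<^esub> e (inv\<^bsub>G\<^esub> g) = t" "t \<otimes>\<^bsub>R\<^esub> ?u = t"
    using g h ec by (simp_all add: D_prod_iff R.m_assoc[symmetric])
  have "?v = \<alpha> g (t \<otimes>\<^bsub>R\<^esub> ?u)"
    using t tu by simp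
  also have "\<dots> = ?v \<otimes>\<^bsub>R\<^esub> \<alpha> g ?u"
    using t tu u g h by (subst alpha_hom(3)) (simp_all add: D_prod_iff D_ideal_iff)
  also have "\<dots> = \<alpha> g ?u"
    using \<alpha>u ec by (simp add: R.m_comm)
  finally show ?thesis ..
qed

lemma alpha_inverse:
  assumes g: "g \<in> carrier G" and d: "d \<in> D_ideal R e (inv\<^bsub>G\<^esub> g)"
  shows "\<alpha> (inv\<^bsub>G\<^esub> g) (\<alpha> g d) = d"
proof -
  have "d \<in> D_ideal R e (inv\<^bsub>G\<^esub> g) \<cdot>\<^bsub>R\<^esub> D_ideal R e (inv\<^bsub>G\<^esub> (inv\<^bsub>G\<^esub> g \<otimes>\<^bsub>G\<^esub> g))"
    using g d by (simp add: D_prod_iff D_ideal_iff e_one)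
  then show ?thesis
    using alpha_comp[of "inv\<^bsub>G\<^esub> g" g d] g d by (simp add: alpha_one D_ideal_iff)
qed

lemma mult_unit_in_D: "\<lbrakk>g \<in> carrier G; r \<in> carrier R\<rbrakk> \<Longrightarrow> r \<otimes>\<^bsub>R\<^esub> e g \<in> D_ideal R e g"
  by (simp add: D_ideal_iff idem_closed R.m_assoc idem)

lemma twist_in_D: "\<lbrakk>g \<in> carrier G; r \<in> carrier R\<rbrakk> \<Longrightarrow> twist g r \<in> D_ideal R e (inv\<^bsub>G\<^esub> g)"
  unfolding twist_def by (rule alpha_hom(1)) (simp_all add: mult_unit_in_D)

lemma twist_closed: "\<lbrakk>g \<in> carrier G; r \<in> carrier R\<rbrakk> \<Longrightarrow> twist g r \<in> carrier R"
  using twist_in_D[of g r] by (simp add: D_ideal_iff)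

lemma twist_unit: "\<lbrakk>g \<in> carrier G; r \<in> carrier R\<rbrakk> \<Longrightarrow> twist g r \<otimes>\<^bsub>R\<^esub> e (inv\<^bsub>G\<^esub> g) = twist g r"
  using twist_in_D[of g r] by (simp add: D_ideal_iff)

lemma nonunital_endo_twist:
  assumes g: "g \<in> carrier G"
  shows "nonunital_endo R (twist g)"
proof -
  have "twist g (r \<oplus>\<^bsub>R\<^esub> s) = twist g r \<oplus>\<^bsub>R\<^esub> twist g s" if "r \<in> carrier R" "s \<in> carrier R" for r s
    using that g unfolding twist_def
    by (simp add: R.l_distr idem_closed alpha_hom(2) mult_unit_in_D)
  moreover have "twist g (r \<otimes>\<^bsub>R\<^esub> s) = twist g r \<otimes>\<^bsub>R\<^esub> twist g s" if "r \<in> carrier R" "s \<in> carrier R" for r s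
  proof -
    have "(r \<otimes>\<^bsub>R\<^esub> s) \<otimes>\<^bsub>R\<^esub> e g = (r \<otimes>\<^bsub>R\<^esub> e g) \<otimes>\<^bsub>R\<^esub> (s \<otimes>\<^bsub>R\<^esub> e g)"
      using that idem_closed[OF g] idem[OF g] by (metis R.m_assoc R.m_comm R.m_closed)
    then show ?thesis
      using that g unfolding twist_def by (simp add: alpha_hom(3) mult_unit_in_D)
  qed
  ultimately show ?thesis
    using g by (simp add: nonunital_endo_def add_hom_def twist_closed)
qed

lemma twist_unit_elem:
  assumes g: "g \<in> carrier G" and h: "h \<in> carrier G"
  shows "twist g (e h) = e (inv\<^bsub>G\<^esub> g) \<otimes>\<^bsub>R\<^esub> e (inv\<^bsub>G\<^esub> g \<otimes>\<^bsub>G\<^esub> h)"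
  using alpha_unit[of "inv\<^bsub>G\<^esub> g" h] g h by (simp add: twist_def R.m_comm idem_closed)

lemma twist_one: "g \<in> carrier G \<Longrightarrow> twist g \<one>\<^bsub>R\<^esub> = e (inv\<^bsub>G\<^esub> g)"
  using alpha_hom(4)[of "inv\<^bsub>G\<^esub> g"] by (simp add: twist_def idem_closed)

lemma twist_at_one: "r \<in> carrier R \<Longrightarrow> twist \<one>\<^bsub>G\<^esub> r = r"
  by (simp add: twist_def e_one alpha_one)

text \<open>The composition law of the partial action holds only where both sides are defined. The factor
  \<open>1\<^sub>h\<close> that \<open>\<theta>\<^sub>h\<close> inserts is the image of \<open>1\<^sub>g1\<^bsub>gh\<^esub>\<close>, as far as \<open>D\<^bsub>g\<^sup>-\<^sup>1\<^esub>\<close> can see; this puts the argument of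
  \<open>\<alpha>\<^bsub>g\<^sup>-\<^sup>1\<^esub>\<close> into \<open>D\<^sub>gD\<^bsub>gh\<^esub>\<close>, where the law applies, and leaves \<open>1\<^bsub>h\<^sup>-\<^sup>1\<^esub>\<close> behind.\<close>

lemma twist_twist:
  assumes g: "g \<in> carrier G" and h: "h \<in> carrier G" and r: "r \<in> carrier R"
  shows "twist h (twist g r) = twist (g \<otimes>\<^bsub>G\<^esub> h) r \<otimes>\<^bsub>R\<^esub> e (inv\<^bsub>G\<^esub> h)"
proof -
  let ?g = "inv\<^bsub>G\<^esub> g" and ?h = "inv\<^bsub>G\<^esub> h" and ?gh = "g \<otimes>\<^bsub>G\<^esub> h"
  have ec: "e g \<in> carrier R" "e h \<in> carrier R" "e ?gh \<in> carrier R"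
    "e ?g \<in> carrier R" "e ?h \<in> carrier R"
    using g h by (simp_all add: idem_closed)
  let ?t = "(r \<otimes>\<^bsub>R\<^esub> e g) \<otimes>\<^bsub>R\<^esub> (e g \<otimes>\<^bsub>R\<^esub> e ?gh)"
  have eg: "e g \<otimes>\<^bsub>R\<^esub> e ?gh \<in> D_ideal R e g"
    using mult_unit_in_D[of g "e ?gh"] g h ec by (simp add: R.m_comm)
  have "twist g r \<otimes>\<^bsub>R\<^esub> e h = \<alpha> ?g (r \<otimes>\<^bsub>R\<^esub> e g) \<otimes>\<^bsub>R\<^esub> \<alpha> ?g (e g \<otimes>\<^bsub>R\<^esub> e ?gh)"
  proof -
    have "\<alpha> ?g (e g \<otimes>\<^bsub>R\<^esub> e ?gh) = e ?g \<otimes>\<^bsub>R\<^esub> e h"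
      using alpha_unit[of ?g ?gh] g h by (simp add: G.m_assoc[symmetric])
    moreover have "twist g r \<otimes>\<^bsub>R\<^esub> e h = twist g r \<otimes>\<^bsub>R\<^esub> (e ?g \<otimes>\<^bsub>R\<^esub> e h)"
      using g h r ec by (simp add: R.m_assoc[symmetric] twist_closed twist_unit)
    ultimately show ?thesis
      by (simp add: twist_def)
  qed
  also have "\<dots> = \<alpha> ?g ?t"
    using g r eg by (subst alpha_hom(3)) (simp_all add: mult_unit_in_D)
  finally have "twist h (twist g r) = \<alpha> ?h (\<alpha> ?g ?t)"
    by (simp add: twist_def[of h])
  also have "?t = (r \<otimes>\<^bsub>R\<^esub> e ?gh) \<otimes>\<^bsub>R\<^esub> (e ?gh \<otimes>\<^bsub>R\<^esub> e g)"
  proof -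
    have "?t = r \<otimes>\<^bsub>R\<^esub> (e g \<otimes>\<^bsub>R\<^esub> e g) \<otimes>\<^bsub>R\<^esub> e ?gh"
      using ec r by (simp add: R.m_assoc)
    also have "\<dots> = r \<otimes>\<^bsub>R\<^esub> e g \<otimes>\<^bsub>R\<^esub> (e ?gh \<otimes>\<^bsub>R\<^esub> e ?gh)"
      using g h by (simp add: idem)
    also have "\<dots> = (r \<otimes>\<^bsub>R\<^esub> e ?gh) \<otimes>\<^bsub>R\<^esub> (e ?gh \<otimes>\<^bsub>R\<^esub> e g)"
      using ec r by (simp add: R.m_ac)
    finally show ?thesis .
  qed
  finally have eq1: "twist h (twist g r) = \<alpha> ?h (\<alpha> ?g ((r \<otimes>\<^bsub>R\<^esub> e ?gh) \<otimes>\<^bsub>R\<^esub> (e ?gh \<otimes>\<^bsub>R\<^esub> e g)))" .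
  let ?s = "(r \<otimes>\<^bsub>R\<^esub> e ?gh) \<otimes>\<^bsub>R\<^esub> (e ?gh \<otimes>\<^bsub>R\<^esub> e g)"
  have inv_gh: "inv\<^bsub>G\<^esub> ?gh = ?h \<otimes>\<^bsub>G\<^esub> ?g"
    using g h by (simp add: G.inv_mult_group)
  have inv_hg: "inv\<^bsub>G\<^esub> (?h \<otimes>\<^bsub>G\<^esub> ?g) = ?gh"
    using g h by (simp add: G.inv_mult_group)
  have "?s \<otimes>\<^bsub>R\<^esub> e g = ?s" "?s \<otimes>\<^bsub>R\<^esub> e ?gh = ?s"
  proof -
    show "?s \<otimes>\<^bsub>R\<^esub> e g = ?s"
      using ec r g by (simp add: R.m_assoc idem)
    have "?s \<otimes>\<^bsub>R\<^esub> e ?gh = (r \<otimes>\<^bsub>R\<^esub> e g) \<otimes>\<^bsub>R\<^esub> (e ?gh \<otimes>\<^bsub>R\<^esub> (e ?gh \<otimes>\<^bsub>R\<^esub> e ?gh))"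
      using ec r by (simp add: R.m_ac)
    also have "\<dots> = (r \<otimes>\<^bsub>R\<^esub> e g) \<otimes>\<^bsub>R\<^esub> (e ?gh \<otimes>\<^bsub>R\<^esub> e ?gh)"
      using g h by (simp add: idem)
    also have "\<dots> = ?s"
      using ec r by (simp add: R.m_ac)
    finally show "?s \<otimes>\<^bsub>R\<^esub> e ?gh = ?s" .
  qed
  then have "?s \<in> D_ideal R e (inv\<^bsub>G\<^esub> ?g) \<cdot>\<^bsub>R\<^esub> D_ideal R e (inv\<^bsub>G\<^esub> (?h \<otimes>\<^bsub>G\<^esub> ?g))"
    using g h ec r by (simp add: D_prod_iff inv_hg)
  then have "\<alpha> ?h (\<alpha> ?g ?s) = \<alpha> (?h \<otimes>\<^bsub>G\<^esub> ?g) ?s"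
    using g h by (intro alpha_comp) simp_all
  also have "\<dots> = \<alpha> (?h \<otimes>\<^bsub>G\<^esub> ?g) (r \<otimes>\<^bsub>R\<^esub> e ?gh) \<otimes>\<^bsub>R\<^esub> \<alpha> (?h \<otimes>\<^bsub>G\<^esub> ?g) (e ?gh \<otimes>\<^bsub>R\<^esub> e g)"
    using g h ec r mult_unit_in_D[of ?gh "e g"]
    by (intro alpha_hom(3)) (simp_all add: inv_hg mult_unit_in_D R.m_comm)
  also have "\<alpha> (?h \<otimes>\<^bsub>G\<^esub> ?g) (e ?gh \<otimes>\<^bsub>R\<^esub> e g) = e (inv\<^bsub>G\<^esub> ?gh) \<otimes>\<^bsub>R\<^esub> e ?h"
    using alpha_unit[of "?h \<otimes>\<^bsub>G\<^esub> ?g" g] g h by (simp add: inv_hg inv_gh G.m_assoc)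
  also have "\<alpha> (?h \<otimes>\<^bsub>G\<^esub> ?g) (r \<otimes>\<^bsub>R\<^esub> e ?gh) = twist ?gh r"
    by (simp add: twist_def inv_gh)
  also have "twist ?gh r \<otimes>\<^bsub>R\<^esub> (e (inv\<^bsub>G\<^esub> ?gh) \<otimes>\<^bsub>R\<^esub> e ?h) = twist ?gh r \<otimes>\<^bsub>R\<^esub> e ?h"
    using g h ec r by (simp add: R.m_assoc[symmetric] idem_closed twist_closed twist_unit)
  finally show ?thesis
    by (simp add: eq1)
qed

lemma twist_inverse:
  assumes g: "g \<in> carrier G" and r: "r \<in> carrier R"
  shows "twist (inv\<^bsub>G\<^esub> g) (twist g r) = r \<otimes>\<^bsub>R\<^esub> e g"
  using twist_twist[of g "inv\<^bsub>G\<^esub> g" r] g r by (simp add: twist_at_one)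

section \<open>The classes of the twisted bimodules\<close>

lemma bimod_iso_twisted:
  assumes g: "g \<in> carrier G"
  shows "bimod_iso R (endo_bimod R (twist g)) (twisted_bimod G R e \<alpha> g)"
  using g by (intro bimod_iso_if_actions_agree R.bimodule_endo nonunital_endo_twist)
    (auto simp: endo_bimod_simps twisted_bimod_def D_ideal_iff twist_def[symmetric] twist_one
      idem_closed R.m_comm)

lemma \<Phi>\<^sub>0_eq:
  "g \<in> carrier G \<Longrightarrow> \<Phi>\<^sub>0 G R e \<alpha> g = bimod_class R (endo_bimod R (twist g))"
  unfolding \<Phi>\<^sub>0_def by (rule bimod_class_eqI[OF bimod_iso_sym[OF bimod_iso_twisted]])

lemma nonunital_endo_scale: "g \<in> carrier G \<Longrightarrow> nonunital_endo R (\<lambda>r. r \<otimes>\<^bsub>R\<^esub> e g)"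
  unfolding nonunital_endo_def add_hom_def
  using idem_closed[of g] idem[of g] by (auto simp: R.l_distr) (metis R.m_assoc R.m_comm R.m_closed)

lemma D_class_eq:
  assumes g: "g \<in> carrier G"
  shows "D_class R e g = bimod_class R (endo_bimod R (\<lambda>r. r \<otimes>\<^bsub>R\<^esub> e g))"
proof -
  have "bimod_iso R (endo_bimod R (\<lambda>r. r \<otimes>\<^bsub>R\<^esub> e g)) (ideal_bimod R (D_ideal R e g))"
  proof (intro bimod_iso_if_actions_agree R.bimodule_endo nonunital_endo_scale g)
    show "carrier (ideal_bimod R (D_ideal R e g)) = carrier (endo_bimod R (\<lambda>r. r \<otimes>\<^bsub>R\<^esub> e g))"
      using g idem_closed[OF g] by (auto simp: ideal_bimod_simps endo_bimod_simps D_ideal_iff R.m_comm)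
    fix a x assume "a \<in> carrier R" "x \<in> carrier (endo_bimod R (\<lambda>r. r \<otimes>\<^bsub>R\<^esub> e g))"
    then show "a \<odot>\<^bsub>ideal_bimod R (D_ideal R e g)\<^esub> x = a \<odot>\<^bsub>endo_bimod R (\<lambda>r. r \<otimes>\<^bsub>R\<^esub> e g)\<^esub> x"
      using g idem_closed[OF g] by (simp add: ideal_bimod_simps endo_bimod_simps R.m_assoc)
  qed (simp_all add: ideal_bimod_simps endo_bimod_simps)
  then show ?thesis
    unfolding D_class_def by (rule bimod_class_eqI[OF bimod_iso_sym])
qed

abbreviation invars where "invars \<equiv> invariants G R e \<alpha>"

lemma invariants_subset: "invars \<subseteq> carrier R"
  by (auto simp: invariants_def)

text \<open>The twist \<open>\<theta>\<^sub>g\<close> is undone by \<open>\<alpha>\<^sub>g\<close>, and on invariants it is multiplication by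
  \<open>1\<^bsub>g\<^sup>-\<^sup>1\<^esub>\<close>.\<close>

lemma partially_invertible_twist:
  assumes g: "g \<in> carrier G"
  shows "partially_invertible R invars (endo_bimod R (twist g))"
proof (rule R.partially_invertible_endo[OF invariants_subset nonunital_endo_twist[OF g]])
  have D: "d \<in> carrier (endo_bimod R (twist g)) \<longleftrightarrow> d \<in> D_ideal R e (inv\<^bsub>G\<^esub> g)" for d
    using g idem_closed[of "inv\<^bsub>G\<^esub> g"] by (auto simp: endo_bimod_simps twist_one D_ideal_iff R.m_comm)
  have \<alpha>D: "\<alpha> g d \<in> carrier R" "\<alpha> g d \<otimes>\<^bsub>R\<^esub> e g = \<alpha> g d" if "d \<in> D_ideal R e (inv\<^bsub>G\<^esub> g)" for d
    using alpha_hom(1)[OF g that] g by (simp_all add: D_ideal_iff)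
  show "linear_form R (endo_bimod R (twist g)) (\<alpha> g)"
  proof (rule linear_formI)
    fix a d assume a: "a \<in> carrier R" and "d \<in> carrier (endo_bimod R (twist g))"
    then have d: "d \<in> D_ideal R e (inv\<^bsub>G\<^esub> g)"
      by (simp add: D)
    have "\<alpha> g (twist g a \<otimes>\<^bsub>R\<^esub> d) = \<alpha> g (twist g a) \<otimes>\<^bsub>R\<^esub> \<alpha> g d"
      by (rule alpha_hom(3)[OF g twist_in_D[OF g a] d])
    also have "\<alpha> g (twist g a) = a \<otimes>\<^bsub>R\<^esub> e g"
      unfolding twist_def using alpha_inverse[of "inv\<^bsub>G\<^esub> g" "a \<otimes>\<^bsub>R\<^esub> e g"] g a by (simp add: mult_unit_in_D)
    also have "a \<otimes>\<^bsub>R\<^esub> e g \<otimes>\<^bsub>R\<^esub> \<alpha> g d = a \<otimes>\<^bsub>R\<^esub> \<alpha> g d"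
      using \<alpha>D[OF d] a idem_closed[OF g] by (simp add: R.m_assoc R.m_comm[of "e g"])
    finally show "\<alpha> g (a \<odot>\<^bsub>endo_bimod R (twist g)\<^esub> d) = a \<otimes>\<^bsub>R\<^esub> \<alpha> g d"
      by (simp add: endo_bimod_simps)
  qed (simp_all add: D \<alpha>D, simp add: endo_bimod_simps alpha_hom(2)[OF g])
  show "twist g (\<alpha> g d) = d" if "d \<in> carrier (endo_bimod R (twist g))" for d
    using that g by (simp add: D twist_def \<alpha>D alpha_inverse)
  show "twist g k = k \<otimes>\<^bsub>R\<^esub> twist g \<one>\<^bsub>R\<^esub>" if "k \<in> invars" for k
  proof -
    have "\<alpha> (inv\<^bsub>G\<^esub> g) (k \<otimes>\<^bsub>R\<^esub> e (inv\<^bsub>G\<^esub> (inv\<^bsub>G\<^esub> g))) = k \<otimes>\<^bsub>R\<^esub> e (inv\<^bsub>G\<^esub> g)"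
      using that g unfolding invariants_def by blast
    then show ?thesis
      using g by (simp add: twist_def[of g k] twist_one)
  qed
qed

lemma partially_invertible_scale:
  assumes K: "K \<subseteq> carrier R" and g: "g \<in> carrier G"
  shows "partially_invertible R K (endo_bimod R (\<lambda>r. r \<otimes>\<^bsub>R\<^esub> e g))"
proof (rule R.partially_invertible_endo[OF K nonunital_endo_scale[OF g]])
  have D: "d \<in> carrier (endo_bimod R (\<lambda>r. r \<otimes>\<^bsub>R\<^esub> e g)) \<longleftrightarrow> d \<in> carrier R \<and> d \<otimes>\<^bsub>R\<^esub> e g = d" for d
    using idem_closed[OF g] by (auto simp: endo_bimod_simps R.m_comm)
  show "linear_form R (endo_bimod R (\<lambda>r. r \<otimes>\<^bsub>R\<^esub> e g)) (\<lambda>d. d)"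
  proof (rule linear_formI)
    fix a d assume "a \<in> carrier R" "d \<in> carrier (endo_bimod R (\<lambda>r. r \<otimes>\<^bsub>R\<^esub> e g))"
    then show "a \<odot>\<^bsub>endo_bimod R (\<lambda>r. r \<otimes>\<^bsub>R\<^esub> e g)\<^esub> d = a \<otimes>\<^bsub>R\<^esub> d"
      using idem_closed[OF g] by (simp add: endo_bimod_simps R.m_assoc)
  qed (simp_all add: D, simp add: endo_bimod_simps)
qed (use K g idem_closed[OF g] in \<open>auto simp: endo_bimod_simps R.m_comm\<close>)

lemmas fg_twist = partially_invertible_twist[unfolded partially_invertible_def, THEN conjunct2, THEN conjunct2, THEN conjunct1]

lemma fg_scale: "g \<in> carrier G \<Longrightarrow> fg_projective R (endo_bimod R (\<lambda>r. r \<otimes>\<^bsub>R\<^esub> e g))"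
  using partially_invertible_scale[of "{}" g] by (simp add: partially_invertible_def)

lemma \<Phi>\<^sub>0_in_PicS: "g \<in> carrier G \<Longrightarrow> \<Phi>\<^sub>0 G R e \<alpha> g \<in> carrier (PicS R invars)"
  by (simp add: \<Phi>\<^sub>0_eq bimod_class_in_PicS[OF invariants_subset partially_invertible_twist])

text \<open>\<open>\<Phi>\<^sub>0\<close> is multiplicative up to the idempotent \<open>[D\<^bsub>h\<^sup>-\<^sup>1\<^esub>]\<close>: this is \<open>twist_twist\<close> read on classes.\<close>

lemma \<Phi>\<^sub>0_mult:
  assumes g: "g \<in> carrier G" and h: "h \<in> carrier G"
  shows "\<Phi>\<^sub>0 G R e \<alpha> g \<otimes>\<^bsub>PicS R K\<^esub> \<Phi>\<^sub>0 G R e \<alpha> h =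
    \<Phi>\<^sub>0 G R e \<alpha> (g \<otimes>\<^bsub>G\<^esub> h) \<otimes>\<^bsub>PicS R K\<^esub> D_class R e (inv\<^bsub>G\<^esub> h)"
  using g h
  by (simp add: \<Phi>\<^sub>0_eq D_class_eq
      R.endo_bimod_class_mult[OF nonunital_endo_twist nonunital_endo_twist fg_twist fg_twist refl]
      R.endo_bimod_class_mult[OF nonunital_endo_twist nonunital_endo_scale fg_twist fg_scale
        twist_twist[OF g h]])

text \<open>\<open>\<theta>\<^sub>g(r1\<^bsub>gh\<^esub>) = \<theta>\<^sub>g(r)1\<^bsub>g\<^sup>-\<^sup>1\<^esub>1\<^sub>h\<close>, and \<open>\<theta>\<^sub>g(r)\<close> absorbs \<open>1\<^bsub>g\<^sup>-\<^sup>1\<^esub>\<close>.\<close>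

lemma \<Phi>\<^sub>0_D_class:
  assumes g: "g \<in> carrier G" and h: "h \<in> carrier G"
  shows "\<Phi>\<^sub>0 G R e \<alpha> g \<otimes>\<^bsub>PicS R K\<^esub> D_class R e h = D_class R e (g \<otimes>\<^bsub>G\<^esub> h) \<otimes>\<^bsub>PicS R K\<^esub> \<Phi>\<^sub>0 G R e \<alpha> g"
proof -
  have gh: "g \<otimes>\<^bsub>G\<^esub> h \<in> carrier G"
    using g h by simp
  have comp: "twist g r \<otimes>\<^bsub>R\<^esub> e h = twist g (r \<otimes>\<^bsub>R\<^esub> e (g \<otimes>\<^bsub>G\<^esub> h))" if r: "r \<in> carrier R" for r
  proof -
    have "twist g (r \<otimes>\<^bsub>R\<^esub> e (g \<otimes>\<^bsub>G\<^esub> h)) = twist g r \<otimes>\<^bsub>R\<^esub> (e (inv\<^bsub>G\<^esub> g) \<otimes>\<^bsub>R\<^esub> e h)"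
      using g h r nonunital_endoD(3)[OF nonunital_endo_twist[OF g]] twist_unit_elem[OF g gh]
      by (simp add: idem_closed G.m_assoc[symmetric])
    then show ?thesis
      using g h r by (simp add: R.m_assoc[symmetric] idem_closed twist_closed twist_unit)
  qed
  show ?thesis
    using g h gh
    by (simp add: \<Phi>\<^sub>0_eq D_class_eq
        R.endo_bimod_class_mult[OF nonunital_endo_twist nonunital_endo_scale fg_twist fg_scale refl]
        R.endo_bimod_class_mult[OF nonunital_endo_scale nonunital_endo_twist fg_scale fg_twist comp])
qed

lemma \<Phi>\<^sub>0_one: "\<Phi>\<^sub>0 G R e \<alpha> \<one>\<^bsub>G\<^esub> = \<one>\<^bsub>PicS R K\<^esub>"
proof -
  have "bimod_iso R (regular_bimod R) (endo_bimod R (twist \<one>\<^bsub>G\<^esub>))"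
    by (intro bimod_iso_if_actions_agree R.bimodule_regular)
      (auto simp: endo_bimod_simps twist_at_one ideal_bimod_simps)
  then show ?thesis
    by (simp add: \<Phi>\<^sub>0_eq PicS_def bimod_class_eqI)
qed

lemma D_class_one: "D_class R e \<one>\<^bsub>G\<^esub> = \<one>\<^bsub>PicS R K\<^esub>"
  by (simp add: D_class_def PicS_def D_one)

lemma \<Phi>\<^sub>0_absorbs:
  assumes g: "g \<in> carrier G"
  shows "\<Phi>\<^sub>0 G R e \<alpha> g \<otimes>\<^bsub>PicS R K\<^esub> D_class R e (inv\<^bsub>G\<^esub> g) = \<Phi>\<^sub>0 G R e \<alpha> g"
proof -
  have "\<Phi>\<^sub>0 G R e \<alpha> g \<otimes>\<^bsub>PicS R K\<^esub> D_class R e (inv\<^bsub>G\<^esub> g) =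
      bimod_class R (endo_bimod R (\<lambda>r. twist g r \<otimes>\<^bsub>R\<^esub> e (inv\<^bsub>G\<^esub> g)))"
    using g by (simp add: \<Phi>\<^sub>0_eq D_class_eq
        R.endo_bimod_class_mult[OF nonunital_endo_twist nonunital_endo_scale fg_twist fg_scale refl])
  also have "\<dots> = \<Phi>\<^sub>0 G R e \<alpha> g"
    using g by (simp add: \<Phi>\<^sub>0_eq)
      (intro R.endo_bimod_class_eqI[symmetric] nonunital_endo_twist, simp_all add: twist_unit)
  finally show ?thesis .
qed

lemma \<Phi>\<^sub>0_\<Phi>\<^sub>0_inv:
  assumes g: "g \<in> carrier G"
  shows "\<Phi>\<^sub>0 G R e \<alpha> g \<otimes>\<^bsub>PicS R K\<^esub> \<Phi>\<^sub>0 G R e \<alpha> (inv\<^bsub>G\<^esub> g) = D_class R e g"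
  using g
  by (simp add: \<Phi>\<^sub>0_eq D_class_eq
      R.endo_bimod_class_mult[OF nonunital_endo_twist nonunital_endo_twist fg_twist fg_twist
        twist_inverse[symmetric]])

lemma partial_representation_\<Phi>\<^sub>0: "partial_representation G (PicS R invars) (\<Phi>\<^sub>0 G R e \<alpha>)"
proof (intro partial_representation.intro partial_representation_axioms.intro)
  let ?M = "PicS R invars" and ?\<Phi> = "\<Phi>\<^sub>0 G R e \<alpha>"
  interpret M: monoid ?M
    by (rule R.monoid_PicS[OF invariants_subset])
  show "group G" "monoid ?M" by unfold_locales
  show "?\<Phi> \<in> carrier G \<rightarrow> carrier ?M"
    by (simp add: \<Phi>\<^sub>0_in_PicS)
  show "?\<Phi> \<one>\<^bsub>G\<^esub> = \<one>\<^bsub>?M\<^esub>"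
    by (rule \<Phi>\<^sub>0_one)
  fix g h assume g: "g \<in> carrier G" and h: "h \<in> carrier G"
  let ?g = "inv\<^bsub>G\<^esub> g" and ?h = "inv\<^bsub>G\<^esub> h" and ?gh = "g \<otimes>\<^bsub>G\<^esub> h"
  note c = \<Phi>\<^sub>0_in_PicS g h
  have "?\<Phi> ?g \<otimes>\<^bsub>?M\<^esub> ?\<Phi> ?gh = ?\<Phi> h \<otimes>\<^bsub>?M\<^esub> D_class R e (inv\<^bsub>G\<^esub> ?gh)"
    using g h \<Phi>\<^sub>0_mult[of ?g ?gh] by (simp add: G.m_assoc[symmetric])
  also have "\<dots> = D_class R e ?g \<otimes>\<^bsub>?M\<^esub> ?\<Phi> h"
    using g h \<Phi>\<^sub>0_D_class[of h "inv\<^bsub>G\<^esub> ?gh"]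
    by (simp add: G.inv_mult_group G.m_assoc[symmetric])
  also have "\<dots> = ?\<Phi> ?g \<otimes>\<^bsub>?M\<^esub> ?\<Phi> g \<otimes>\<^bsub>?M\<^esub> ?\<Phi> h"
    using \<Phi>\<^sub>0_\<Phi>\<^sub>0_inv[of ?g] g by simp
  finally show "?\<Phi> ?g \<otimes>\<^bsub>?M\<^esub> ?\<Phi> g \<otimes>\<^bsub>?M\<^esub> ?\<Phi> h = ?\<Phi> ?g \<otimes>\<^bsub>?M\<^esub> ?\<Phi> ?gh" ..
  have "?\<Phi> ?gh \<otimes>\<^bsub>?M\<^esub> ?\<Phi> ?h = ?\<Phi> g \<otimes>\<^bsub>?M\<^esub> D_class R e h"
    using g h \<Phi>\<^sub>0_mult[of ?gh ?h] by (simp add: G.m_assoc)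
  also have "\<dots> = ?\<Phi> g \<otimes>\<^bsub>?M\<^esub> ?\<Phi> h \<otimes>\<^bsub>?M\<^esub> ?\<Phi> ?h"
    using c by (simp add: M.m_assoc \<Phi>\<^sub>0_\<Phi>\<^sub>0_inv)
  finally show "?\<Phi> g \<otimes>\<^bsub>?M\<^esub> ?\<Phi> h \<otimes>\<^bsub>?M\<^esub> ?\<Phi> ?h = ?\<Phi> ?gh \<otimes>\<^bsub>?M\<^esub> ?\<Phi> ?h" ..
qed

text \<open>\<open>P\<close> is isomorphic to \<open>D\<^sub>g \<otimes> Q\<close> for some \<open>Q\<close> that is central over \<open>R\<close>, and
  \<open>D\<^sub>g \<otimes> Q\<close> to \<open>1\<^sub>gQ\<close>.\<close>

lemma mem_X_setD:
  fixes P :: "('a, 'p) bimod"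
  assumes g: "g \<in> carrier G" and P: "bimodule R P" and "bimod_class R P \<in> X_set R e g"
  shows "partially_invertible R (carrier R) P" "\<And>x. x \<in> carrier P \<Longrightarrow> e g \<odot>\<^bsub>P\<^esub> x = x"
proof -
  let ?\<delta> = "\<lambda>r. r \<otimes>\<^bsub>R\<^esub> e g"
  obtain C where C: "C \<in> carrier (PicS R (carrier R))"
    and PC: "bimod_class R P = D_class R e g \<otimes>\<^bsub>PicS R (carrier R)\<^esub> C"
    using assms(3) by (auto simp: X_set_def l_coset_def)
  obtain Q :: "('a, nat \<Rightarrow> 'a) bimod" where Q: "C = bimod_class R Q"
    "partially_invertible R (carrier R) Q" "bimodule R Q" "fg_projective R Q"
    using C by (rule PicS_carrierE)
  interpret DQ: tensor_pair R "endo_bimod R ?\<delta>" Q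
    using Q(3) R.bimodule_endo[OF nonunital_endo_scale[OF g]] by (simp add: tensor_pair_def)
  have iso: "bimod_iso R (tensor R (endo_bimod R ?\<delta>) Q) (pullback_bimod R ?\<delta> Q)"
    by (rule pullback_tensor_iso[OF Q(3) nonunital_endo_scale[OF g]])
  have "partially_invertible R (carrier R) (tensor R (endo_bimod R ?\<delta>) Q)"
    by (rule DQ.partially_invertible_tensor[OF subset_refl partially_invertible_scale[OF subset_refl g] Q(2)])
  then have inv: "partially_invertible R (carrier R) (pullback_bimod R ?\<delta> Q)"
    by (rule partially_invertible_iso[OF subset_refl iso])
  have "bimod_class R P = bimod_class R (tensor R (endo_bimod R ?\<delta>) Q)"
    unfolding PC Q(1) D_class_eq[OF g]
    by (rule bimod_class_mult[OF DQ.P.bimodule_axioms fg_scale[OF g] Q(3,4)])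
  also have "\<dots> = bimod_class R (pullback_bimod R ?\<delta> Q)"
    by (rule bimod_class_eqI[OF iso])
  finally have iso': "bimod_iso R (pullback_bimod R ?\<delta> Q) P"
    using inv by (intro bimod_iso_if_class_eq) (auto simp: partially_invertible_def)
  show "partially_invertible R (carrier R) P"
    by (rule partially_invertible_iso[OF subset_refl iso' inv])
  fix x assume x: "x \<in> carrier P"
  obtain f f' where f: "inverse_homs R (pullback_bimod R ?\<delta> Q) P f f'"
    using iso' by (rule bimod_isoE)
  note fD = bimod_homD[OF inverse_homsD(1)[OF f]] and f'D = bimod_homD[OF inverse_homsD(2)[OF f]]
  have "e g \<odot>\<^bsub>pullback_bimod R ?\<delta> Q\<^esub> f' x = f' x"
    using f'D(1)[OF x] g idem_closed[OF g] idem[OF g] by (simp add: pullback_bimod_simps)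
  then have "e g \<odot>\<^bsub>P\<^esub> f (f' x) = f (f' x)"
    using fD(3)[OF idem_closed[OF g] f'D(1)[OF x]] by simp
  then show "e g \<odot>\<^bsub>P\<^esub> x = x"
    using inverse_homsD(4)[OF f x] by simp
qed

lemma conj_bimod_simps:
  "carrier (conj_bimod G R e \<alpha> P g) = carrier P"
  "\<zero>\<^bsub>conj_bimod G R e \<alpha> P g\<^esub> = \<zero>\<^bsub>P\<^esub>"
  "x \<oplus>\<^bsub>conj_bimod G R e \<alpha> P g\<^esub> y = x \<oplus>\<^bsub>P\<^esub> y"
  "r \<odot>\<^bsub>conj_bimod G R e \<alpha> P g\<^esub> x = twist g r \<odot>\<^bsub>P\<^esub> x"
  "x \<triangleleft>\<^bsub>conj_bimod G R e \<alpha> P g\<^esub> r = twist g r \<odot>\<^bsub>P\<^esub> x"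
  by (simp_all add: conj_bimod_def twist_def)

text \<open>By \<open>pullback_tensor_iso\<close> the tensor product of the first two factors is \<open>P\<close> with left action
  through \<open>\<theta>\<^sub>g\<close>, called \<open>W\<close> below. On \<open>W \<otimes> \<^bsub>g\<^sup>-\<^sup>1\<^esub>(D\<^sub>g)\<^sub>I\<close> the isomorphism is \<open>w \<otimes> d \<mapsto> \<theta>\<^sub>g(d)w\<close> with inverse
  \<open>w \<mapsto> w \<otimes> 1\<^sub>g\<close>. Both the balancedness of the first map and the fact that the second inverts it rest on
  \<open>\<theta>\<^sub>g\<close> and \<open>\<theta>\<^bsub>g\<^sup>-\<^sup>1\<^esub>\<close> being mutually inverse between the two ideals.\<close>

lemma conj_bimod_iso:
  fixes P :: "('a, 'p) bimod"
  assumes g: "g \<in> carrier G" and P: "bimodule R P" and central: "central_over (carrier R) P"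
    and unit: "\<And>x. x \<in> carrier P \<Longrightarrow> e (inv\<^bsub>G\<^esub> g) \<odot>\<^bsub>P\<^esub> x = x"
  shows "bimod_iso R (conj_bimod G R e \<alpha> P g)
    (tensor R (tensor R (twisted_bimod G R e \<alpha> g) P) (twisted_bimod G R e \<alpha> (inv\<^bsub>G\<^esub> g)))"
proof -
  interpret P: bimodule R P by (rule P)
  let ?\<theta> = "twist g" and ?\<theta>' = "twist (inv\<^bsub>G\<^esub> g)"
  let ?W = "pullback_bimod R ?\<theta> P" and ?E = "endo_bimod R ?\<theta>'" and ?C = "conj_bimod G R e \<alpha> P g"
  have g': "inv\<^bsub>G\<^esub> g \<in> carrier G" using g by simp
  have endo: "nonunital_endo R ?\<theta>" "nonunital_endo R ?\<theta>'"
    using g by (simp_all add: nonunital_endo_twist)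
  note \<theta>D = nonunital_endoD[OF endo(1)] and \<theta>'D = nonunital_endoD[OF endo(2)]
  have ec: "e g \<in> carrier R" "e (inv\<^bsub>G\<^esub> g) \<in> carrier R"
    using g by (simp_all add: idem_closed)
  have right: "x \<triangleleft>\<^bsub>P\<^esub> a = a \<odot>\<^bsub>P\<^esub> x" if "a \<in> carrier R" "x \<in> carrier P" for a x
    using central that by (simp add: central_over_def)
  have swap: "a \<odot>\<^bsub>P\<^esub> (b \<odot>\<^bsub>P\<^esub> x) = b \<odot>\<^bsub>P\<^esub> (a \<odot>\<^bsub>P\<^esub> x)"
    if "a \<in> carrier R" "b \<in> carrier R" "x \<in> carrier P" for a b x
    using that by (simp add: P.smult_assoc1[symmetric] R.m_comm)
  have W: "carrier ?W = carrier P"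
    using unit g by (auto simp: pullback_bimod_simps twist_one)
  have E: "d \<in> carrier ?E \<longleftrightarrow> d \<in> carrier R \<and> d \<otimes>\<^bsub>R\<^esub> e g = d" for d
    using g ec by (auto simp: endo_bimod_simps twist_one R.m_comm)
  have eE: "e g \<in> carrier ?E"
    using g by (simp add: E idem_closed idem)
  have C: "bimodule R ?C"
  proof (intro bimodule.intro bimodule_axioms.intro moduleI R.is_cring)
    show "abelian_group ?C"
    proof (rule abelian_groupI)
      fix x assume "x \<in> carrier ?C"
      then show "\<exists>y \<in> carrier ?C. y \<oplus>\<^bsub>?C\<^esub> x = \<zero>\<^bsub>?C\<^esub>"
        using P.M.l_neg[of x] by (intro bexI[of _ "\<ominus>\<^bsub>P\<^esub> x"]) (auto simp: conj_bimod_simps)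
    qed (auto simp: conj_bimod_simps P.M.a_ac)
  qed (use unit g in \<open>auto simp: conj_bimod_simps \<theta>D P.smult_l_distr P.smult_r_distr P.smult_assoc1
      twist_one swap\<close>)
  interpret WE: tensor_pair R ?W ?E
    using P.bimodule_pullback[OF endo(1)] R.bimodule_endo[OF endo(2)] by (simp add: tensor_pair_def)
  have pre: "bimod_iso R (tensor R ?W ?E) ?C"
  proof (rule WE.tensor_isoI[OF C])
    show "balanced R ?W ?E ?C (\<lambda>w d. ?\<theta> d \<odot>\<^bsub>P\<^esub> w)"
    proof (rule balancedI)
      fix w a d assume w: "w \<in> carrier ?W" and a: "a \<in> carrier R" and "d \<in> carrier ?E"
      then have d: "d \<in> carrier R" "?\<theta> d \<in> carrier R" and wP: "w \<in> carrier P"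
        using W \<theta>D by (auto simp: E)
      have "?\<theta> (?\<theta>' a \<otimes>\<^bsub>R\<^esub> d) = a \<otimes>\<^bsub>R\<^esub> e (inv\<^bsub>G\<^esub> g) \<otimes>\<^bsub>R\<^esub> ?\<theta> d"
        using twist_inverse[OF g' a] g a d by (simp add: \<theta>D \<theta>'D)
      also have "\<dots> = ?\<theta> d \<otimes>\<^bsub>R\<^esub> a"
        using twist_unit[OF g d(1)] a d ec by (metis R.m_assoc R.m_comm R.m_closed)
      finally show "?\<theta> d \<odot>\<^bsub>P\<^esub> (w \<triangleleft>\<^bsub>?W\<^esub> a) = ?\<theta> (a \<odot>\<^bsub>?E\<^esub> d) \<odot>\<^bsub>P\<^esub> w"
        using a d wP by (simp add: pullback_bimod_simps(5) endo_bimod_simps(4) right P.smult_assoc1)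
    qed (auto simp: W E conj_bimod_simps pullback_bimod_simps(3) endo_bimod_simps(3) ideal_bimod_simps(3) \<theta>D
        P.smult_r_distr P.smult_l_distr)
    show "(\<lambda>w. pure_tensor R ?W ?E w (e g)) \<in> add_hom ?C (tensor R ?W ?E)"
    proof (rule add_homI)
      fix x y assume "x \<in> carrier ?C" "y \<in> carrier ?C"
      then have "x \<in> carrier ?W" "y \<in> carrier ?W"
        by (simp_all add: W conj_bimod_simps)
      then show "pure_tensor R ?W ?E (x \<oplus>\<^bsub>?C\<^esub> y) (e g) =
          pure_tensor R ?W ?E x (e g) \<oplus>\<^bsub>tensor R ?W ?E\<^esub> pure_tensor R ?W ?E y (e g)"
        using WE.pure_add_left[OF _ _ eE, of x y] by (simp add: conj_bimod_simps pullback_bimod_simps(3))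
    qed (simp add: W conj_bimod_simps WE.pure_closed eE)
  next
    fix a w d assume "a \<in> carrier R" "w \<in> carrier ?W" "d \<in> carrier ?E"
    then show "?\<theta> d \<odot>\<^bsub>P\<^esub> (a \<odot>\<^bsub>?W\<^esub> w) = a \<odot>\<^bsub>?C\<^esub> (?\<theta> d \<odot>\<^bsub>P\<^esub> w)"
      "?\<theta> (d \<triangleleft>\<^bsub>?E\<^esub> a) \<odot>\<^bsub>P\<^esub> w = (?\<theta> d \<odot>\<^bsub>P\<^esub> w) \<triangleleft>\<^bsub>?C\<^esub> a"
      by (simp_all add: W E conj_bimod_simps pullback_bimod_simps(4) endo_bimod_simps(5) \<theta>D swap
          P.smult_assoc1)
  next
    fix w d assume w: "w \<in> carrier ?W" and d: "d \<in> carrier ?E"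
    then have dR: "d \<in> carrier R" "?\<theta> d \<in> carrier R" "d \<otimes>\<^bsub>R\<^esub> e g = d" and wP: "w \<in> carrier P"
      using W \<theta>D by (auto simp: E)
    have "?\<theta> d \<odot>\<^bsub>P\<^esub> w = w \<triangleleft>\<^bsub>?W\<^esub> ?\<theta> d"
      using dR wP by (simp add: pullback_bimod_simps(5) right)
    then have "pure_tensor R ?W ?E (?\<theta> d \<odot>\<^bsub>P\<^esub> w) (e g) = pure_tensor R ?W ?E w (?\<theta> d \<odot>\<^bsub>?E\<^esub> e g)"
      using WE.pure_balanced[OF w dR(2) eE] by simp
    also have "?\<theta> d \<odot>\<^bsub>?E\<^esub> e g = d"
      using twist_inverse[OF g dR(1)] dR by (simp add: endo_bimod_simps(4))
    finally show "pure_tensor R ?W ?E (?\<theta> d \<odot>\<^bsub>P\<^esub> w) (e g) = pure_tensor R ?W ?E w d" .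
  next
    fix w assume "w \<in> carrier ?C"
    then have "w \<in> carrier ?W" "w = ?\<theta> (e g) \<odot>\<^bsub>P\<^esub> w"
      using twist_unit_elem[OF g g] g ec unit by (simp_all add: W conj_bimod_simps e_one)
    then show "\<exists>w' \<in> carrier ?W. \<exists>d \<in> carrier ?E. w = ?\<theta> d \<odot>\<^bsub>P\<^esub> w'"
      using eE by blast
  qed
  have "bimod_iso R (tensor R (twisted_bimod G R e \<alpha> g) P) (tensor R (endo_bimod R ?\<theta>) P)"
    by (intro tensor_cong bimod_iso_sym[OF bimod_iso_twisted[OF g]] bimod_iso_refl P)
  also have "bimod_iso R \<dots> ?W"
    by (rule pullback_tensor_iso[OF P endo(1)])
  finally have "bimod_iso R (tensor R (tensor R (twisted_bimod G R e \<alpha> g) P) (twisted_bimod G R e \<alpha> (inv\<^bsub>G\<^esub> g)))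
      (tensor R ?W ?E)"
    by (intro tensor_cong bimod_iso_sym[OF bimod_iso_twisted[OF g']])
  also note pre
  finally show ?thesis
    by (rule bimod_iso_sym)
qed

end

section \<open>The partial representation and conjugation of bimodules\<close>

theorem proposition6p2:
  fixes G :: "('g, 'h) monoid_scheme" and R :: "('a, 'r) ring_scheme"
    and e :: "'g \<Rightarrow> 'a" and \<alpha> :: "'g \<Rightarrow> 'a \<Rightarrow> 'a"
  assumes "unital_partial_action G R e \<alpha>"
    and "finite (carrier G)"
    and "partial_Galois G R e \<alpha>"
  shows "(partial_representation G (PicS R (invariants G R e \<alpha>)) (\<Phi>\<^sub>0 G R e \<alpha>)) \<and>
    (\<forall>g \<in> carrier G.
      \<Phi>\<^sub>0 G R e \<alpha> g \<otimes>\<^bsub>PicS R (invariants G R e \<alpha>)\<^esub> \<Phi>\<^sub>0 G R e \<alpha> (inv\<^bsub>G\<^esub> g) = D_class R e g) \<and>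
    (\<forall>g \<in> carrier G. \<forall>h \<in> carrier G.
      \<Phi>\<^sub>0 G R e \<alpha> g \<otimes>\<^bsub>PicS R (invariants G R e \<alpha>)\<^esub> D_class R e h =
        D_class R e (g \<otimes>\<^bsub>G\<^esub> h) \<otimes>\<^bsub>PicS R (invariants G R e \<alpha>)\<^esub> \<Phi>\<^sub>0 G R e \<alpha> g) \<and>
    (\<forall>g \<in> carrier G.
      \<Phi>\<^sub>0 G R e \<alpha> g \<otimes>\<^bsub>PicS R (invariants G R e \<alpha>)\<^esub> D_class R e (inv\<^bsub>G\<^esub> g) = \<Phi>\<^sub>0 G R e \<alpha> g \<and>
      \<Phi>\<^sub>0 G R e \<alpha> g = D_class R e g \<otimes>\<^bsub>PicS R (invariants G R e \<alpha>)\<^esub> \<Phi>\<^sub>0 G R e \<alpha> g) \<and>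
    (\<forall>g \<in> carrier G. \<forall>P :: ('a, 'p) bimod.
      bimodule R P \<and> bimod_class R P \<in> X_set R e (inv\<^bsub>G\<^esub> g) \<longrightarrow>
        bimod_iso R (conj_bimod G R e \<alpha> P g)
          (tensor R (tensor R (twisted_bimod G R e \<alpha> g) P) (twisted_bimod G R e \<alpha> (inv\<^bsub>G\<^esub> g))) \<and>
        bimod_class R (conj_bimod G R e \<alpha> P g) =
          \<Phi>\<^sub>0 G R e \<alpha> g \<otimes>\<^bsub>PicS R (invariants G R e \<alpha>)\<^esub> bimod_class R P
            \<otimes>\<^bsub>PicS R (invariants G R e \<alpha>)\<^esub> \<Phi>\<^sub>0 G R e \<alpha> (inv\<^bsub>G\<^esub> g))"
proof (intro conjI ballI allI impI)
  interpret unital_partial_action G R e \<alpha> by (rule assms(1))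
  let ?M = "PicS R (invariants G R e \<alpha>)"
  interpret M: monoid ?M
    by (rule R.monoid_PicS[OF invariants_subset])
  show "partial_representation G ?M (\<Phi>\<^sub>0 G R e \<alpha>)"
    by (rule partial_representation_\<Phi>\<^sub>0)
  fix g assume g: "g \<in> carrier G"
  show "\<Phi>\<^sub>0 G R e \<alpha> g \<otimes>\<^bsub>?M\<^esub> \<Phi>\<^sub>0 G R e \<alpha> (inv\<^bsub>G\<^esub> g) = D_class R e g"
    by (rule \<Phi>\<^sub>0_\<Phi>\<^sub>0_inv[OF g])
  show "\<Phi>\<^sub>0 G R e \<alpha> g \<otimes>\<^bsub>?M\<^esub> D_class R e h = D_class R e (g \<otimes>\<^bsub>G\<^esub> h) \<otimes>\<^bsub>?M\<^esub> \<Phi>\<^sub>0 G R e \<alpha> g"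
    if "h \<in> carrier G" for h
    by (rule \<Phi>\<^sub>0_D_class[OF g that])
  show "\<Phi>\<^sub>0 G R e \<alpha> g \<otimes>\<^bsub>?M\<^esub> D_class R e (inv\<^bsub>G\<^esub> g) = \<Phi>\<^sub>0 G R e \<alpha> g"
    by (rule \<Phi>\<^sub>0_absorbs[OF g])
  show "\<Phi>\<^sub>0 G R e \<alpha> g = D_class R e g \<otimes>\<^bsub>?M\<^esub> \<Phi>\<^sub>0 G R e \<alpha> g"
    using \<Phi>\<^sub>0_D_class[OF g G.one_closed, of "invariants G R e \<alpha>"] g
    by (simp add: D_class_one[of "invariants G R e \<alpha>"] \<Phi>\<^sub>0_in_PicS)
  fix P :: "('a, 'p) bimod"
  assume P: "bimodule R P \<and> bimod_class R P \<in> X_set R e (inv\<^bsub>G\<^esub> g)"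
  have g': "inv\<^bsub>G\<^esub> g \<in> carrier G" using g by simp
  note X = mem_X_setD[OF g' conjunct1[OF P] conjunct2[OF P]]
  from X(1) have P': "bimodule R P" "fg_projective R P" "central_over (carrier R) P"
    by (simp_all add: partially_invertible_def)
  show iso: "bimod_iso R (conj_bimod G R e \<alpha> P g)
      (tensor R (tensor R (twisted_bimod G R e \<alpha> g) P) (twisted_bimod G R e \<alpha> (inv\<^bsub>G\<^esub> g)))"
    by (rule conj_bimod_iso[OF g P'(1,3) X(2)])
  have T: "bimodule R (twisted_bimod G R e \<alpha> k)" "fg_projective R (twisted_bimod G R e \<alpha> k)"
    if "k \<in> carrier G" for k
    using bimod_iso_twisted[OF that] fg_projective_iso[OF bimod_iso_twisted[OF that] fg_twist[OF that]]
    by (simp_all add: bimod_iso_def)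
  interpret TP: tensor_pair R "twisted_bimod G R e \<alpha> g" P
    using T[OF g] P' by (simp add: tensor_pair_def)
  show "bimod_class R (conj_bimod G R e \<alpha> P g) =
      \<Phi>\<^sub>0 G R e \<alpha> g \<otimes>\<^bsub>?M\<^esub> bimod_class R P \<otimes>\<^bsub>?M\<^esub> \<Phi>\<^sub>0 G R e \<alpha> (inv\<^bsub>G\<^esub> g)"
    unfolding \<Phi>\<^sub>0_def bimod_class_mult[OF T[OF g] P'(1,2)]
      bimod_class_mult[OF TP.bimodule_tensor TP.fg_projective_tensor[OF T(2)[OF g] P'(2)] T[OF g']]
    by (rule bimod_class_eqI[OF iso])
qed


end
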